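(* Let $\Gamma=\Gamma(S_{d_0},HF)$ be a finitely generated saturated directed group acting on $T_{\bar d}$ with $\bar d$ bounded, with step law $\mu$ (below), and let $L_{\Gamma,\mu}(n)=\mathbb{E}\|Y_n\|_\Sigma$ where $Y_n\sim\mu^{*n}$ and $\|\cdot\|_\Sigma$ is the word norm with respect to $\Sigma=S_{d_0}\cup HF$. Let $L_1,L_2:\mathbb N\to(0,\infty)$ satisfy $L_1(n)/L_{\Gamma,\mu}(n)\to\infty$ and $L_2(n)/n\to0$. Then there exist a finitely generated group $\Delta$ with a finite symmetric generating set $\Sigma'$, a surjective homomorphism $\pi:\Delta\to\Gamma$ mapping $\Sigma'$ bijectively onto $\Sigma$, a symmetric probability measure $\mu'$ supported on a finite set with $\pi_*\mu'=\mu$, and a constant $C$, such that, writing $L_{\Delta,\mu'}(n)=\mathbb{E}\|Y'_n\|_{\Sigma'}$ with $Y'_n\sim\mu'^{*n}$: (1) $L_{\Gamma,\mu}(n)\le L_{\Delta,\mu'}(n)\le Cn$ for all $n$; (2) $L_{\Delta,\mu'}(n_i)\le L_1(n_i)$ for an infinite sequence $n_i\to\infty$; (3) $L_{\Delta,\mu'}(m_i)\ge L_2(m_i)$ for an infinite sequence $m_i\to\infty$.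
   Context: $\bar d=(d_j)_{j\ge0}$ is a bounded sequence of integers $d_j\ge2$, $\sigma\bar d=(d_1,d_2,\dots)$. $T_{\bar d}$ is the spherically homogeneous rooted tree with vertices the finite sequences $i_1\dots i_k$, $i_j\in\{1,\dots,d_{j-1}\}$; $\partial T_{\bar d}$ its boundary; $1^\infty=111\dots$. Products of automorphisms follow $(gf)(x)=f(g(x))$. Each $g\in\mathrm{Aut}(T_{\bar d})$ is written $g=(g_1,\dots,g_{d_0})\tau$ ($g_t\in\mathrm{Aut}(T_{\sigma\bar d})$, $\tau\in S_{d_0}$, $g(ty)=\tau(t)g_t(y)$); rooted automorphisms form a copy of $S_{d_0}$. $H_{\bar d}$ is defined recursively: $h\in H_{\bar d}$ iff $h=(h',\sigma_2,\dots,\sigma_{d_0})$ with $h'\in H_{\sigma\bar d}$ and $\sigma_2,\dots,\sigma_{d_0}$ rooted automorphisms of $T_{\sigma\bar d}$; thus $H_{\bar d}\cong\prod_{l\ge1}S_{d_l}^{\,d_{l-1}-1}$. For a finite group $F$, $F\wr_{\partial T_{\bar d}}\mathrm{Aut}(T_{\bar d})=\{\varphi:\partial T_{\bar d}\to F\}\rtimes\mathrm{Aut}(T_{\bar d})$ with $(g.\varphi)(x)=\varphi(g(x))$ and $(\varphi g)(\varphi'g')=\varphi(g.\varphi')gg'$; $\varphi_f$ equals $f$ at $1^\infty$ and is trivial elsewhere. $\Gamma(S_{d_0},HF)$ is the subgroup generated by the rooted group $S_{d_0}$, a finite subgroup $H\le H_{\bar d}$ such that the pushforward of the uniform measure on $H$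 to each factor $S_{d_l}$ is uniform, and $\{\varphi_f:f\in F\}$; $HF\cong H\times F$. $\mu$ is the law of $sks'$ with $s,s'$ uniform on $S_{d_0}$, $k$ uniform on $HF$, independent. *)

theory Defs
  imports "HOL-Probability.Probability" "HOL-Algebra.Algebra" "HOL-Combinatorics.Permutations"
begin

definition tree_vertices :: "(nat \<Rightarrow> nat) \<Rightarrow> nat list set" where
  "tree_vertices d = {v. \<forall>j < length v. 1 \<le> v ! j \<and> v ! j \<le> d j}"

definition tree_boundary :: "(nat \<Rightarrow> nat) \<Rightarrow> (nat \<Rightarrow> nat) set" where
  "tree_boundary d = {x. \<forall>j. 1 \<le> x j \<and> x j \<le> d j}"

definition ones_ray :: "nat \<Rightarrow> nat" where "ones_ray = (\<lambda>_. 1)"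

text \<open>Automorphisms of the rooted tree: level- and prefix-preserving bijections of
  the vertex set (identity outside the vertex set, for extensionality).\<close>
definition tree_aut :: "(nat \<Rightarrow> nat) \<Rightarrow> (nat list \<Rightarrow> nat list) set" where
  "tree_aut d = {g. bij_betw g (tree_vertices d) (tree_vertices d)
      \<and> (\<forall>v\<in>tree_vertices d. length (g v) = length v \<and> (\<forall>k. g (take k v) = take k (g v)))
      \<and> (\<forall>v. v \<notin> tree_vertices d \<longrightarrow> g v = v)}"

definition aut_group :: "(nat \<Rightarrow> nat) \<Rightarrow> (nat list \<Rightarrow> nat list) monoid" where
  "aut_group d = \<lparr>carrier = tree_aut d, mult = (\<lambda>g f. f \<circ> g), one = id\<rparr>"

definition aut_bd :: "(nat list \<Rightarrow> nat list) \<Rightarrow> (nat \<Rightarrow> nat) \<Rightarrow> (nat \<Rightarrow> nat)" where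
  "aut_bd g x = (\<lambda>j. g (map x [0..<Suc j]) ! j)"

definition aut_label :: "(nat \<Rightarrow> nat) \<Rightarrow> (nat list \<Rightarrow> nat list) \<Rightarrow> nat list \<Rightarrow> nat \<Rightarrow> nat" where
  "aut_label d g v = (\<lambda>i. if 1 \<le> i \<and> i \<le> d (length v) then last (g (v @ [i])) else i)"

definition rooted_aut :: "(nat \<Rightarrow> nat) \<Rightarrow> (nat \<Rightarrow> nat) \<Rightarrow> nat list \<Rightarrow> nat list" where
  "rooted_aut d \<tau> = (\<lambda>v. if v \<in> tree_vertices d \<and> v \<noteq> [] then \<tau> (hd v) # tl v else v)"

text \<open>The group H_d, unfolded from its recursive definition
  h = (h', sigma_2, ..., sigma_d0), h' in H_(sigma d), sigma_t rooted:
  h is an automorphism whose labels are trivial everywhere except possibly at the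
  vertices 1^(l-1) t with l \<ge> 1 and 2 \<le> t \<le> d_(l-1).\<close>
definition special_vertex :: "nat list \<Rightarrow> bool" where
  "special_vertex v \<longleftrightarrow> v \<noteq> [] \<and> last v \<noteq> 1 \<and> (\<forall>j < length v - 1. v ! j = 1)"

definition H_group_set :: "(nat \<Rightarrow> nat) \<Rightarrow> (nat list \<Rightarrow> nat list) set" where
  "H_group_set d = {h \<in> tree_aut d. \<forall>v \<in> tree_vertices d.
       \<not> special_vertex v \<longrightarrow> aut_label d h v = id}"

text \<open>Wreath product F wr_{boundary} Aut(T_d): pairs (phi, g),
  (phi g)(phi' g') = phi (g.phi') g g', with (g.phi')(x) = phi'(g(x)).\<close>
definition wreath :: "('f, 'm) monoid_scheme \<Rightarrow> (nat \<Rightarrow> nat)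
    \<Rightarrow> (((nat \<Rightarrow> nat) \<Rightarrow> 'f) \<times> (nat list \<Rightarrow> nat list)) monoid" where
  "wreath F d = \<lparr>carrier = (tree_boundary d \<rightarrow>\<^sub>E carrier F) \<times> tree_aut d,
     mult = (\<lambda>(\<phi>, g) (\<phi>', g'). (\<lambda>x\<in>tree_boundary d. \<phi> x \<otimes>\<^bsub>F\<^esub> \<phi>' (aut_bd g x), g' \<circ> g)),
     one = (\<lambda>x\<in>tree_boundary d. \<one>\<^bsub>F\<^esub>, id)\<rparr>"

definition phi_f :: "('f, 'm) monoid_scheme \<Rightarrow> (nat \<Rightarrow> nat) \<Rightarrow> 'f
    \<Rightarrow> ((nat \<Rightarrow> nat) \<Rightarrow> 'f) \<times> (nat list \<Rightarrow> nat list)" where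
  "phi_f F d f = (\<lambda>x\<in>tree_boundary d. if x = ones_ray then f else \<one>\<^bsub>F\<^esub>, id)"

definition aut_el :: "('f, 'm) monoid_scheme \<Rightarrow> (nat \<Rightarrow> nat) \<Rightarrow> (nat list \<Rightarrow> nat list)
    \<Rightarrow> ((nat \<Rightarrow> nat) \<Rightarrow> 'f) \<times> (nat list \<Rightarrow> nat list)" where
  "aut_el F d g = (\<lambda>x\<in>tree_boundary d. \<one>\<^bsub>F\<^esub>, g)"

definition rooted_set :: "('f, 'm) monoid_scheme \<Rightarrow> (nat \<Rightarrow> nat)
    \<Rightarrow> (((nat \<Rightarrow> nat) \<Rightarrow> 'f) \<times> (nat list \<Rightarrow> nat list)) set" where
  "rooted_set F d = {aut_el F d (rooted_aut d \<tau>) | \<tau>. \<tau> permutes {1..d 0}}"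

text \<open>The subgroup HF = {phi_f h | h in H, f in F} (isomorphic to H x F).\<close>
definition HF_set :: "('f, 'm) monoid_scheme \<Rightarrow> (nat \<Rightarrow> nat) \<Rightarrow> (nat list \<Rightarrow> nat list) set
    \<Rightarrow> (((nat \<Rightarrow> nat) \<Rightarrow> 'f) \<times> (nat list \<Rightarrow> nat list)) set" where
  "HF_set F d H = {phi_f F d f \<otimes>\<^bsub>wreath F d\<^esub> aut_el F d h | f h. f \<in> carrier F \<and> h \<in> H}"

definition Gamma_grp :: "('f, 'm) monoid_scheme \<Rightarrow> (nat \<Rightarrow> nat) \<Rightarrow> (nat list \<Rightarrow> nat list) set
    \<Rightarrow> (((nat \<Rightarrow> nat) \<Rightarrow> 'f) \<times> (nat list \<Rightarrow> nat list)) monoid" where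
  "Gamma_grp F d H = (wreath F d)\<lparr>carrier := generate (wreath F d)
      (rooted_set F d \<union> aut_el F d ` H \<union> phi_f F d ` carrier F)\<rparr>"

definition Sigma_set :: "('f, 'm) monoid_scheme \<Rightarrow> (nat \<Rightarrow> nat) \<Rightarrow> (nat list \<Rightarrow> nat list) set
    \<Rightarrow> (((nat \<Rightarrow> nat) \<Rightarrow> 'f) \<times> (nat list \<Rightarrow> nat list)) set" where
  "Sigma_set F d H = rooted_set F d \<union> HF_set F d H"

definition step_law :: "('f, 'm) monoid_scheme \<Rightarrow> (nat \<Rightarrow> nat) \<Rightarrow> (nat list \<Rightarrow> nat list) set
    \<Rightarrow> (((nat \<Rightarrow> nat) \<Rightarrow> 'f) \<times> (nat list \<Rightarrow> nat list)) pmf" where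
  "step_law F d H =
     do { s \<leftarrow> pmf_of_set (rooted_set F d);
          k \<leftarrow> pmf_of_set (HF_set F d H);
          s' \<leftarrow> pmf_of_set (rooted_set F d);
          return_pmf (s \<otimes>\<^bsub>wreath F d\<^esub> k \<otimes>\<^bsub>wreath F d\<^esub> s') }"

fun conv_pow :: "('a, 'm) monoid_scheme \<Rightarrow> 'a pmf \<Rightarrow> nat \<Rightarrow> 'a pmf" where
  "conv_pow G \<mu> 0 = return_pmf \<one>\<^bsub>G\<^esub>"
| "conv_pow G \<mu> (Suc n) = bind_pmf (conv_pow G \<mu> n) (\<lambda>y. map_pmf (\<lambda>x. y \<otimes>\<^bsub>G\<^esub> x) \<mu>)"

definition word_norm :: "('a, 'm) monoid_scheme \<Rightarrow> 'a set \<Rightarrow> 'a \<Rightarrow> nat" where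
  "word_norm G S g = (LEAST n. \<exists>ws. length ws = n \<and> set ws \<subseteq> S
                                   \<and> foldr (\<lambda>a b. a \<otimes>\<^bsub>G\<^esub> b) ws \<one>\<^bsub>G\<^esub> = g)"

definition drift :: "('a, 'm) monoid_scheme \<Rightarrow> 'a set \<Rightarrow> 'a pmf \<Rightarrow> nat \<Rightarrow> real" where
  "drift G S \<mu> n = measure_pmf.expectation (conv_pow G \<mu> n) (\<lambda>g. real (word_norm G S g))"

end

theory Submission
  imports Defs
begin

text \<open>Let \<open>K\<^sub>k\<close> be the finite group of sections of \<open>HF\<close> at \<open>1\<^sup>k\<close>. A word of length less than \<open>k\<close> sees at each
  vertex of level \<open>k\<close> either only letters of \<open>S\<^bsub>d k\<^esub>\<close> or only letters of \<open>K\<^sub>k\<close>. Hence, if below level \<open>k\<close> the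
  action of \<open>\<Gamma>\<close> is replaced by an action of the free product of \<open>S\<^bsub>d k\<^esub>\<close> and \<open>K\<^sub>k\<close>, all relations of length
  less than \<open>k\<close> survive, whereas the drift becomes linear as soon as \<open>K\<^sub>k\<close> has at least three elements:
  by saturation the induced walk on the Bass-Serre tree makes uniform moves, and each change of the
  acting factor gains length on average. Truncating the tree gives finite quotients \<open>Q\<^sub>i\<close>, and
  \<open>\<Delta>\<close> is generated by the diagonal in \<open>\<Gamma> \<times> \<Prod>\<^sub>i Q\<^sub>i\<close> for rapidly growing parameters: \<open>Q\<^sub>i\<close> is invisible
  until its level is reached, then forces linear drift at one time, and in the long run only adds a
  bounded amount to the norm because it is finite.

  If some \<open>K\<^sub>k\<close> has two elements, then \<open>F\<close> is trivial, the tree is eventually binary and \<open>\<Gamma>\<close> is virtually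
  abelian (for instance infinite dihedral), so it has no such approximations. Then the construction is
  applied to the group with lamps in \<open>\<int>/2\<close> instead of \<open>F\<close>. Its drift is comparable to that of \<open>\<Gamma>\<close>, because
  the lamps lit up to time \<open>n\<close> lie in a ball of a Schreier graph of linear growth whose radius is the
  maximal norm up to time \<open>n\<close>. To keep the generating sets in bijection, the lamp generator is sent
  to the identity of \<open>\<Gamma>\<close>.\<close>

section \<open>Words, norms and drift\<close>

text \<open>Everything is computed on random words rather than on group elements: one word in the
  letters of \<Sigma> is read simultaneously in \<Gamma>, in the finite permutation groups and in
  the diagonal group, which couples the three walks. The parameters are interlocked. The actions
  already chosen are finite, so every relator of \<Gamma> acts on them like a relator of length at
  most some K; n is taken so large that L1 leaves room for K; the next level exceeds 6n + K, so that
  the new action and all later ones are trivial on the relators that matter at time n; m and the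
  truncation come from the linear drift of the new action. Norms are bounded from below only through
  functions on the acted set which a letter raises by at most 1, so no norm in a finite quotient has
  to be computed. Levels start at 4 so that relators of length up to 3 hold in all actions: inverse
  letters act inversely, and a product of two letters that is a letter stays one. The second fact
  makes it possible to thin out the generators of the lamp group without losing control of the
  drift.\<close>

definition wprod :: "('a, 'm) monoid_scheme \<Rightarrow> 'a list \<Rightarrow> 'a" where
  "wprod G ws = foldr (\<lambda>a b. a \<otimes>\<^bsub>G\<^esub> b) ws \<one>\<^bsub>G\<^esub>"

lemma wprod_Nil [simp]: "wprod G [] = \<one>\<^bsub>G\<^esub>"
  and wprod_Cons [simp]: "wprod G (a # ws) = a \<otimes>\<^bsub>G\<^esub> wprod G ws"
  by (simp_all add: wprod_def)

lemma word_norm_alt: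
  "word_norm G S g = (LEAST n. \<exists>ws. length ws = n \<and> set ws \<subseteq> S \<and> wprod G ws = g)"
  by (simp add: word_norm_def wprod_def)

lemma word_norm_le: "set ws \<subseteq> S \<Longrightarrow> word_norm G S (wprod G ws) \<le> length ws"
  unfolding word_norm_alt by (rule Least_le) auto

context group begin

lemma wprod_closed [simp]: "set ws \<subseteq> carrier G \<Longrightarrow> wprod G ws \<in> carrier G"
  by (induction ws) auto

lemma wprod_append: "set us \<subseteq> carrier G \<Longrightarrow> set vs \<subseteq> carrier G \<Longrightarrow>
    wprod G (us @ vs) = wprod G us \<otimes> wprod G vs"
  by (induction us) (auto simp: m_assoc)

lemma wprod_rev_inv: "set ws \<subseteq> carrier G \<Longrightarrow> wprod G (rev (map (\<lambda>a. inv a) ws)) = inv (wprod G ws)"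
proof (induction ws)
  case (Cons a ws)
  have "set (map (\<lambda>a. inv a) ws) \<subseteq> carrier G" using Cons.prems by auto
  then show ?case using Cons by (simp add: wprod_append inv_mult_group)
qed simp

lemma wprod_in_generate: "set ws \<subseteq> S \<Longrightarrow> wprod G ws \<in> generate G S"
  by (induction ws) (auto intro: generate.intros)

lemma generate_eq_wprod:
  assumes S: "S \<subseteq> carrier G" and inv: "\<And>s. s \<in> S \<Longrightarrow> inv s \<in> S"
  shows "generate G S = wprod G ` {ws. set ws \<subseteq> S}"
proof (intro equalityI subsetI)
  fix g assume "g \<in> generate G S"
  then show "g \<in> wprod G ` {ws. set ws \<subseteq> S}"
  proof induction
    case one
    show ?case by (rule image_eqI[of _ _ "[]"]) auto
  next
    case (incl h)
    then show ?case using S by (intro image_eqI[of _ _ "[h]"]) auto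
  next
    case (inv h)
    then have "inv h \<in> S" "inv h \<in> carrier G" using assms by auto
    then show ?case by (intro image_eqI[of _ _ "[inv h]"]) auto
  next
    case (eng h1 h2)
    then obtain u v where "set u \<subseteq> S" "h1 = wprod G u" "set v \<subseteq> S" "h2 = wprod G v" by auto
    then show ?case using S by (intro image_eqI[of _ _ "u @ v"]) (auto simp: wprod_append)
  qed
qed (auto intro: wprod_in_generate)

end

lemma wprod_hom:
  assumes "group G" "group K" "h \<in> hom G K" "set ws \<subseteq> carrier G"
  shows "wprod K (map h ws) = h (wprod G ws)"
proof -
  interpret group_hom G K h using assms by (simp add: group_hom_def group_hom_axioms_def)
  show ?thesis using assms(4) by (induction ws) auto
qed

locale marked_group = group G for G (structure) +
  fixes S :: "'a set"
  assumes fin_S: "finite S" and S_carrier: "S \<subseteq> carrier G"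
    and inv_S: "s \<in> S \<Longrightarrow> inv s \<in> S" and gen_S: "generate G S = carrier G"
begin

lemma carrier_wprod: "carrier G = wprod G ` {ws. set ws \<subseteq> S}"
  using generate_eq_wprod[OF S_carrier inv_S] gen_S by simp

lemma word_norm_attained:
  assumes "g \<in> carrier G"
  obtains ws where "length ws = word_norm G S g" "set ws \<subseteq> S" "wprod G ws = g"
proof -
  have "\<exists>n ws. length ws = n \<and> set ws \<subseteq> S \<and> wprod G ws = g"
    using assms carrier_wprod by auto
  from LeastI_ex[OF this] show ?thesis using that unfolding word_norm_alt by blast
qed

lemma word_norm_one [simp]: "word_norm G S \<one> = 0"
  using word_norm_le[of "[]" S G] by simp

lemma word_norm_mult:
  assumes "g \<in> carrier G" "h \<in> carrier G"
  shows "word_norm G S (g \<otimes> h) \<le> word_norm G S g + word_norm G S h"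
proof -
  obtain u where u: "length u = word_norm G S g" "set u \<subseteq> S" "wprod G u = g"
    using word_norm_attained[OF assms(1)] .
  obtain v where v: "length v = word_norm G S h" "set v \<subseteq> S" "wprod G v = h"
    using word_norm_attained[OF assms(2)] .
  have "wprod G (u @ v) = g \<otimes> h" using u v S_carrier by (subst wprod_append) auto
  with word_norm_le[of "u @ v" S G] u v show ?thesis by simp
qed

lemma word_norm_inv_le:
  assumes "g \<in> carrier G"
  shows "word_norm G S (inv g) \<le> word_norm G S g"
proof -
  obtain u where u: "length u = word_norm G S g" "set u \<subseteq> S" "wprod G u = g"
    using word_norm_attained[OF assms(1)] .
  have "wprod G (rev (map (\<lambda>a. inv a) u)) = inv g" using u S_carrier by (subst wprod_rev_inv) auto
  with word_norm_le[of "rev (map (\<lambda>a. inv a) u)" S G] u inv_S show ?thesis by auto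
qed

lemma word_norm_inv [simp]:
  assumes "g \<in> carrier G"
  shows "word_norm G S (inv g) = word_norm G S g"
  using word_norm_inv_le[OF assms] word_norm_inv_le[of "inv g"] assms by force

lemma word_norm_pos: "g \<in> carrier G \<Longrightarrow> g \<noteq> \<one> \<Longrightarrow> 1 \<le> word_norm G S g"
  by (metis length_0_conv not_less_eq_eq le0 nat_le_linear One_nat_def le_zero_eq word_norm_attained wprod_Nil)

end

lemma word_norm_hom_le:
  assumes "marked_group G S" "marked_group K T" "h \<in> hom G K" "h ` S \<subseteq> T" "g \<in> carrier G"
  shows "word_norm K T (h g) \<le> word_norm G S g"
proof -
  interpret G: marked_group G S by fact
  interpret K: marked_group K T by fact
  obtain u where u: "length u = word_norm G S g" "set u \<subseteq> S" "wprod G u = g"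
    using G.word_norm_attained[OF assms(5)] .
  have "wprod K (map h u) = h g"
    using wprod_hom[OF G.is_group K.is_group assms(3), of u] u G.S_carrier by auto
  moreover have "set (map h u) \<subseteq> T" using u assms(4) by auto
  ultimately show ?thesis using word_norm_le[of "map h u" T K] u by simp
qed

section \<open>Convolution powers and their expectations\<close>

lemma finite_set_conv_pow: "finite (set_pmf \<mu>) \<Longrightarrow> finite (set_pmf (conv_pow G \<mu> n))"
  by (induction n) auto

lemma (in group) conv_pow_carrier: "set_pmf \<mu> \<subseteq> carrier G \<Longrightarrow> set_pmf (conv_pow G \<mu> n) \<subseteq> carrier G"
  by (induction n) (auto simp: subset_iff)

lemma conv_pow_hom:
  assumes G: "group G" and K: "group K" and h: "h \<in> hom G K" and mu: "set_pmf \<mu> \<subseteq> carrier G"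
  shows "conv_pow K (map_pmf h \<mu>) n = map_pmf h (conv_pow G \<mu> n)"
proof (induction n)
  interpret group_hom G K h using assms by (simp add: group_hom_def group_hom_axioms_def)
  case 0
  show ?case by simp
next
  interpret group_hom G K h using assms by (simp add: group_hom_def group_hom_axioms_def)
  case (Suc n)
  have "h y \<otimes>\<^bsub>K\<^esub> h x = h (y \<otimes>\<^bsub>G\<^esub> x)" if "y \<in> set_pmf (conv_pow G \<mu> n)" "x \<in> set_pmf \<mu>" for x y
    using that G.conv_pow_carrier[OF mu] mu by (subst hom_mult) auto
  then show ?case unfolding conv_pow.simps Suc
    by (auto simp: bind_map_pmf map_bind_pmf map_pmf_comp intro!: bind_pmf_cong map_pmf_cong)
qed

lemma pmf_expectation_mono:
  fixes f g :: "'a \<Rightarrow> real"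
  assumes "finite (set_pmf p)" "\<And>x. x \<in> set_pmf p \<Longrightarrow> f x \<le> g x"
  shows "measure_pmf.expectation p f \<le> measure_pmf.expectation p g"
  using assms by (intro integral_mono_AE integrable_measure_pmf_finite) (auto simp: AE_measure_pmf_iff)

lemma pmf_expectation_cong:
  fixes f g :: "'a \<Rightarrow> real"
  assumes "\<And>x. x \<in> set_pmf p \<Longrightarrow> f x = g x"
  shows "measure_pmf.expectation p f = measure_pmf.expectation p g"
  using assms by (intro integral_cong_AE) (auto simp: AE_measure_pmf_iff)

lemma expectation_bind_pmf:
  fixes f :: "'b \<Rightarrow> real"
  assumes "finite (set_pmf p)" "\<And>x. x \<in> set_pmf p \<Longrightarrow> finite (set_pmf (q x))"
  shows "measure_pmf.expectation (bind_pmf p q) f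
       = measure_pmf.expectation p (\<lambda>x. measure_pmf.expectation (q x) f)"
  using assms
  by (subst pmf_expectation_bind[OF assms(1) assms(2)], simp, simp)
     (simp add: integral_measure_pmf[OF assms(1)])

text \<open>Serves twice: for the projection to \<Gamma> it is the lower estimate in (1), and
  applied to an isomorphism and its inverse it shows that the copy on \<open>nat\<close> has the
  same drift.\<close>

lemma drift_hom_le:
  assumes "marked_group G S" "marked_group K T" "h \<in> hom G K" "h ` S \<subseteq> T"
    and "set_pmf \<mu> \<subseteq> carrier G" "finite (set_pmf \<mu>)"
  shows "drift K T (map_pmf h \<mu>) n \<le> drift G S \<mu> n"
proof -
  interpret G: marked_group G S by fact
  interpret K: marked_group K T by fact
  show ?thesis unfolding drift_def
    using G.conv_pow_carrier[OF assms(5), of n] assms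
    by (simp add: conv_pow_hom[OF G.is_group K.is_group])
       (intro pmf_expectation_mono finite_set_conv_pow, auto intro!: word_norm_hom_le)
qed

lemma drift_le_linear:
  assumes "marked_group G S" and mu: "set_pmf \<mu> \<subseteq> carrier G" "finite (set_pmf \<mu>)"
    and B: "\<And>x. x \<in> set_pmf \<mu> \<Longrightarrow> word_norm G S x \<le> B"
  shows "drift G S \<mu> n \<le> B * real n"
proof (induction n)
  interpret marked_group G S by fact
  case 0
  show ?case by (simp add: drift_def)
next
  interpret marked_group G S by fact
  case (Suc n)
  note fin = finite_set_conv_pow[OF mu(2), of G n]
  have "drift G S \<mu> (Suc n) = measure_pmf.expectation (conv_pow G \<mu> n)
      (\<lambda>y. measure_pmf.expectation \<mu> (\<lambda>x. real (word_norm G S (y \<otimes>\<^bsub>G\<^esub> x))))"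
    using fin mu by (simp add: drift_def expectation_bind_pmf)
  also have "\<dots> \<le> measure_pmf.expectation (conv_pow G \<mu> n)
      (\<lambda>y. measure_pmf.expectation \<mu> (\<lambda>x. real (word_norm G S y) + B))"
  proof (intro pmf_expectation_mono fin mu)
    fix y x assume yx: "y \<in> set_pmf (conv_pow G \<mu> n)" "x \<in> set_pmf \<mu>"
    then have "y \<in> carrier G" "x \<in> carrier G" using mu conv_pow_carrier[OF mu(1)] by auto
    from word_norm_mult[OF this] B[OF yx(2)]
    show "real (word_norm G S (y \<otimes>\<^bsub>G\<^esub> x)) \<le> real (word_norm G S y) + B" by linarith
  qed
  also have "\<dots> = drift G S \<mu> n + B"
    using fin by (simp add: drift_def integrable_measure_pmf_finite)
  finally show ?case using Suc by (simp add: algebra_simps)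
qed

text \<open>The letters are kept instead of their product, so that the same random word can be
  evaluated in several groups and actions. One step contributes a whole word.\<close>

primrec word_law :: "'a list pmf \<Rightarrow> nat \<Rightarrow> 'a list pmf" where
  "word_law \<nu> 0 = return_pmf []"
| "word_law \<nu> (Suc n) = bind_pmf (word_law \<nu> n) (\<lambda>u. map_pmf (\<lambda>v. u @ v) \<nu>)"

lemma finite_set_word_law: "finite (set_pmf \<nu>) \<Longrightarrow> finite (set_pmf (word_law \<nu> n))"
  by (induction n) auto

lemma word_law_set:
  "(\<And>w. w \<in> set_pmf \<nu> \<Longrightarrow> set w \<subseteq> S) \<Longrightarrow> w \<in> set_pmf (word_law \<nu> n) \<Longrightarrow> set w \<subseteq> S"
proof (induction n arbitrary: w)
  case (Suc n)
  then obtain u v where "u \<in> set_pmf (word_law \<nu> n)" "v \<in> set_pmf \<nu>" "w = u @ v" by auto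
  with Suc.IH[of u] Suc.prems(1)[of v] Suc.prems(1) show ?case by auto
qed simp

lemma word_law_length:
  "(\<And>w. w \<in> set_pmf \<nu> \<Longrightarrow> length w \<le> b) \<Longrightarrow> w \<in> set_pmf (word_law \<nu> n) \<Longrightarrow> length w \<le> b * n"
proof (induction n arbitrary: w)
  case (Suc n)
  then obtain u v where "u \<in> set_pmf (word_law \<nu> n)" "v \<in> set_pmf \<nu>" "w = u @ v" by auto
  with Suc.IH[of u] Suc.prems(1)[of v] Suc.prems(1) have "length u \<le> b * n" "length v \<le> b" by auto
  with \<open>w = u @ v\<close> show ?case by simp
qed simp

lemma (in group) conv_pow_word_law:
  assumes "\<And>w. w \<in> set_pmf \<nu> \<Longrightarrow> set w \<subseteq> carrier G"
  shows "conv_pow G (map_pmf (wprod G) \<nu>) n = map_pmf (wprod G) (word_law \<nu> n)"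
proof (induction n)
  case (Suc n)
  have "wprod G u \<otimes> wprod G v = wprod G (u @ v)" if "u \<in> set_pmf (word_law \<nu> n)" "v \<in> set_pmf \<nu>" for u v
    using word_law_set[OF assms that(1)] assms[OF that(2)] by (simp add: wprod_append)
  then show ?case
    by (auto simp: Suc bind_map_pmf map_bind_pmf map_pmf_comp intro!: bind_pmf_cong map_pmf_cong)
qed simp

lemma drift_word_law:
  assumes "group G" "\<And>w. w \<in> set_pmf \<nu> \<Longrightarrow> set w \<subseteq> carrier G"
  shows "drift G S (map_pmf (wprod G) \<nu>) n
       = measure_pmf.expectation (word_law \<nu> n) (\<lambda>w. real (word_norm G S (wprod G w)))"
  unfolding drift_def by (subst group.conv_pow_word_law[OF assms]) simp_all

lemma wprod_update_carrier [simp]: "wprod (G\<lparr>carrier := U\<rparr>) ws = wprod G ws"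
  by (simp add: wprod_def)

lemma word_norm_update_carrier [simp]: "word_norm (G\<lparr>carrier := U\<rparr>) S g = word_norm G S g"
  by (simp add: word_norm_def)

section \<open>Marked subgroups, isomorphic copies and symmetry\<close>

lemma (in group) marked_group_generate:
  assumes "finite S" "S \<subseteq> carrier G" "\<And>s. s \<in> S \<Longrightarrow> inv s \<in> S"
  shows "marked_group (G\<lparr>carrier := generate G S\<rparr>) S"
proof -
  have sub: "subgroup (generate G S) G" using generate_is_subgroup[OF assms(2)] .
  have SS: "S \<subseteq> generate G S" by (auto intro: generate.incl)
  show ?thesis
  proof (intro marked_group.intro marked_group_axioms.intro)
    show "group (G\<lparr>carrier := generate G S\<rparr>)" using subgroup.subgroup_is_group[OF sub is_group] .
    show "inv\<^bsub>G\<lparr>carrier := generate G S\<rparr>\<^esub> s \<in> S" if "s \<in> S" for s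
      using assms(3)[OF that] m_inv_consistent[OF sub, of s] that SS by auto
    show "generate (G\<lparr>carrier := generate G S\<rparr>) S = carrier (G\<lparr>carrier := generate G S\<rparr>)"
      using generate_consistent[OF SS sub] by simp
  qed (use assms SS in auto)
qed

lemma marked_group_iso:
  assumes "marked_group G S" "group K" "h \<in> iso G K"
  shows "marked_group K (h ` S)"
proof -
  interpret G: marked_group G S by fact
  interpret K: group K by fact
  interpret group_hom G K h using assms(3) G.is_group K.is_group
    by (simp add: group_hom_def group_hom_axioms_def iso_def)
  have "generate K (h ` S) = carrier K"
    using generate_img[OF G.S_carrier] G.gen_S assms(3) by (auto simp: iso_def bij_betw_def)
  moreover have "inv\<^bsub>K\<^esub> (h s) \<in> h ` S" if "s \<in> S" for s
    using G.inv_S[OF that] that G.S_carrier hom_inv[of s] by (metis image_eqI subsetD)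
  ultimately show ?thesis
    using G.fin_S G.S_carrier by unfold_locales auto
qed

lemma (in marked_group) countable_carrier: "countable (carrier G)"
proof -
  have "{ws. set ws \<subseteq> S} = lists S" by (auto simp: in_lists_conv_set)
  then show ?thesis unfolding carrier_wprod using fin_S
    by (simp add: countable_lists countable_finite)
qed

text \<open>A group with a finite generating set is countable, so its structure can be transported
  along an injection into \<open>nat\<close>, the type on which the final \<Delta> has to
  live.\<close>

lemma (in marked_group) nat_copy:
  obtains \<Delta> :: "nat monoid" and f where "group \<Delta>" "f \<in> iso G \<Delta>"
proof -
  define f where "f = to_nat_on (carrier G)"
  define e where "e = inv_into (carrier G) f"
  have inj: "inj_on f (carrier G)" unfolding f_def by (rule inj_on_to_nat_on[OF countable_carrier])
  have e: "e (f x) = x" if "x \<in> carrier G" for x using inj that by (simp add: e_def)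
  define \<Delta> where "\<Delta> = \<lparr>carrier = f ` carrier G, mult = (\<lambda>x y. f (e x \<otimes> e y)), one = f \<one>\<rparr>"
  have "group \<Delta>"
  proof (rule groupI)
    fix x assume "x \<in> carrier \<Delta>"
    then obtain g where g: "g \<in> carrier G" "x = f g" by (auto simp: \<Delta>_def)
    show "\<exists>y\<in>carrier \<Delta>. y \<otimes>\<^bsub>\<Delta>\<^esub> x = \<one>\<^bsub>\<Delta>\<^esub>"
      by (rule bexI[of _ "f (inv g)"]) (use g in \<open>auto simp: \<Delta>_def e\<close>)
  qed (auto simp: \<Delta>_def e m_assoc)
  moreover have "f \<in> iso G \<Delta>"
    using inj by (auto simp: \<Delta>_def iso_def hom_def bij_betw_def e)
  ultimately show ?thesis using that by blast
qed

lemma pmf_inv_symmetric: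
  assumes "group G" "set_pmf \<mu> \<subseteq> carrier G" "map_pmf (\<lambda>x. inv\<^bsub>G\<^esub> x) \<mu> = \<mu>" "x \<in> carrier G"
  shows "pmf \<mu> (inv\<^bsub>G\<^esub> x) = pmf \<mu> x"
proof -
  interpret group G by fact
  have "pmf \<mu> (inv\<^bsub>G\<^esub> x) = pmf (map_pmf (\<lambda>x. inv\<^bsub>G\<^esub> x) \<mu>) (inv\<^bsub>G\<^esub> x)" using assms by simp
  also have "\<dots> = measure \<mu> ((\<lambda>x. inv\<^bsub>G\<^esub> x) -` {inv\<^bsub>G\<^esub> x})" by (simp add: pmf_map)
  also have "\<dots> = measure \<mu> {x}"
    using assms(2,4) by (intro measure_pmf.finite_measure_eq_AE) (auto simp: AE_measure_pmf_iff)
  finally show ?thesis by (simp add: measure_pmf_single)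
qed

text \<open>Products are read from left to right, as in \<open>aut_group\<close>: the left factor
  acts first. With this order the product of the permutations of a word is the one given by
  \<open>run\<close>.\<close>

definition sym_grp :: "('x \<Rightarrow> 'x) monoid" where
  "sym_grp = \<lparr>carrier = {f. bij f}, mult = (\<lambda>g f. f \<circ> g), one = id\<rparr>"

lemma group_sym_grp: "group sym_grp"
proof (rule groupI)
  fix x :: "'a \<Rightarrow> 'a" assume "x \<in> carrier sym_grp"
  then show "\<exists>y\<in>carrier sym_grp. y \<otimes>\<^bsub>sym_grp\<^esub> x = \<one>\<^bsub>sym_grp\<^esub>"
    by (intro bexI[of _ "inv_into UNIV x"])
       (auto simp: sym_grp_def bij_imp_bij_inv bij_is_surj fun_eq_iff bij_is_surj surj_f_inv_f)
qed (auto simp: sym_grp_def bij_comp comp_assoc)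

definition run :: "('s \<Rightarrow> 'z \<Rightarrow> 'z) \<Rightarrow> 's list \<Rightarrow> 'z \<Rightarrow> 'z" where
  "run A ws z = foldl (\<lambda>z s. A s z) z ws"

lemma run_Nil [simp]: "run A [] z = z"
  and run_Cons [simp]: "run A (s # ws) z = run A ws (A s z)"
  and run_append [simp]: "run A (us @ vs) z = run A vs (run A us z)"
  by (simp_all add: run_def)

lemma run_permutes: "(\<And>s. s \<in> S \<Longrightarrow> A s permutes Z) \<Longrightarrow> set ws \<subseteq> S \<Longrightarrow> run A ws permutes Z"
proof (induction ws)
  case Nil
  have "run A [] = id" by (simp add: fun_eq_iff)
  then show ?case by (simp only: permutes_id)
next
  case (Cons s ws)
  have "run A (s # ws) = run A ws \<circ> A s" by (simp add: fun_eq_iff)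
  moreover have "run A ws permutes Z" "A s permutes Z" using Cons by auto
  ultimately show ?case by (simp only: permutes_compose)
qed

text \<open>This is how norms are bounded from below: the growth of such a function under a word is
  at most the length of every word acting in the same way.\<close>

lemma run_lipschitz:
  fixes \<rho> :: "'z \<Rightarrow> nat"
  shows "(\<And>s z. s \<in> S \<Longrightarrow> \<rho> (A s z) \<le> \<rho> z + 1) \<Longrightarrow> set ws \<subseteq> S \<Longrightarrow> \<rho> (run A ws z) \<le> \<rho> z + length ws"
proof (induction ws arbitrary: z)
  case (Cons s ws)
  from Cons.IH[of "A s z"] Cons.prems(1)[of s z] Cons.prems show ?case by fastforce
qed simp

section \<open>Diagonal products\<close>

text \<open>A step is a random word; 3 is the number of letters of \<open>s k s'\<close>. Symmetry
  is demanded at the level of words, under reversal with inverted letters, so that it can be passed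
  on to the diagonal group.\<close>

locale symmetric_walk = marked_group G S for G (structure) and S +
  fixes \<nu> :: "'a list pmf"
  assumes fin_nu: "finite (set_pmf \<nu>)"
    and nu_S: "w \<in> set_pmf \<nu> \<Longrightarrow> set w \<subseteq> S"
    and nu_len: "w \<in> set_pmf \<nu> \<Longrightarrow> length w \<le> 3"
    and nu_sym: "map_pmf (\<lambda>w. rev (map (\<lambda>a. inv a) w)) \<nu> = \<nu>"
begin

lemma wprod_S: "set w \<subseteq> S \<Longrightarrow> wprod G w \<in> carrier G"
  using S_carrier by (intro wprod_closed) auto

lemma wprod_S_append: "set u \<subseteq> S \<Longrightarrow> set v \<subseteq> S \<Longrightarrow> wprod G (u @ v) = wprod G u \<otimes> wprod G v"
  using S_carrier by (intro wprod_append) auto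

end

text \<open>The groups approximating \<open>G\<close> are given by finite permutation actions \<open>act k L\<close> of the
  letters in which every relation of \<open>G\<close> of length less than \<open>k\<close> holds; \<open>L\<close> is a truncation
  parameter, which has to be large compared with the times at which linear drift is seen.\<close>
locale approximated_group = symmetric_walk G S \<nu> for G (structure) and S and \<nu> :: "'a list pmf" +
  fixes act :: "nat \<Rightarrow> nat \<Rightarrow> 'a \<Rightarrow> 'z \<Rightarrow> 'z" and Z :: "nat \<Rightarrow> nat \<Rightarrow> 'z set"
  assumes fin_Z: "finite (Z k L)"
    and act_permutes: "4 \<le> k \<Longrightarrow> s \<in> S \<Longrightarrow> act k L s permutes Z k L"
    and act_local: "set w \<subseteq> S \<Longrightarrow> length w < k \<Longrightarrow> wprod G w = \<one> \<Longrightarrow> 4 \<le> k \<Longrightarrow> run (act k L) w z = z"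
    and act_drift: "4 \<le> k \<Longrightarrow> \<exists>c>0. \<forall>N. \<exists>n\<ge>N. \<exists>L z\<^sub>0. \<exists>\<rho>::'z \<Rightarrow> nat.
        (\<forall>s\<in>S. \<forall>z. \<rho> (act k L s z) \<le> \<rho> z + 1) \<and>
        c * real n \<le> measure_pmf.expectation (word_law \<nu> n) (\<lambda>w. real (\<rho> (run (act k L) w z\<^sub>0)))
                      - real (\<rho> z\<^sub>0)"
begin

declare wprod_S [simp]

abbreviation inv_word :: "'a list \<Rightarrow> 'a list" where "inv_word w \<equiv> rev (map (\<lambda>a. inv a) w)"

lemma inv_word_S: "set w \<subseteq> S \<Longrightarrow> set (inv_word w) \<subseteq> S"
  using inv_S by auto

lemma wprod_inv_word: "set w \<subseteq> S \<Longrightarrow> wprod G (inv_word w) = inv (wprod G w)"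
  using S_carrier by (intro wprod_rev_inv) auto

text \<open>\<open>[s, inv s]\<close> is a relator of length 2, below every admissible level, so the
  letter \<open>inv s\<close> acts as the inverse permutation although \<open>act\<close> is not
  assumed to be a homomorphism.\<close>

lemma act_inv: "4 \<le> k \<Longrightarrow> s \<in> S \<Longrightarrow> act k L (inv s) (act k L s z) = z"
  using act_local[of "[s, inv s]" k L z] inv_S[of s] S_carrier by auto

lemma run_inv_word: "4 \<le> k \<Longrightarrow> set w \<subseteq> S \<Longrightarrow> run (act k L) (inv_word w) (run (act k L) w z) = z"
  by (induction w arbitrary: z) (auto simp: act_inv)

lemma run_inv_word': "4 \<le> k \<Longrightarrow> set w \<subseteq> S \<Longrightarrow> run (act k L) w (run (act k L) (inv_word w) z) = z"
proof (induction w arbitrary: z)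
  case (Cons a w)
  have "act k L a (act k L (inv a) y) = y" for y
    using act_inv[of k "inv a" L y] Cons.prems inv_S[of a] S_carrier by auto
  then show ?case using Cons by auto
qed simp

text \<open>Finitely many actions on finite sets admit only finitely many tuples of permutations.
  For each tuple realised by a relator of G one such relator is fixed, and K is the largest of their
  lengths.\<close>

lemma kernel_bound:
  assumes "\<And>p. p \<in> set ps \<Longrightarrow> 4 \<le> fst p"
  obtains K where "\<And>w. set w \<subseteq> S \<Longrightarrow> wprod G w = \<one> \<Longrightarrow> \<exists>u. set u \<subseteq> S \<and> length u \<le> K \<and> wprod G u = \<one> \<and>
      (\<forall>p\<in>set ps. \<forall>z. run (act (fst p) (snd p)) u z = run (act (fst p) (snd p)) w z)"
proof -
  define \<Phi> where "\<Phi> w = restrict (\<lambda>p. run (act (fst p) (snd p)) w) (set ps)" for w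
  define T where "T = {w. set w \<subseteq> S \<and> wprod G w = \<one>}"
  have "\<Phi> ` T \<subseteq> PiE (set ps) (\<lambda>p. {q. q permutes Z (fst p) (snd p)})"
    using assms by (auto simp: \<Phi>_def T_def intro!: run_permutes[of S] act_permutes)
  moreover have "finite (PiE (set ps) (\<lambda>p. {q. q permutes Z (fst p) (snd p)}))"
    by (intro finite_PiE finite_permutations fin_Z) auto
  ultimately have fin: "finite (\<Phi> ` T)" by (rule finite_subset)
  define r where "r q = (SOME u. u \<in> T \<and> \<Phi> u = q)" for q
  have r: "r q \<in> T \<and> \<Phi> (r q) = q" if "q \<in> \<Phi> ` T" for q
    unfolding r_def by (rule someI_ex[of "\<lambda>u. u \<in> T \<and> \<Phi> u = q"]) (use that in auto)
  define K where "K = Max (insert 0 ((length \<circ> r) ` \<Phi> ` T))"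
  show ?thesis
  proof (rule that[of K])
    fix w assume w: "set w \<subseteq> S" "wprod G w = \<one>"
    then have q: "\<Phi> w \<in> \<Phi> ` T" by (auto simp: T_def)
    from r[OF q] have u: "r (\<Phi> w) \<in> T" "\<Phi> (r (\<Phi> w)) = \<Phi> w" by auto
    have "length (r (\<Phi> w)) \<le> K" unfolding K_def using fin q by (intro Max_ge) auto
    moreover have "run (act (fst p) (snd p)) (r (\<Phi> w)) z = run (act (fst p) (snd p)) w z"
      if "p \<in> set ps" for p z
      using fun_cong[OF u(2), of p] that by (simp add: \<Phi>_def)
    ultimately show "\<exists>u. set u \<subseteq> S \<and> length u \<le> K \<and> wprod G u = \<one> \<and>
      (\<forall>p\<in>set ps. \<forall>z. run (act (fst p) (snd p)) u z = run (act (fst p) (snd p)) w z)"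
      using u(1) by (intro exI[of _ "r (\<Phi> w)"]) (auto simp: T_def)
  qed
qed

definition kernel_ok :: "(nat \<times> nat) list \<Rightarrow> nat \<Rightarrow> bool" where
  "kernel_ok ps K \<longleftrightarrow> (\<forall>w. set w \<subseteq> S \<longrightarrow> wprod G w = \<one> \<longrightarrow> (\<exists>u. set u \<subseteq> S \<and> length u \<le> K \<and> wprod G u = \<one> \<and>
      (\<forall>p\<in>set ps. \<forall>z. run (act (fst p) (snd p)) u z = run (act (fst p) (snd p)) w z)))"

definition far :: "nat \<Rightarrow> nat \<Rightarrow> nat \<Rightarrow> real \<Rightarrow> bool" where
  "far k L m x \<longleftrightarrow> (\<exists>z\<^sub>0. \<exists>\<rho>::'z \<Rightarrow> nat. (\<forall>s\<in>S. \<forall>z. \<rho> (act k L s z) \<le> \<rho> z + 1) \<and>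
        x \<le> measure_pmf.expectation (word_law \<nu> m) (\<lambda>w. real (\<rho> (run (act k L) w z\<^sub>0))) - real (\<rho> z\<^sub>0))"

lemma far_mono:
  assumes "far k L m x" "y \<le> x"
  shows "far k L m y"
proof -
  obtain z\<^sub>0 and \<rho> :: "'z \<Rightarrow> nat" where *: "\<forall>s\<in>S. \<forall>z. \<rho> (act k L s z) \<le> \<rho> z + 1"
    "x \<le> measure_pmf.expectation (word_law \<nu> m) (\<lambda>w. real (\<rho> (run (act k L) w z\<^sub>0))) - real (\<rho> z\<^sub>0)"
    using assms(1) unfolding far_def by auto
  show ?thesis unfolding far_def
    by (rule exI[of _ z\<^sub>0], rule exI[of _ \<rho>], intro conjI *(1) order_trans[OF assms(2) *(2)])
qed

abbreviation "step \<equiv> map_pmf (wprod G) \<nu>"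

text \<open>Recursion on states consisting of the list of actions chosen so far and of the last n, m
  and K. Each new K depends only on the earlier actions, n on K, the level on n and K, and m and the
  truncation on the level; dependent choice then yields the sequences.\<close>

lemma choose_parameters:
  fixes \<LL> L2 :: "nat \<Rightarrow> real"
  assumes \<LL>: "\<And>K N. \<exists>n\<ge>N. drift G S step n + K \<le> \<LL> n"
    and L2: "(\<lambda>n. L2 n / real n) \<longlonglongrightarrow> 0"
  obtains \<kappa> :: "nat \<Rightarrow> nat \<times> nat" and ns ms K :: "nat \<Rightarrow> nat"
  where "strict_mono ns" "strict_mono ms" "\<And>i. 4 \<le> fst (\<kappa> i)"
    "\<And>i. kernel_ok (map \<kappa> [0..<i]) (K i)"
    "\<And>i. drift G S step (ns i) + real (K i) \<le> \<LL> (ns i)"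
    "\<And>i j. i \<le> j \<Longrightarrow> 6 * ns i + K i < fst (\<kappa> j)"
    "\<And>i. far (fst (\<kappa> i)) (snd (\<kappa> i)) (ms i) (L2 (ms i))"
proof -
  define P where "P i s = (case s of (ps :: (nat \<times> nat) list, n :: nat, m :: nat, K :: nat) \<Rightarrow>
      length ps = i \<and> (\<forall>p\<in>set ps. 4 \<le> fst p))" for i s
  define Q where "Q (i::nat) s s' = (case s of (ps :: (nat \<times> nat) list, n :: nat, m :: nat, K :: nat) \<Rightarrow>
      (case s' of (ps', n', m', K') \<Rightarrow> \<exists>k L. ps' = ps @ [(k, L)] \<and> n < n' \<and> m < m' \<and> kernel_ok ps K' \<and>
        drift G S step n' + real K' \<le> \<LL> n' \<and> 6 * n' + K' < k \<and> 4 \<le> k \<and> (\<forall>p\<in>set ps. fst p < k) \<and>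
        far k L m' (L2 m')))" for i s s'
  have next_state: "\<exists>s'. P (Suc i) s' \<and> Q i s s'" if Ps: "P i s" for i s
  proof -
    obtain ps n m K where s: "s = (ps, n, m, K)" by (cases s)
    have ps: "length ps = i" "\<And>p. p \<in> set ps \<Longrightarrow> 4 \<le> fst p" using Ps by (auto simp: P_def s)
    obtain K' where K': "kernel_ok ps K'" using kernel_bound[of ps] ps(2) unfolding kernel_ok_def by metis
    obtain n' where n': "n' \<ge> Suc n" "drift G S step n' + real K' \<le> \<LL> n'" using \<LL> by blast
    \<comment> \<open>The sum of the earlier levels makes k exceed each of them, so the levels
      increase and the bound against 6 n + K persists for all later actions.\<close>
    define k where "k = 6 * n' + K' + 4 + sum_list (map fst ps) + 1"
    have ks: "fst p < k" if "p \<in> set ps" for p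
      using member_le_sum_list[of "fst p" "map fst ps"] that by (auto simp: k_def)
    obtain c where c: "c > 0" "\<And>N. \<exists>n\<ge>N. \<exists>L. far k L n (c * real n)"
      using act_drift[of k] unfolding far_def by (auto simp: k_def)
    \<comment> \<open>The slope c of the new action is fixed before m is chosen; since L2 is
      sublinear, it stays below this slope at all large times.\<close>
    have "eventually (\<lambda>n. L2 n / real n < c) sequentially"
      using order_tendstoD(2)[OF L2 c(1)] .
    then obtain N where N: "\<And>n. n \<ge> N \<Longrightarrow> L2 n / real n < c" by (auto simp: eventually_sequentially)
    obtain m' L where m': "m' \<ge> max N (Suc m)" "far k L m' (c * real m')" using c(2) by blast
    have "L2 m' \<le> c * real m'" using N[of m'] m'(1) by (simp add: field_simps)
    then have "far k L m' (L2 m')" by (rule far_mono[OF m'(2)])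
    then show ?thesis using K' n' m'(1) ks ps
      by (intro exI[of _ "(ps @ [(k, L)], n', m', K')"]) (auto simp: P_def Q_def s k_def)
  qed
  have first_state: "\<exists>s. P 0 s" by (rule exI[of _ "([], 0, 0, 0)"]) (simp add: P_def)
  have "\<exists>f. \<forall>i. P i (f i) \<and> Q i (f i) (f (Suc i))"
    by (rule dependent_nat_choice[OF first_state next_state])
  then obtain f where f: "\<And>i. P i (f i)" "\<And>i. Q i (f i) (f (Suc i))" by metis
  define \<kappa> where "\<kappa> i = fst (f (Suc i)) ! i" for i
  define ns where "ns i = fst (snd (f (Suc i)))" for i
  define ms where "ms i = fst (snd (snd (f (Suc i))))" for i
  define K where "K i = snd (snd (snd (f (Suc i))))" for i
  have len: "length (fst (f i)) = i" for i using f(1)[of i] by (auto simp: P_def split: prod.splits)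
  have app: "fst (f (Suc i)) = fst (f i) @ [\<kappa> i]" for i
    using f(2)[of i] len[of i] by (auto simp: Q_def \<kappa>_def nth_append split: prod.splits)
  have ps: "fst (f i) = map \<kappa> [0..<i]" for i
    by (induction i) (use len[of 0] app in auto)
  have big: "kernel_ok (map \<kappa> [0..<i]) (K i) \<and> drift G S step (ns i) + real (K i) \<le> \<LL> (ns i) \<and>
       6 * ns i + K i < fst (\<kappa> i) \<and> 4 \<le> fst (\<kappa> i) \<and> (\<forall>j<i. fst (\<kappa> j) < fst (\<kappa> i)) \<and>
       far (fst (\<kappa> i)) (snd (\<kappa> i)) (ms i) (L2 (ms i))" for i
    using f(2)[of i] app[of i] ps[of i]
    by (auto simp: Q_def ns_def ms_def K_def split: prod.splits)
  have ker: "kernel_ok (map \<kappa> [0..<i]) (K i)"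
    and near: "drift G S step (ns i) + real (K i) \<le> \<LL> (ns i)"
    and k_big: "6 * ns i + K i < fst (\<kappa> i)" and k4: "4 \<le> fst (\<kappa> i)"
    and k_less: "\<forall>j<i. fst (\<kappa> j) < fst (\<kappa> i)"
    and farm: "far (fst (\<kappa> i)) (snd (\<kappa> i)) (ms i) (L2 (ms i))" for i
    using big[of i] by (elim conjE, assumption | elim conjE, simp)+
  have mono: "ns i < ns (Suc i)" "ms i < ms (Suc i)" for i
    using f(2)[of "Suc i"] by (auto simp: Q_def ns_def ms_def split: prod.splits)
  then have sm: "strict_mono ns" "strict_mono ms" by (auto simp: strict_mono_Suc_iff)
  have sep: "6 * ns i + K i < fst (\<kappa> j)" if "i \<le> j" for i j
  proof (cases "i = j")
    case False
    then have "fst (\<kappa> i) < fst (\<kappa> j)" using k_less[of j] that by (simp only: le_neq_implies_less)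
    with k_big[of i] show ?thesis by linarith
  next
    case True
    show ?thesis using k_big[of i] unfolding True .
  qed
  show ?thesis by (rule that[of ns ms \<kappa> K, OF sm k4 ker near sep farm])
qed

text \<open>The clause on triples of letters records that a product of two letters which is a letter
  of G remains so in \<Delta>. It serves to reduce the generating set in the lamp case.\<close>

theorem diagonal_product:
  fixes \<LL> L2 :: "nat \<Rightarrow> real"
  assumes \<LL>: "\<And>K N. \<exists>n\<ge>N. drift G S step n + K \<le> \<LL> n"
    and L2: "(\<lambda>n. L2 n / real n) \<longlonglongrightarrow> 0"
  shows "\<exists>(\<Delta> :: nat monoid) S' \<pi> \<mu>'. marked_group \<Delta> S' \<and> \<pi> \<in> hom \<Delta> G \<and> bij_betw \<pi> S' S \<and>
     (\<forall>a\<in>S'. \<forall>b\<in>S'. \<forall>c\<in>S'. \<pi> a \<otimes> \<pi> b = \<pi> c \<longrightarrow> a \<otimes>\<^bsub>\<Delta>\<^esub> b = c) \<and>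
     set_pmf \<mu>' \<subseteq> carrier \<Delta> \<and> finite (set_pmf \<mu>') \<and>
     (\<forall>x\<in>carrier \<Delta>. pmf \<mu>' (inv\<^bsub>\<Delta>\<^esub> x) = pmf \<mu>' x) \<and> map_pmf \<pi> \<mu>' = step \<and>
     (\<exists>ns :: nat \<Rightarrow> nat. strict_mono ns \<and> (\<forall>i. drift \<Delta> S' \<mu>' (ns i) \<le> \<LL> (ns i))) \<and>
     (\<exists>ms :: nat \<Rightarrow> nat. strict_mono ms \<and> (\<forall>i. L2 (ms i) \<le> drift \<Delta> S' \<mu>' (ms i)))"
proof -
  obtain \<kappa> ns ms K where mono: "strict_mono ns" "strict_mono ms"
    and k4: "\<And>i. 4 \<le> fst (\<kappa> i)"
    and ker: "\<And>i. kernel_ok (map \<kappa> [0..<i]) (K i)"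
    and near: "\<And>i. drift G S step (ns i) + real (K i) \<le> \<LL> (ns i)"
    and sep: "\<And>i j. i \<le> j \<Longrightarrow> 6 * ns i + K i < fst (\<kappa> j)"
    and far: "\<And>i. far (fst (\<kappa> i)) (snd (\<kappa> i)) (ms i) (L2 (ms i))"
    by (rule choose_parameters[OF assms]) (rule that; assumption)
  define A where "A i = act (fst (\<kappa> i)) (snd (\<kappa> i))" for i
  \<comment> \<open>The product of all finite quotients is realised by permutations of the disjoint
    union \<open>nat \<times> 'z\<close>: component i moves only the i-th copy of the set.\<close>
  define \<gamma> where "\<gamma> s = (s, \<lambda>(i, z). (i :: nat, A i s z))" for s
  define B where "B = G \<times>\<times> (sym_grp :: (nat \<times> 'z \<Rightarrow> nat \<times> 'z) monoid)"
  define T where "T = \<gamma> ` S"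
  define D where "D = B\<lparr>carrier := generate B T\<rparr>"
  interpret B: group B unfolding B_def by (rule DirProd_group[OF is_group group_sym_grp])
  have A_inv: "A i (inv s) (A i s z) = z" "A i s (A i (inv s) z) = z" if "s \<in> S" for i s z
    using act_inv[OF k4 that, of i] act_inv[OF k4 inv_S[OF that], of i] that S_carrier by (auto simp: A_def)
  have A_inv_word: "run (A i) (inv_word w) (run (A i) w z) = z" "run (A i) w (run (A i) (inv_word w) z) = z"
    if "set w \<subseteq> S" for i w z
    using run_inv_word[OF k4 that, of i] run_inv_word'[OF k4 that, of i] by (auto simp: A_def)
  have bij: "bij (\<lambda>(i, z). (i :: nat, A i s z))" if "s \<in> S" for s
    by (rule o_bij[of "\<lambda>(i, z). (i, A i (inv s) z)"]) (use A_inv that in \<open>auto simp: fun_eq_iff\<close>)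
  have gam_B: "\<gamma> s \<in> carrier B" if "s \<in> S" for s
    using bij[OF that] that S_carrier by (auto simp: \<gamma>_def B_def sym_grp_def)
  have gam_inv: "inv\<^bsub>B\<^esub> (\<gamma> s) = \<gamma> (inv s)" if "s \<in> S" for s
  proof (rule B.inv_equality)
    show "\<gamma> (inv s) \<otimes>\<^bsub>B\<^esub> \<gamma> s = \<one>\<^bsub>B\<^esub>"
      using A_inv that S_carrier by (auto simp: \<gamma>_def B_def sym_grp_def fun_eq_iff)
  qed (use that gam_B inv_S in auto)
  have wB: "wprod B (map \<gamma> w) = (wprod G w, \<lambda>(i, z). (i, run (A i) w z))" if "set w \<subseteq> S" for w
    using that by (induction w) (auto simp: \<gamma>_def B_def sym_grp_def fun_eq_iff)
  have "marked_group D T" unfolding D_def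
    by (rule B.marked_group_generate) (use fin_S gam_B gam_inv inv_S in \<open>auto simp: T_def\<close>)
  then interpret D: marked_group D T .
  have wD: "wprod D = wprod B" by (simp add: D_def fun_eq_iff)
  have D_mult: "x \<otimes>\<^bsub>D\<^esub> y = x \<otimes>\<^bsub>B\<^esub> y" for x y by (simp add: D_def)
  have words: "\<exists>v. set v \<subseteq> S \<and> map \<gamma> v = w \<and> length v = length w" if "set w \<subseteq> T" for w
    by (rule exI[of _ "map fst w"], use that in \<open>induction w\<close>) (auto simp: T_def \<gamma>_def)
  have gam_word: "set (map \<gamma> w) \<subseteq> T" if "set w \<subseteq> S" for w using that by (auto simp: T_def)
  have fst_hom: "fst \<in> hom D G"
  proof (rule homI)
    fix x assume "x \<in> carrier D"
    then obtain w where "set w \<subseteq> T" "x = wprod D w" using D.carrier_wprod by auto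
    with words[of w] show "fst x \<in> carrier G" by (auto simp: wD wB)
  qed (auto simp: D_mult B_def DirProd_def)
  have fst_bij: "bij_betw fst T S"
    by (auto simp: bij_betw_def T_def inj_on_def \<gamma>_def image_image)
  define \<mu> where "\<mu> = map_pmf (wprod D) (map_pmf (map \<gamma>) \<nu>)"
  have fin_mu: "finite (set_pmf \<mu>)" using fin_nu by (simp add: \<mu>_def)
  have mu_carrier: "set_pmf \<mu> \<subseteq> carrier D"
    using nu_S D.carrier_wprod gam_word by (fastforce simp: \<mu>_def)
  have mu_proj: "map_pmf fst \<mu> = step"
    using nu_S by (auto simp: \<mu>_def map_pmf_comp wD wB intro!: map_pmf_cong)
  have "map_pmf (\<lambda>x. inv\<^bsub>D\<^esub> x) \<mu> = \<mu>"
  proof -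
    have "inv\<^bsub>D\<^esub> (wprod D (map \<gamma> w)) = wprod D (map \<gamma> (inv_word w))" if w: "set w \<subseteq> S" for w
    proof -
      have "rev (map (\<lambda>a. inv\<^bsub>D\<^esub> a) (map \<gamma> w)) = map \<gamma> (inv_word w)"
        unfolding rev_map[symmetric] map_map
      proof (intro map_cong arg_cong[of _ _ rev])
        fix s assume "s \<in> set w"
        then have s: "s \<in> S" "\<gamma> s \<in> T" using w by (auto simp: T_def)
        have "inv\<^bsub>D\<^esub> (\<gamma> s) = inv\<^bsub>B\<^esub> (\<gamma> s)" unfolding D_def
          by (rule B.m_inv_consistent)
             (use s gam_B in \<open>auto simp: T_def intro!: B.generate_is_subgroup generate.incl\<close>)
        then show "((\<lambda>a. inv\<^bsub>D\<^esub> a) \<circ> \<gamma>) s = (\<gamma> \<circ> (\<lambda>a. inv a)) s" using gam_inv[OF s(1)] by simp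
      qed simp
      moreover have "set (map \<gamma> w) \<subseteq> carrier D" using gam_word[OF w] D.S_carrier by auto
      ultimately show ?thesis using D.wprod_rev_inv by metis
    qed
    then have "map_pmf (\<lambda>x. inv\<^bsub>D\<^esub> x) \<mu> = map_pmf (\<lambda>w. wprod D (map \<gamma> (inv_word w))) \<nu>"
      using nu_S by (auto simp: \<mu>_def map_pmf_comp intro!: map_pmf_cong)
    also have "\<dots> = map_pmf (\<lambda>w. wprod D (map \<gamma> w)) (map_pmf inv_word \<nu>)" by (simp add: map_pmf_comp)
    also have "\<dots> = \<mu>" by (simp add: nu_sym \<mu>_def map_pmf_comp)
    finally show ?thesis .
  qed
  then have mu_sym: "pmf \<mu> (inv\<^bsub>D\<^esub> x) = pmf \<mu> x" if "x \<in> carrier D" for x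
    by (rule pmf_inv_symmetric[OF D.is_group mu_carrier _ that])
  have word_law_gam: "word_law (map_pmf (map \<gamma>) \<nu>) n = map_pmf (map \<gamma>) (word_law \<nu> n)" for n
    by (induction n) (auto simp: map_bind_pmf bind_map_pmf map_pmf_comp)
  have drift_D: "drift D T \<mu> n = measure_pmf.expectation (word_law \<nu> n)
      (\<lambda>w. real (word_norm D T (wprod D (map \<gamma> w))))" for n
    unfolding \<mu>_def using nu_S gam_word D.S_carrier
    by (subst drift_word_law[OF D.is_group]) (auto simp: word_law_gam, blast)
  have drift_G: "drift G S step n = measure_pmf.expectation (word_law \<nu> n)
      (\<lambda>w. real (word_norm G S (wprod G w)))" for n
    using nu_S S_carrier by (intro drift_word_law[OF is_group]) auto
  have relations: "a \<otimes>\<^bsub>D\<^esub> b = c" if abc: "a \<in> T" "b \<in> T" "c \<in> T" "fst a \<otimes> fst b = fst c" for a b c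
  proof -
    obtain x y z where xyz: "x \<in> S" "y \<in> S" "z \<in> S" "a = \<gamma> x" "b = \<gamma> y" "c = \<gamma> z"
      using abc by (auto simp: T_def)
    have xy: "x \<otimes> y = z" using abc xyz by (simp add: \<gamma>_def)
    then have one: "wprod G [x, y, inv z] = \<one>" using xyz S_carrier by (auto simp: m_assoc[symmetric] subset_iff)
    have "run (A i) [x, y, inv z] u = u" for i u unfolding A_def
      by (rule act_local[OF _ _ one k4]) (use xyz inv_S k4[of i] in auto)
    then have "A i z u = A i y (A i x u)" for i u using A_inv(2)[OF xyz(3), of i "A i y (A i x u)"] by simp
    then show ?thesis using xyz xy by (auto simp: D_def B_def sym_grp_def \<gamma>_def fun_eq_iff)
  qed
  \<comment> \<open>A shortest word v for the image of w in G is corrected by a short relator u: on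
    the earlier actions u is chosen to act as w v^-1, and on the later ones every relator in sight
    is trivial. Hence u v represents w in the diagonal group, at an extra cost of at most K
    i.\<close>
  have upper: "drift D T \<mu> (ns i) \<le> drift G S step (ns i) + real (K i)" for i
  proof -
    have "word_norm D T (wprod D (map \<gamma> w)) \<le> word_norm G S (wprod G w) + K i"
      if "w \<in> set_pmf (word_law \<nu> (ns i))" for w
    proof -
      have w: "set w \<subseteq> S" "length w \<le> 3 * ns i"
        using word_law_set[OF nu_S that] word_law_length[OF nu_len that] by auto
      obtain v where v: "length v = word_norm G S (wprod G w)" "set v \<subseteq> S" "wprod G v = wprod G w"
        using word_norm_attained[of "wprod G w"] w by auto
      have lv: "length v \<le> length w" using v(1) word_norm_le[OF w(1)] by simp
      have wv: "set (w @ inv_word v) \<subseteq> S" using w v inv_word_S by auto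
      have wv1: "wprod G (w @ inv_word v) = \<one>"
        using w v inv_word_S by (simp add: wprod_S_append wprod_inv_word del: set_rev)
      have "\<exists>u. set u \<subseteq> S \<and> length u \<le> K i \<and> wprod G u = \<one> \<and> (\<forall>p\<in>set (map \<kappa> [0..<i]). \<forall>z.
          run (act (fst p) (snd p)) u z = run (act (fst p) (snd p)) (w @ inv_word v) z)"
        using ker[of i, unfolded kernel_ok_def, THEN spec, of "w @ inv_word v"] wv wv1 by (elim impE) simp_all
      then obtain u where u: "set u \<subseteq> S" "length u \<le> K i" "wprod G u = \<one>"
        and "\<forall>p\<in>set (map \<kappa> [0..<i]). \<forall>z.
          run (act (fst p) (snd p)) u z = run (act (fst p) (snd p)) (w @ inv_word v) z"
        by (elim exE conjE)
      then have u_run: "\<And>j z. j < i \<Longrightarrow> run (A j) u z = run (A j) (w @ inv_word v) z"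
        unfolding A_def by (metis atLeast0LessThan image_eqI lessThan_iff list.set_map set_upt)
      have "run (A j) (u @ v) z = run (A j) w z" for j z
      proof (cases "j < i")
        case True
        then show ?thesis using u_run[OF True] A_inv_word(2)[OF v(2)] by simp
      next
        case False
        \<comment> \<open>Length at most 3 n + 3 n + K: w has at most three letters per step and v
          is no longer than w. This is the origin of 6 n + K in the choice of levels.\<close>
        define t where "t = w @ inv_word v @ inv_word u"
        have t: "set t \<subseteq> S" using w inv_word_S[OF v(2)] inv_word_S[OF u(1)] by (simp add: t_def)
        have t1: "wprod G t = \<one>" using wprod_S_append[OF wv inv_word_S[OF u(1)]] wv1 u
          by (simp add: t_def wprod_inv_word del: set_rev)
        have "run (A j) t z = z" unfolding A_def
        proof (rule act_local[OF t _ t1 k4])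
          show "length t < fst (\<kappa> j)"
            using sep[of i j] False w lv u by (simp add: t_def)
        qed
        then have "run (A j) (u @ v) z = run (A j) (u @ v) (run (A j) t z)" by simp
        then show ?thesis by (simp add: t_def A_inv_word(2)[OF u(1)] A_inv_word(2)[OF v(2)])
      qed
      then have "wprod D (map \<gamma> w) = wprod D (map \<gamma> (u @ v))"
        using u v w by (simp add: wD wB wprod_S_append del: map_append run_append)
      then show ?thesis using word_norm_le[OF gam_word, of "u @ v" D] u v by simp
    qed
    then have "drift D T \<mu> (ns i) \<le> measure_pmf.expectation (word_law \<nu> (ns i))
        (\<lambda>w. real (word_norm G S (wprod G w)) + real (K i))"
      unfolding drift_D using fin_nu
      by (intro pmf_expectation_mono finite_set_word_law) (auto simp flip: of_nat_add)
    then show ?thesis using finite_set_word_law[OF fin_nu]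
      by (simp add: drift_G integrable_measure_pmf_finite)
  qed
  \<comment> \<open>Any word equal to w in the diagonal group acts like w on the i-th component, so
    its length is at least the growth of \<rho>; the mean of this growth is at least
    \<open>L2 (ms i)\<close>.\<close>
  have lower: "L2 (ms i) \<le> drift D T \<mu> (ms i)" for i
  proof -
    obtain z\<^sub>0 and \<rho> :: "'z \<Rightarrow> nat" where \<rho>: "\<And>s z. s \<in> S \<Longrightarrow> \<rho> (A i s z) \<le> \<rho> z + 1"
      and L2_le: "L2 (ms i) \<le> measure_pmf.expectation (word_law \<nu> (ms i))
        (\<lambda>w. real (\<rho> (run (A i) w z\<^sub>0))) - real (\<rho> z\<^sub>0)"
      using far[of i] unfolding far_def A_def by blast
    have "real (\<rho> (run (A i) w z\<^sub>0)) - real (\<rho> z\<^sub>0) \<le> real (word_norm D T (wprod D (map \<gamma> w)))"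
      if "w \<in> set_pmf (word_law \<nu> (ms i))" for w
    proof -
      have w: "set w \<subseteq> S" using word_law_set[OF nu_S that] by auto
      have "wprod D (map \<gamma> w) \<in> carrier D" using D.carrier_wprod gam_word[OF w] by auto
      from D.word_norm_attained[OF this] words obtain v where
        v: "set v \<subseteq> S" "length v = word_norm D T (wprod D (map \<gamma> w))"
          "wprod D (map \<gamma> v) = wprod D (map \<gamma> w)" by metis
      have "run (A i) v z\<^sub>0 = run (A i) w z\<^sub>0" using v(3) by (auto simp: wD wB w v(1) fun_eq_iff)
      then show ?thesis using run_lipschitz[of S \<rho> "A i" v z\<^sub>0] \<rho> v by auto
    qed
    then have "measure_pmf.expectation (word_law \<nu> (ms i))
        (\<lambda>w. real (\<rho> (run (A i) w z\<^sub>0)) - real (\<rho> z\<^sub>0)) \<le> drift D T \<mu> (ms i)"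
      unfolding drift_D using fin_nu by (intro pmf_expectation_mono finite_set_word_law)
    then show ?thesis using finite_set_word_law[OF fin_nu] L2_le
      by (simp add: integrable_measure_pmf_finite)
  qed
  obtain \<Delta> :: "nat monoid" and f where \<Delta>: "group \<Delta>" and f: "f \<in> iso D \<Delta>"
    using D.nat_copy by blast
  interpret \<Delta>: group \<Delta> by fact
  interpret f: group_hom D \<Delta> f using f by (unfold_locales) (auto simp: iso_def)
  have f_inj: "inj_on f (carrier D)" and f_surj: "f ` carrier D = carrier \<Delta>"
    using f by (auto simp: iso_def bij_betw_def)
  have m\<Delta>: "marked_group \<Delta> (f ` T)" by (rule marked_group_iso[OF D.marked_group_axioms \<Delta> f])
  define h where "h = inv_into (carrier D) f"
  have h: "h \<in> iso \<Delta> D" unfolding h_def by (rule D.iso_set_sym[OF f])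
  have hf: "h (f x) = x" if "x \<in> carrier D" for x using f_inj that by (simp add: h_def)
  have h_hom: "h \<in> hom \<Delta> D" using h by (simp add: iso_def)
  have hT: "h ` f ` T = T" using hf D.S_carrier by (auto simp: image_image subset_iff intro!: image_eqI)
  have driftf: "drift \<Delta> (f ` T) (map_pmf f \<mu>) n = drift D T \<mu> n" for n
  proof (rule antisym)
    show "drift \<Delta> (f ` T) (map_pmf f \<mu>) n \<le> drift D T \<mu> n"
      by (rule drift_hom_le[OF D.marked_group_axioms m\<Delta> f.homh _ mu_carrier fin_mu]) simp
    have "map_pmf h (map_pmf f \<mu>) = map_pmf id \<mu>"
      unfolding map_pmf_comp using mu_carrier hf by (intro map_pmf_cong) auto
    moreover have "f ` set_pmf \<mu> \<subseteq> carrier \<Delta>" using mu_carrier f_surj by blast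
    ultimately show "drift D T \<mu> n \<le> drift \<Delta> (f ` T) (map_pmf f \<mu>) n"
      using drift_hom_le[OF m\<Delta> D.marked_group_axioms h_hom, of "map_pmf f \<mu>" n] hT mu_carrier fin_mu f_surj
      by auto
  qed
  show ?thesis
  proof (intro exI conjI ballI allI impI)
    show "marked_group \<Delta> (f ` T)" by fact
    show "fst \<circ> h \<in> hom \<Delta> G" using h_hom fst_hom by (auto simp: hom_def Pi_iff)
    have "bij_betw h (f ` T) T"
      using hT hf D.S_carrier by (auto simp: bij_betw_def inj_on_def subset_iff)
    then show "bij_betw (fst \<circ> h) (f ` T) S" using fst_bij by (rule bij_betw_trans)
    show "a \<otimes>\<^bsub>\<Delta>\<^esub> b = c" if abc: "a \<in> f ` T" "b \<in> f ` T" "c \<in> f ` T"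
      "(fst \<circ> h) a \<otimes> (fst \<circ> h) b = (fst \<circ> h) c" for a b c
    proof -
      obtain x y z where xyz: "x \<in> T" "y \<in> T" "z \<in> T" "a = f x" "b = f y" "c = f z" using abc by auto
      have xD: "x \<in> carrier D" "y \<in> carrier D" "z \<in> carrier D" using xyz D.S_carrier by blast+
      then have "x \<otimes>\<^bsub>D\<^esub> y = z" using relations[OF xyz(1-3)] abc(4) by (simp add: xyz hf)
      then show ?thesis using xyz xD f.hom_mult[of x y] by simp
    qed
    show "set_pmf (map_pmf f \<mu>) \<subseteq> carrier \<Delta>" using mu_carrier by auto
    show "finite (set_pmf (map_pmf f \<mu>))" using fin_mu by simp
    show "pmf (map_pmf f \<mu>) (inv\<^bsub>\<Delta>\<^esub> x) = pmf (map_pmf f \<mu>) x" if x: "x \<in> carrier \<Delta>" for x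
    proof -
      obtain y where y: "y \<in> carrier D" "x = f y" using x f_surj by (metis imageE)
      have eq: "pmf (map_pmf f \<mu>) (f y) = pmf \<mu> y" if "y \<in> carrier D" for y
      proof -
        have "pmf (map_pmf f \<mu>) (f y) = measure \<mu> (f -` {f y})" by (simp add: pmf_map)
        also have "\<dots> = measure \<mu> {y}"
          using mu_carrier that f_inj
          by (intro measure_pmf.finite_measure_eq_AE) (auto simp: AE_measure_pmf_iff dest: inj_onD)
        finally show ?thesis by (simp add: measure_pmf_single)
      qed
      have "inv\<^bsub>\<Delta>\<^esub> x = f (inv\<^bsub>D\<^esub> y)" using y f.hom_inv by simp
      then show ?thesis using eq[of y] eq[of "inv\<^bsub>D\<^esub> y"] y mu_sym by simp
    qed
    have "map_pmf (fst \<circ> h) (map_pmf f \<mu>) = map_pmf fst \<mu>"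
      unfolding map_pmf_comp using mu_carrier hf by (intro map_pmf_cong) auto
    then show "map_pmf (fst \<circ> h) (map_pmf f \<mu>) = step" using mu_proj by simp
    show "strict_mono ns" "strict_mono ms" by fact+
    show "drift \<Delta> (f ` T) (map_pmf f \<mu>) (ns i) \<le> \<LL> (ns i)" for i
      using upper[of i] near[of i] by (simp add: driftf)
    show "L2 (ms i) \<le> drift \<Delta> (f ` T) (map_pmf f \<mu>) (ms i)" for i
      using lower[of i] by (simp add: driftf)
  qed
qed

end

section \<open>The wreath product and the group \<open>\<Gamma>\<close>\<close>

abbreviation prefix_of :: "(nat \<Rightarrow> nat) \<Rightarrow> nat \<Rightarrow> nat list" where
  "prefix_of x n \<equiv> map x [0..<n]"

lemma Nil_tree_vertices [simp]: "[] \<in> tree_vertices d"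
  by (simp add: tree_vertices_def)

lemma snoc_tree_vertices:
  "v @ [i] \<in> tree_vertices d \<longleftrightarrow> v \<in> tree_vertices d \<and> 1 \<le> i \<and> i \<le> d (length v)"
  by (auto simp: tree_vertices_def nth_append less_Suc_eq)

lemma append_tree_vertices: "u @ y \<in> tree_vertices d \<Longrightarrow> u \<in> tree_vertices d"
  by (induction y rule: rev_induct) (auto simp: snoc_tree_vertices simp flip: append_assoc)

lemma take_tree_vertices: "v \<in> tree_vertices d \<Longrightarrow> take k v \<in> tree_vertices d"
  by (metis append_take_drop_id append_tree_vertices)

lemma prefix_tree_vertices: "x \<in> tree_boundary d \<Longrightarrow> prefix_of x n \<in> tree_vertices d"
  by (auto simp: tree_vertices_def tree_boundary_def)

lemma tree_boundary_prefixI: "(\<And>n. prefix_of x n \<in> tree_vertices d) \<Longrightarrow> x \<in> tree_boundary d"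
  unfolding tree_boundary_def tree_vertices_def
proof (clarsimp)
  fix j assume "\<And>n. \<forall>j<n. Suc 0 \<le> x j \<and> x j \<le> d j"
  from this[of "Suc j"] show "Suc 0 \<le> x j \<and> x j \<le> d j" by auto
qed

lemma prefix_of_eqI: "(\<And>n. prefix_of x n = prefix_of y n) \<Longrightarrow> x = y"
proof
  fix j assume "\<And>n. prefix_of x n = prefix_of y n"
  from this[of "Suc j"] show "x j = y j" by simp
qed

lemma finite_level: "finite {v \<in> tree_vertices d. length v = k}"
proof (induction k)
  case (Suc k)
  have "{v \<in> tree_vertices d. length v = Suc k} \<subseteq>
      (\<lambda>(v, i). v @ [i]) ` ({v \<in> tree_vertices d. length v = k} \<times> {1..d k})"
  proof
    fix v assume v: "v \<in> {v \<in> tree_vertices d. length v = Suc k}"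
    then have eq: "v = butlast v @ [last v]" by (cases v) auto
    have "butlast v @ [last v] \<in> tree_vertices d" using v eq by simp
    from this[unfolded snoc_tree_vertices] have "butlast v \<in> tree_vertices d" "1 \<le> last v" "last v \<le> d k"
      using v by auto
    then show "v \<in> (\<lambda>(v, i). v @ [i]) ` ({v \<in> tree_vertices d. length v = k} \<times> {1..d k})"
      using v eq by (intro image_eqI[of _ _ "(butlast v, last v)"]) auto
  qed
  then show ?case by (rule finite_subset) (use Suc in auto)
qed simp

subsection \<open>Tree automorphisms\<close>

lemma tree_autD:
  assumes "g \<in> tree_aut d"
  shows "bij_betw g (tree_vertices d) (tree_vertices d)"
    and "v \<in> tree_vertices d \<Longrightarrow> length (g v) = length v"
    and "v \<in> tree_vertices d \<Longrightarrow> g (take k v) = take k (g v)"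
    and "v \<notin> tree_vertices d \<Longrightarrow> g v = v"
    and "v \<in> tree_vertices d \<Longrightarrow> g v \<in> tree_vertices d"
  using assms by (auto simp: tree_aut_def dest: bij_betwE)

lemma tree_autD_iff: "g \<in> tree_aut d \<Longrightarrow> g v \<in> tree_vertices d \<longleftrightarrow> v \<in> tree_vertices d"
  using tree_autD(4,5) by metis

lemma tree_aut_bij:
  assumes "g \<in> tree_aut d" shows "bij g"
proof -
  have "bij_betw g (- tree_vertices d) (- tree_vertices d)"
    using tree_autD(4)[OF assms] by (auto simp: bij_betw_def inj_on_def)
  from bij_betw_combine[OF tree_autD(1)[OF assms] this] show ?thesis by (simp add: Compl_partition)
qed

lemma tree_aut_inj: "g \<in> tree_aut d \<Longrightarrow> g u = g v \<longleftrightarrow> u = v"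
  using tree_aut_bij bij_is_inj inj_eq by metis

lemma id_tree_aut [simp]: "id \<in> tree_aut d"
  by (auto simp: tree_aut_def)

lemma comp_tree_aut [simp]: "g \<in> tree_aut d \<Longrightarrow> f \<in> tree_aut d \<Longrightarrow> f \<circ> g \<in> tree_aut d"
  unfolding tree_aut_def by (auto intro: bij_betw_trans dest: bij_betwE)

lemma inv_tree_aut:
  assumes g: "g \<in> tree_aut d"
  shows "inv_into UNIV g \<in> tree_aut d" "inv_into UNIV g \<circ> g = id" "g \<circ> inv_into UNIV g = id"
proof -
  let ?h = "inv_into UNIV g"
  have bij: "bij g" by (rule tree_aut_bij[OF g])
  then show hg: "?h \<circ> g = id" by (simp add: bij_is_inj)
  show gh: "g \<circ> ?h = id" using bij bij_is_surj surj_iff by blast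
  have gh': "g (?h v) = v" for v using gh by (metis comp_apply id_apply)
  have V: "?h v \<in> tree_vertices d \<longleftrightarrow> v \<in> tree_vertices d" for v
    using tree_autD_iff[OF g, of "?h v"] gh'[of v] by simp
  show "?h \<in> tree_aut d"
    unfolding tree_aut_def
  proof (intro CollectI conjI ballI allI impI)
    show "bij_betw ?h (tree_vertices d) (tree_vertices d)"
    proof (rule bij_betw_byWitness[of _ g])
      show "\<forall>v\<in>tree_vertices d. g (?h v) = v" "\<forall>v\<in>tree_vertices d. ?h (g v) = v"
        using gh' hg by (auto simp: fun_eq_iff)
    qed (use V tree_autD(5)[OF g] in auto)
    fix v
    { assume v: "v \<in> tree_vertices d"
      show "length (?h v) = length v" using tree_autD(2)[OF g, of "?h v"] v V gh' by simp
      fix k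
      have "g (take k (?h v)) = g (?h (take k v))" using tree_autD(3)[OF g, of "?h v"] v V gh' by simp
      then show "?h (take k v) = take k (?h v)" using tree_aut_inj[OF g] by metis }
    assume "v \<notin> tree_vertices d"
    then have "g v = v" by (rule tree_autD(4)[OF g])
    then show "?h v = v" by (metis gh' tree_aut_inj[OF g])
  qed
qed

lemma group_aut_group: "group (aut_group d)"
proof (rule groupI)
  fix g assume "g \<in> carrier (aut_group d)"
  then show "\<exists>h\<in>carrier (aut_group d). h \<otimes>\<^bsub>aut_group d\<^esub> g = \<one>\<^bsub>aut_group d\<^esub>"
    using inv_tree_aut[of g d] by (intro bexI[of _ "inv_into UNIV g"]) (auto simp: aut_group_def)
qed (auto simp: aut_group_def comp_assoc simp del: comp_apply)

lemma tree_aut_append: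
  assumes "g \<in> tree_aut d" "v @ [i] \<in> tree_vertices d"
  shows "g (v @ [i]) = g v @ [aut_label d g v i]"
proof -
  have v: "v \<in> tree_vertices d" "1 \<le> i" "i \<le> d (length v)" using assms(2) by (auto simp: snoc_tree_vertices)
  have len: "length (g (v @ [i])) = Suc (length v)" using tree_autD(2)[OF assms] by simp
  then have "g (v @ [i]) = butlast (g (v @ [i])) @ [last (g (v @ [i]))]" by (cases "g (v @ [i])") auto
  also have "butlast (g (v @ [i])) = g v"
    using tree_autD(3)[OF assms, of "length v"] len by (simp add: butlast_conv_take)
  finally show ?thesis using v by (simp add: aut_label_def)
qed

lemma aut_label_permutes:
  assumes g: "g \<in> tree_aut d" and v: "v \<in> tree_vertices d"
  shows "aut_label d g v permutes {1..d (length v)}"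
proof (rule bij_imp_permutes)
  have into: "aut_label d g v i \<in> {1..d (length v)}" if "i \<in> {1..d (length v)}" for i
  proof -
    have vi: "v @ [i] \<in> tree_vertices d" using v that by (simp add: snoc_tree_vertices)
    have "g v @ [aut_label d g v i] \<in> tree_vertices d"
      using tree_autD(5)[OF g vi] tree_aut_append[OF g vi] by simp
    then show ?thesis using tree_autD(2)[OF g v] by (simp add: snoc_tree_vertices)
  qed
  have inj: "inj_on (aut_label d g v) {1..d (length v)}"
  proof (rule inj_onI)
    fix i j assume ij: "i \<in> {1..d (length v)}" "j \<in> {1..d (length v)}" "aut_label d g v i = aut_label d g v j"
    then have "v @ [i] \<in> tree_vertices d" "v @ [j] \<in> tree_vertices d" using v by (auto simp: snoc_tree_vertices)
    then have "g (v @ [i]) = g (v @ [j])" using ij tree_aut_append[OF g] by simp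
    then show "i = j" using tree_aut_inj[OF g] by blast
  qed
  have "aut_label d g v ` {1..d (length v)} = {1..d (length v)}"
    by (rule endo_inj_surj[OF _ image_subsetI inj]) (simp, rule into)
  with inj show "bij_betw (aut_label d g v) {1..d (length v)} {1..d (length v)}"
    by (simp add: bij_betw_def)
qed (auto simp: aut_label_def)

lemma aut_label_comp:
  assumes g: "g \<in> tree_aut d" and f: "f \<in> tree_aut d" and v: "v \<in> tree_vertices d"
  shows "aut_label d (f \<circ> g) v = aut_label d f (g v) \<circ> aut_label d g v"
proof
  fix i
  show "aut_label d (f \<circ> g) v i = (aut_label d f (g v) \<circ> aut_label d g v) i"
  proof (cases "i \<in> {1..d (length v)}")
    case True
    then have vi: "v @ [i] \<in> tree_vertices d" using v by (simp add: snoc_tree_vertices)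
    have gvi: "g v @ [aut_label d g v i] \<in> tree_vertices d"
      using tree_autD(5)[OF g vi] tree_aut_append[OF g vi] by simp
    have "f (g v) @ [aut_label d (f \<circ> g) v i] = (f \<circ> g) (v @ [i])"
      using tree_aut_append[OF comp_tree_aut[OF g f] vi] by simp
    also have "\<dots> = f (g v) @ [aut_label d f (g v) (aut_label d g v i)]"
      using tree_aut_append[OF g vi] tree_aut_append[OF f gvi] by simp
    finally show ?thesis by simp
  next
    case False
    then show ?thesis using tree_autD(2)[OF g v] by (auto simp: aut_label_def)
  qed
qed

lemma aut_label_id [simp]: "aut_label d id v = id"
  by (auto simp: aut_label_def fun_eq_iff)

subsection \<open>The boundary action and the wreath product\<close>

lemma prefix_aut_bd:
  assumes g: "g \<in> tree_aut d" and x: "x \<in> tree_boundary d"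
  shows "prefix_of (aut_bd g x) n = g (prefix_of x n)"
proof (rule nth_equalityI)
  have V: "prefix_of x m \<in> tree_vertices d" for m by (rule prefix_tree_vertices[OF x])
  show len: "length (prefix_of (aut_bd g x) n) = length (g (prefix_of x n))"
    using tree_autD(2)[OF g V] by simp
  fix j assume "j < length (prefix_of (aut_bd g x) n)"
  then have j: "j < n" by simp
  have "prefix_of x (Suc j) = take (Suc j) (prefix_of x n)" using j by (simp add: take_map)
  then have "g (prefix_of x (Suc j)) = take (Suc j) (g (prefix_of x n))" using tree_autD(3)[OF g V] by simp
  then have "aut_bd g x j = take (Suc j) (g (prefix_of x n)) ! j" by (simp only: aut_bd_def)
  then show "prefix_of (aut_bd g x) n ! j = g (prefix_of x n) ! j" using j by simp
qed

lemma aut_bd_closed: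
  "g \<in> tree_aut d \<Longrightarrow> x \<in> tree_boundary d \<Longrightarrow> aut_bd g x \<in> tree_boundary d"
  by (rule tree_boundary_prefixI) (simp only: prefix_aut_bd prefix_tree_vertices tree_autD)

lemma aut_bd_comp:
  assumes "g \<in> tree_aut d" "f \<in> tree_aut d" "x \<in> tree_boundary d"
  shows "aut_bd (f \<circ> g) x = aut_bd f (aut_bd g x)"
  by (rule prefix_of_eqI) (simp only: prefix_aut_bd[of _ d] aut_bd_closed[of _ d] assms comp_tree_aut comp_apply)

lemma aut_bd_id [simp]: "aut_bd id x = x"
  by (rule ext) (auto simp: aut_bd_def simp del: upt_Suc)

lemma wreath_mult:
  "(\<phi>, g) \<otimes>\<^bsub>wreath F d\<^esub> (\<phi>', g') = (\<lambda>x\<in>tree_boundary d. \<phi> x \<otimes>\<^bsub>F\<^esub> \<phi>' (aut_bd g x), g' \<circ> g)"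
  by (simp add: wreath_def)

lemma snd_wreath_mult: "snd (a \<otimes>\<^bsub>wreath F d\<^esub> b) = snd b \<circ> snd a"
  by (cases a; cases b) (simp add: wreath_mult)

lemma fst_wreath_mult: "x \<in> tree_boundary d \<Longrightarrow>
    fst (a \<otimes>\<^bsub>wreath F d\<^esub> b) x = fst a x \<otimes>\<^bsub>F\<^esub> fst b (aut_bd (snd a) x)"
  by (cases a; cases b) (simp add: wreath_mult)

lemma wreath_one: "\<one>\<^bsub>wreath F d\<^esub> = (\<lambda>x\<in>tree_boundary d. \<one>\<^bsub>F\<^esub>, id)"
  by (simp add: wreath_def)

lemma wreath_carrier: "carrier (wreath F d) = (tree_boundary d \<rightarrow>\<^sub>E carrier F) \<times> tree_aut d"
  by (simp add: wreath_def)

lemma group_wreath: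
  assumes "group F" shows "group (wreath F d)"
proof (rule groupI)
  interpret F: group F by fact
  let ?W = "wreath F d"
  have mem: "\<phi> x \<in> carrier F" if "\<phi> \<in> tree_boundary d \<rightarrow>\<^sub>E carrier F" "x \<in> tree_boundary d" for \<phi> x
    using that by (rule PiE_mem)
  show "a \<otimes>\<^bsub>?W\<^esub> b \<in> carrier ?W" if "a \<in> carrier ?W" "b \<in> carrier ?W" for a b
    using that by (cases a; cases b) (auto simp: wreath_mult wreath_carrier aut_bd_closed mem)
  show "a \<otimes>\<^bsub>?W\<^esub> b \<otimes>\<^bsub>?W\<^esub> c = a \<otimes>\<^bsub>?W\<^esub> (b \<otimes>\<^bsub>?W\<^esub> c)"
    if "a \<in> carrier ?W" "b \<in> carrier ?W" "c \<in> carrier ?W" for a b c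
    using that
    by (cases a; cases b; cases c)
       (auto simp: wreath_mult wreath_carrier aut_bd_closed mem aut_bd_comp[of _ d] F.m_assoc comp_assoc
         intro!: restrict_ext)
  show "\<one>\<^bsub>?W\<^esub> \<in> carrier ?W" by (auto simp: wreath_one wreath_carrier)
  show "\<one>\<^bsub>?W\<^esub> \<otimes>\<^bsub>?W\<^esub> a = a" if "a \<in> carrier ?W" for a
  proof -
    obtain \<phi> g where ag: "a = (\<phi>, g)" "\<phi> \<in> tree_boundary d \<rightarrow>\<^sub>E carrier F"
      using \<open>a \<in> carrier ?W\<close> by (auto simp: wreath_carrier)
    have "(\<lambda>x\<in>tree_boundary d. \<one>\<^bsub>F\<^esub> \<otimes>\<^bsub>F\<^esub> \<phi> x) = restrict \<phi> (tree_boundary d)"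
      by (rule restrict_ext) (simp add: mem[OF ag(2)])
    then have "(\<lambda>x\<in>tree_boundary d. \<one>\<^bsub>F\<^esub> \<otimes>\<^bsub>F\<^esub> \<phi> x) = \<phi>"
      using PiE_restrict[OF ag(2)] by simp
    moreover have "(\<lambda>x\<in>tree_boundary d. (\<lambda>x\<in>tree_boundary d. \<one>\<^bsub>F\<^esub>) x \<otimes>\<^bsub>F\<^esub> \<phi> (aut_bd id x))
        = (\<lambda>x\<in>tree_boundary d. \<one>\<^bsub>F\<^esub> \<otimes>\<^bsub>F\<^esub> \<phi> x)" by (rule restrict_ext) simp
    ultimately show ?thesis by (simp only: ag wreath_one wreath_mult) simp
  qed
  show "\<exists>b\<in>carrier ?W. b \<otimes>\<^bsub>?W\<^esub> a = \<one>\<^bsub>?W\<^esub>" if a: "a \<in> carrier ?W" for a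
  proof -
    obtain \<phi> g where ag: "a = (\<phi>, g)" "\<phi> \<in> tree_boundary d \<rightarrow>\<^sub>E carrier F" "g \<in> tree_aut d"
      using a by (auto simp: wreath_carrier)
    define h where "h = inv_into UNIV g"
    have h: "h \<in> tree_aut d" "h \<circ> g = id" "g \<circ> h = id" using inv_tree_aut[OF ag(3)] by (auto simp: h_def)
    define b where "b = (\<lambda>x\<in>tree_boundary d. inv\<^bsub>F\<^esub> (\<phi> (aut_bd h x)), h)"
    have "b \<in> carrier ?W" using h ag by (auto simp: b_def wreath_carrier aut_bd_closed mem)
    moreover have "b \<otimes>\<^bsub>?W\<^esub> a = \<one>\<^bsub>?W\<^esub>"
      using h ag by (auto simp: b_def wreath_mult wreath_one aut_bd_closed mem intro!: restrict_ext)
    ultimately show ?thesis by blast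
  qed
qed

subsection \<open>Rooted automorphisms\<close>

lemma rooted_aut_Nil [simp]: "rooted_aut d \<tau> [] = []"
  by (simp add: rooted_aut_def)

lemma Cons_tree_vertices: "i # v \<in> tree_vertices d \<longleftrightarrow> 1 \<le> i \<and> i \<le> d 0 \<and> v \<in> tree_vertices (\<lambda>j. d (Suc j))"
  by (simp add: tree_vertices_def All_less_Suc2 conj_assoc)

lemma rooted_aut_Cons:
  "i # v \<in> tree_vertices d \<Longrightarrow> rooted_aut d \<tau> (i # v) = \<tau> i # v"
  by (simp add: rooted_aut_def)

lemma rooted_aut_comp:
  assumes "\<tau> permutes {1..d 0}"
  shows "rooted_aut d \<tau>' \<circ> rooted_aut d \<tau> = rooted_aut d (\<tau>' \<circ> \<tau>)"
proof
  fix v show "(rooted_aut d \<tau>' \<circ> rooted_aut d \<tau>) v = rooted_aut d (\<tau>' \<circ> \<tau>) v"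
  proof (cases v)
    case (Cons i w)
    have "\<tau> i # w \<in> tree_vertices d \<longleftrightarrow> i # w \<in> tree_vertices d"
      using permutes_in_image[OF assms, of i] by (auto simp: Cons_tree_vertices)
    then show ?thesis by (auto simp: rooted_aut_def Cons)
  qed simp
qed

lemma rooted_aut_id [simp]: "rooted_aut d id = id"
  by (auto simp: rooted_aut_def fun_eq_iff)

lemma rooted_aut_closed:
  assumes "\<tau> permutes {1..d 0}"
  shows "rooted_aut d \<tau> \<in> tree_aut d"
proof -
  have V: "rooted_aut d \<tau>' v \<in> tree_vertices d" if "v \<in> tree_vertices d" "\<tau>' permutes {1..d 0}" for \<tau>' v
    using that permutes_in_image[of \<tau>' "{1..d 0}" "hd v"]
    by (cases v) (auto simp: rooted_aut_Cons Cons_tree_vertices)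
  note inv = permutes_inv[OF assms]
  have c: "rooted_aut d (inv_into UNIV \<tau>) \<circ> rooted_aut d \<tau> = id" "rooted_aut d \<tau> \<circ> rooted_aut d (inv_into UNIV \<tau>) = id"
    using rooted_aut_comp[where d = d and \<tau> = \<tau> and \<tau>' = "inv_into UNIV \<tau>", OF assms]
      rooted_aut_comp[where d = d and \<tau> = "inv_into UNIV \<tau>" and \<tau>' = \<tau>, OF inv] permutes_inv_o[OF assms]
    by simp_all
  show ?thesis unfolding tree_aut_def
  proof (intro CollectI conjI ballI allI impI)
    show "bij_betw (rooted_aut d \<tau>) (tree_vertices d) (tree_vertices d)"
      by (rule bij_betw_byWitness[of _ "rooted_aut d (inv_into UNIV \<tau>)"])
         (use c V assms inv in \<open>auto simp: fun_eq_iff\<close>)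
    fix v assume v: "v \<in> tree_vertices d"
    show "length (rooted_aut d \<tau> v) = length v" by (cases v) (auto simp: rooted_aut_def)
    fix k
    show "rooted_aut d \<tau> (take k v) = take k (rooted_aut d \<tau> v)"
      using v take_tree_vertices[OF v, of k] by (cases v; cases k) (auto simp: rooted_aut_def)
  qed (simp add: rooted_aut_def)
qed

lemma rooted_aut_append:
  assumes "u \<noteq> []" "u @ y \<in> tree_vertices d"
  shows "rooted_aut d \<tau> (u @ y) = rooted_aut d \<tau> u @ y"
  using assms append_tree_vertices[OF assms(2)] by (simp add: rooted_aut_def)

lemma rooted_aut_label:
  assumes "u \<noteq> []" "u \<in> tree_vertices d"
  shows "aut_label d (rooted_aut d \<tau>) u = id"
proof
  fix i
  show "aut_label d (rooted_aut d \<tau>) u i = id i"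
    using rooted_aut_append[OF assms(1), of "[i]" d \<tau>] assms(2)
    by (auto simp: aut_label_def snoc_tree_vertices)
qed

section \<open>Lamps, letters and the law of a step\<close>

definition lamp :: "('f, 'm) monoid_scheme \<Rightarrow> (nat \<Rightarrow> nat) \<Rightarrow> 'f \<Rightarrow> (nat \<Rightarrow> nat) \<Rightarrow> 'f" where
  "lamp F d f = (\<lambda>x\<in>tree_boundary d. if x = ones_ray then f else \<one>\<^bsub>F\<^esub>)"

definition step_words :: "('f, 'm) monoid_scheme \<Rightarrow> (nat \<Rightarrow> nat) \<Rightarrow> (nat list \<Rightarrow> nat list) set
    \<Rightarrow> (((nat \<Rightarrow> nat) \<Rightarrow> 'f) \<times> (nat list \<Rightarrow> nat list)) list pmf" where
  "step_words F d H =
     do { s \<leftarrow> pmf_of_set (rooted_set F d);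
          k \<leftarrow> pmf_of_set (HF_set F d H);
          s' \<leftarrow> pmf_of_set (rooted_set F d);
          return_pmf [s, k, s'] }"

lemma ones_prefix [simp]: "prefix_of ones_ray n = replicate n 1"
  by (simp add: ones_ray_def map_replicate_const)

lemma replicate_not_special: "\<not> special_vertex (replicate k 1)"
  by (cases k) (auto simp: special_vertex_def simp flip: replicate_append_same)

lemma special_vertex_alt:
  "special_vertex v \<longleftrightarrow> (\<exists>k t. v = replicate k 1 @ [t] \<and> t \<noteq> 1)"
proof
  assume v: "special_vertex v"
  then have eq: "v = butlast v @ [last v]" by (simp add: special_vertex_def)
  have "butlast v = replicate (length v - 1) 1"
    by (rule nth_equalityI) (use v in \<open>auto simp: special_vertex_def nth_butlast\<close>)
  with eq v show "\<exists>k t. v = replicate k 1 @ [t] \<and> t \<noteq> 1"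
    unfolding special_vertex_def by metis
qed (auto simp: special_vertex_def nth_append)

locale saturated =
  fixes d :: "nat \<Rightarrow> nat" and F :: "('f, 'm) monoid_scheme" and H :: "(nat list \<Rightarrow> nat list) set"
  assumes d_ge2: "2 \<le> d j"
    and F_grp: "group F" and F_fin: "finite (carrier F)"
    and H_sub: "subgroup H (aut_group d)" and H_fin: "finite H"
    and H_Hd: "H \<subseteq> H_group_set d"
    and H_unif: "1 \<le> l \<Longrightarrow> 2 \<le> t \<Longrightarrow> t \<le> d (l - 1) \<Longrightarrow>
        map_pmf (\<lambda>h. aut_label d h (replicate (l - 1) 1 @ [t])) (pmf_of_set H)
          = pmf_of_set {p. p permutes {1..d l}}"
begin

abbreviation "W \<equiv> wreath F d"
abbreviation "R \<equiv> rooted_set F d"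
abbreviation "HF \<equiv> HF_set F d H"
abbreviation "\<Sigma> \<equiv> Sigma_set F d H"
abbreviation "\<Gamma> \<equiv> Gamma_grp F d H"

sublocale F: group F by (rule F_grp)
sublocale W: group W by (rule group_wreath[OF F_grp])

lemma d_pos: "Suc 0 \<le> d j" using d_ge2[of j] by simp

lemma ones_boundary [simp]: "ones_ray \<in> tree_boundary d"
  using d_pos by (simp add: tree_boundary_def ones_ray_def)

lemma ones_vertex [simp]: "replicate k (Suc 0) \<in> tree_vertices d"
  using prefix_tree_vertices[OF ones_boundary, of k] by simp

lemma H_aut: "h \<in> H \<Longrightarrow> h \<in> tree_aut d"
  using subgroup.subset[OF H_sub] by (auto simp: aut_group_def)

lemma H_label: "h \<in> H \<Longrightarrow> u \<in> tree_vertices d \<Longrightarrow> \<not> special_vertex u \<Longrightarrow> aut_label d h u = id"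
  using H_Hd by (auto simp: H_group_set_def)

lemma H_comp: "h \<in> H \<Longrightarrow> h' \<in> H \<Longrightarrow> h' \<circ> h \<in> H"
  using subgroup.m_closed[OF H_sub, of h h'] by (simp add: aut_group_def)

lemma H_id [simp]: "id \<in> H"
  using subgroup.one_closed[OF H_sub] by (simp add: aut_group_def)

lemma H_inv: assumes "h \<in> H" shows "inv_into UNIV h \<in> H"
proof -
  note h = inv_tree_aut[OF H_aut[OF assms]]
  have "inv\<^bsub>aut_group d\<^esub> h = inv_into UNIV h"
    by (rule group.inv_equality[OF group_aut_group]) (use h H_aut[OF assms] in \<open>auto simp: aut_group_def\<close>)
  then show ?thesis using subgroup.m_inv_closed[OF H_sub assms] by simp
qed

text \<open>No vertex 1^j is special, so the labels along the ray 1^\<infinity> are trivial.\<close>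

lemma H_ones [simp]: "h \<in> H \<Longrightarrow> h (replicate k (Suc 0)) = replicate k (Suc 0)"
proof (induction k)
  case 0
  then show ?case using tree_autD(2)[OF H_aut, of h "[]"] by simp
next
  case (Suc k)
  have eq: "replicate (Suc k) (Suc 0) = replicate k (Suc 0) @ [Suc 0]" by (simp add: replicate_append_same)
  have V: "replicate k (Suc 0) @ [Suc 0] \<in> tree_vertices d" using ones_vertex[of "Suc k"] unfolding eq .
  have "aut_label d h (replicate k (Suc 0)) = id"
    using H_label[OF Suc.prems ones_vertex[of k]] replicate_not_special[of k] by simp
  then show ?case unfolding eq tree_aut_append[OF H_aut[OF Suc.prems] V] using Suc by simp
qed

lemma H_special_fix:
  assumes h: "h \<in> H" and u: "u \<in> tree_vertices d" "special_vertex u"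
  shows "h u = u"
proof -
  obtain k t where eq: "u = replicate k 1 @ [t]" using u(2) by (auto simp: special_vertex_alt)
  have "aut_label d h (replicate k 1) = id"
    using H_label[OF h] replicate_not_special[of k] by simp
  then show ?thesis using tree_aut_append[OF H_aut[OF h], of "replicate k 1" t] u(1) h by (simp add: eq)
qed

text \<open>Proper prefixes of a special vertex consist of ones. So below a vertex that is neither
  special nor a power of 1 there are no special vertices, and h carries that subtree along
  rigidly.\<close>

lemma H_append:
  assumes h: "h \<in> H" and V: "u @ y \<in> tree_vertices d" and u: "u \<noteq> replicate (length u) 1" "\<not> special_vertex u"
  shows "h (u @ y) = h u @ y"
  using V
proof (induction y rule: rev_induct)
  case (snoc i y)
  then have V: "(u @ y) @ [i] \<in> tree_vertices d" "u @ y \<in> tree_vertices d"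
    using append_tree_vertices[of "u @ y" "[i]"] by auto
  have "\<not> special_vertex (u @ y)"
  proof
    assume "special_vertex (u @ y)"
    then obtain k t where eq: "u @ y = replicate k 1 @ [t]" "t \<noteq> 1" by (auto simp: special_vertex_alt)
    show False
    proof (cases y rule: rev_cases)
      case Nil
      then show False using eq u(2) by (auto simp: special_vertex_alt)
    next
      case (snoc y' b)
      then have "u @ y' = replicate k 1" using eq by simp
      then have "u = take (length u) (replicate k 1)" by (metis append_eq_conv_conj)
      then have "u = replicate (min (length u) k) 1" by simp
      then show False using u(1) by (metis length_replicate)
    qed
  qed
  then have "aut_label d h (u @ y) = id" using H_label[OF h V(2)] by simp
  then show ?case using tree_aut_append[OF H_aut[OF h] V(1)] snoc.IH V by simp
qed simp

lemma H_bd_ones [simp]: "h \<in> H \<Longrightarrow> aut_bd h ones_ray = ones_ray"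
  by (rule prefix_of_eqI) (simp add: prefix_aut_bd[OF H_aut])

lemma H_bd_ones_iff:
  assumes h: "h \<in> H" and x: "x \<in> tree_boundary d"
  shows "aut_bd h x = ones_ray \<longleftrightarrow> x = ones_ray"
proof
  assume eq: "aut_bd h x = ones_ray"
  have "h (prefix_of x n) = replicate n (Suc 0)" for n
    using prefix_aut_bd[OF H_aut[OF h] x, of n] by (simp add: eq)
  then have "h (prefix_of x n) = h (replicate n 1)" for n
    using H_ones[OF h, of n] by simp
  then have "prefix_of x n = prefix_of ones_ray n" for n using tree_aut_inj[OF H_aut[OF h]] by simp
  then show "x = ones_ray" by (rule prefix_of_eqI)
qed (use h in simp)

lemma lamp_closed: "f \<in> carrier F \<Longrightarrow> lamp F d f \<in> tree_boundary d \<rightarrow>\<^sub>E carrier F"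
  by (auto simp: lamp_def)

lemma lamp_one: "lamp F d \<one>\<^bsub>F\<^esub> = (\<lambda>x\<in>tree_boundary d. \<one>\<^bsub>F\<^esub>)"
  by (auto simp: lamp_def)

lemma lamp_wreath: "f \<in> carrier F \<Longrightarrow> g \<in> tree_aut d \<Longrightarrow> (lamp F d f, g) \<in> carrier W"
  by (simp add: wreath_carrier lamp_closed)

lemma W_one: "\<one>\<^bsub>W\<^esub> = (lamp F d \<one>\<^bsub>F\<^esub>, id)"
  by (simp add: wreath_one lamp_one)

lemma aut_el_lamp: "aut_el F d g = (lamp F d \<one>\<^bsub>F\<^esub>, g)"
  by (simp add: aut_el_def lamp_one)

lemma phi_f_lamp: "phi_f F d f = (lamp F d f, id)"
  by (simp add: phi_f_def lamp_def)

text \<open>Elements of H fix 1^\<infinity>, hence they do not move the lamp there: this gives HF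
  its direct product structure.\<close>

lemma lamp_mult:
  assumes "h \<in> H" "f \<in> carrier F" "f' \<in> carrier F"
  shows "(lamp F d f, h) \<otimes>\<^bsub>W\<^esub> (lamp F d f', h') = (lamp F d (f \<otimes>\<^bsub>F\<^esub> f'), h' \<circ> h)"
proof -
  have "(\<lambda>x\<in>tree_boundary d. lamp F d f x \<otimes>\<^bsub>F\<^esub> lamp F d f' (aut_bd h x)) = lamp F d (f \<otimes>\<^bsub>F\<^esub> f')"
    unfolding lamp_def
    by (rule restrict_ext) (use assms in \<open>auto simp: H_bd_ones_iff aut_bd_closed[OF H_aut]\<close>)
  then show ?thesis by (simp add: wreath_mult)
qed

lemma rooted_mult:
  assumes "g \<in> tree_aut d"
  shows "(lamp F d \<one>\<^bsub>F\<^esub>, g) \<otimes>\<^bsub>W\<^esub> (lamp F d \<one>\<^bsub>F\<^esub>, g') = (lamp F d \<one>\<^bsub>F\<^esub>, g' \<circ> g)"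
proof -
  have "(\<lambda>x\<in>tree_boundary d. lamp F d \<one>\<^bsub>F\<^esub> x \<otimes>\<^bsub>F\<^esub> lamp F d \<one>\<^bsub>F\<^esub> (aut_bd g x)) = lamp F d \<one>\<^bsub>F\<^esub>"
    unfolding lamp_one
    by (rule restrict_ext) (use assms in \<open>simp add: aut_bd_closed\<close>)
  then show ?thesis by (simp add: wreath_mult)
qed

lemma phi_aut_mult: "f \<in> carrier F \<Longrightarrow> phi_f F d f \<otimes>\<^bsub>W\<^esub> aut_el F d h = (lamp F d f, h)"
  using lamp_mult[OF H_id _ F.one_closed, of f h] by (simp add: phi_f_lamp aut_el_lamp)

lemma HF_I: "f \<in> carrier F \<Longrightarrow> h \<in> H \<Longrightarrow> (lamp F d f, h) \<in> HF"
  unfolding HF_set_def using phi_aut_mult[of f h] by (intro CollectI exI[of _ f] exI[of _ h]) simp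

lemma HF_E:
  assumes "a \<in> HF"
  obtains f h where "f \<in> carrier F" "h \<in> H" "a = (lamp F d f, h)"
proof -
  obtain f h where "f \<in> carrier F" "h \<in> H" "a = phi_f F d f \<otimes>\<^bsub>W\<^esub> aut_el F d h"
    using assms unfolding HF_set_def by (elim CollectE exE conjE)
  then show ?thesis using that by (simp only: phi_aut_mult)
qed

lemma HF_alt: "HF = (\<lambda>(f, h). (lamp F d f, h)) ` (carrier F \<times> H)"
proof (intro equalityI subsetI)
  fix a assume "a \<in> HF"
  then show "a \<in> (\<lambda>(f, h). (lamp F d f, h)) ` (carrier F \<times> H)"
    by (rule HF_E) (auto intro: image_eqI[of _ _ "(f, h)" for f h])
qed (auto intro: HF_I)

lemma rooted_closed: "\<tau> permutes {1..d 0} \<Longrightarrow> rooted_aut d \<tau> \<in> tree_aut d"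
  by (rule rooted_aut_closed)

lemma rooted_comp: "\<tau> permutes {1..d 0} \<Longrightarrow>
    rooted_aut d \<tau>' \<circ> rooted_aut d \<tau> = rooted_aut d (\<tau>' \<circ> \<tau>)"
  by (rule rooted_aut_comp)

lemma R_alt: "R = (\<lambda>\<tau>. (lamp F d \<one>\<^bsub>F\<^esub>, rooted_aut d \<tau>)) ` {\<tau>. \<tau> permutes {1..d 0}}"
  by (auto simp: rooted_set_def aut_el_lamp)

lemma subgroup_R: "subgroup R W"
proof (rule W.subgroupI)
  show "R \<subseteq> carrier W" by (auto simp: R_alt lamp_wreath rooted_aut_closed)
  have "(lamp F d \<one>\<^bsub>F\<^esub>, rooted_aut d id) \<in> R"
    unfolding R_alt using permutes_id by blast
  then show "R \<noteq> {}" by blast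
  show "a \<otimes>\<^bsub>W\<^esub> b \<in> R" if ab: "a \<in> R" "b \<in> R" for a b
  proof -
    obtain \<tau> \<tau>' where t: "\<tau> permutes {1..d 0}" "\<tau>' permutes {1..d 0}"
      "a = (lamp F d \<one>\<^bsub>F\<^esub>, rooted_aut d \<tau>)" "b = (lamp F d \<one>\<^bsub>F\<^esub>, rooted_aut d \<tau>')"
      using ab by (auto simp: R_alt)
    then show ?thesis using rooted_mult[OF rooted_closed[OF t(1)]] permutes_compose[OF t(1,2)]
      by (auto simp: R_alt rooted_comp)
  qed
  show "inv\<^bsub>W\<^esub> a \<in> R" if a: "a \<in> R" for a
  proof -
    obtain \<tau> where t: "\<tau> permutes {1..d 0}" "a = (lamp F d \<one>\<^bsub>F\<^esub>, rooted_aut d \<tau>)"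
      using a by (auto simp: R_alt)
    let ?t = "inv_into UNIV \<tau>"
    have t': "?t permutes {1..d 0}" by (rule permutes_inv[OF t(1)])
    have "(lamp F d \<one>\<^bsub>F\<^esub>, rooted_aut d ?t) \<otimes>\<^bsub>W\<^esub> a = \<one>\<^bsub>W\<^esub>"
      using rooted_mult[OF rooted_closed[OF t']] rooted_comp[OF t', of \<tau>] permutes_inv_o[OF t(1)]
      by (simp add: t(2) W_one)
    then have "inv\<^bsub>W\<^esub> a = (lamp F d \<one>\<^bsub>F\<^esub>, rooted_aut d ?t)"
      by (rule W.inv_equality) (simp_all only: t(2) lamp_wreath[OF F.one_closed rooted_closed[OF t(1)]] lamp_wreath[OF F.one_closed rooted_closed[OF t'] ])
    then show ?thesis using t' by (auto simp: R_alt)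
  qed
qed

lemma subgroup_HF: "subgroup HF W"
proof (rule W.subgroupI)
  show "HF \<subseteq> carrier W" by (auto elim!: HF_E intro!: lamp_wreath H_aut)
  have "(lamp F d \<one>\<^bsub>F\<^esub>, id) \<in> HF"
    by (rule HF_I) simp_all
  then show "HF \<noteq> {}" by blast
  show "a \<otimes>\<^bsub>W\<^esub> b \<in> HF" if "a \<in> HF" "b \<in> HF" for a b
    using that by (auto elim!: HF_E simp: lamp_mult intro!: HF_I H_comp)
  show "inv\<^bsub>W\<^esub> a \<in> HF" if a: "a \<in> HF" for a
  proof -
    obtain f h where t: "f \<in> carrier F" "h \<in> H" "a = (lamp F d f, h)"
      using a by (rule HF_E)
    let ?h = "inv_into UNIV h"
    have h': "?h \<in> H" "h \<circ> ?h = id" using H_inv[OF t(2)] inv_tree_aut(3)[OF H_aut[OF t(2)]] by auto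
    have "(lamp F d (inv\<^bsub>F\<^esub> f), ?h) \<otimes>\<^bsub>W\<^esub> a = \<one>\<^bsub>W\<^esub>"
      using h' t by (simp add: lamp_mult W_one)
    then have "inv\<^bsub>W\<^esub> a = (lamp F d (inv\<^bsub>F\<^esub> f), ?h)"
      by (rule W.inv_equality) (auto simp: t lamp_wreath H_aut h')
    then show ?thesis using HF_I[of "inv\<^bsub>F\<^esub> f" ?h] h' t by simp
  qed
qed

lemma finite_R: "finite R"
  by (simp add: R_alt finite_permutations)

lemma finite_HF: "finite HF"
  by (simp add: HF_alt F_fin H_fin)

lemma one_R: "\<one>\<^bsub>W\<^esub> \<in> R" and one_HF: "\<one>\<^bsub>W\<^esub> \<in> HF"
  using subgroup_R subgroup_HF by (auto intro: subgroup.one_closed)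

text \<open>The definition of \<Gamma> uses the three families separately; combining H and the lamps
  to the subgroup HF gives the generating set, closed under inverses, with respect to which the norm
  is taken.\<close>

lemma Gamma_generate: "\<Gamma> = W\<lparr>carrier := generate W \<Sigma>\<rparr>"
proof -
  let ?S = "R \<union> aut_el F d ` H \<union> phi_f F d ` carrier F"
  have el: "aut_el F d h \<in> HF" if "h \<in> H" for h
    using HF_I[OF F.one_closed that] by (simp add: aut_el_lamp)
  have ph: "phi_f F d f \<in> HF" if "f \<in> carrier F" for f
    using HF_I[OF that H_id] by (simp add: phi_f_lamp)
  have "?S \<subseteq> \<Sigma>" using el ph by (auto simp: Sigma_set_def)
  then have 1: "generate W ?S \<subseteq> generate W \<Sigma>" by (rule W.mono_generate)
  have SW: "?S \<subseteq> carrier W"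
    using \<open>?S \<subseteq> \<Sigma>\<close> subgroup.subset[OF subgroup_R] subgroup.subset[OF subgroup_HF]
    unfolding Sigma_set_def by (meson Un_least subset_trans)
  have "HF \<subseteq> generate W ?S"
  proof
    fix a assume "a \<in> HF"
    then obtain f h where "f \<in> carrier F" "h \<in> H" "a = phi_f F d f \<otimes>\<^bsub>W\<^esub> aut_el F d h"
      unfolding HF_set_def by (elim CollectE exE conjE)
    then show "a \<in> generate W ?S" by (auto intro: generate.eng generate.incl)
  qed
  moreover have "R \<subseteq> generate W ?S" by (auto intro: generate.incl)
  ultimately have "\<Sigma> \<subseteq> generate W ?S" by (simp add: Sigma_set_def)
  then have "generate W \<Sigma> \<subseteq> generate W ?S"
    by (rule W.generate_subgroup_incl[OF _ W.generate_is_subgroup[OF SW]])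
  with 1 show ?thesis by (simp add: Gamma_grp_def)
qed

lemma Sigma_carrier: "\<Sigma> \<subseteq> carrier W"
  using subgroup.subset[OF subgroup_R] subgroup.subset[OF subgroup_HF] by (simp add: Sigma_set_def)

lemma Sigma_inv: "a \<in> \<Sigma> \<Longrightarrow> inv\<^bsub>W\<^esub> a \<in> \<Sigma>"
  using subgroup.m_inv_closed[OF subgroup_R, of a] subgroup.m_inv_closed[OF subgroup_HF, of a]
  by (auto simp: Sigma_set_def)

lemma finite_Sigma: "finite \<Sigma>"
  by (simp add: Sigma_set_def finite_R finite_HF)

lemma marked_Gamma: "marked_group \<Gamma> \<Sigma>"
  unfolding Gamma_generate
  by (rule W.marked_group_generate[OF finite_Sigma Sigma_carrier Sigma_inv])

sublocale \<Gamma>: marked_group \<Gamma> \<Sigma> by (rule marked_Gamma)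

lemma wprod_Gamma: "wprod \<Gamma> = wprod W"
  by (simp add: Gamma_generate fun_eq_iff)

lemma one_Gamma: "\<one>\<^bsub>\<Gamma>\<^esub> = \<one>\<^bsub>W\<^esub>"
  by (simp add: Gamma_generate)

lemma mult_Gamma: "a \<otimes>\<^bsub>\<Gamma>\<^esub> b = a \<otimes>\<^bsub>W\<^esub> b"
  by (simp add: Gamma_generate)

lemma inv_Gamma: "a \<in> \<Sigma> \<Longrightarrow> inv\<^bsub>\<Gamma>\<^esub> a = inv\<^bsub>W\<^esub> a"
  unfolding Gamma_generate
  by (rule W.m_inv_consistent[OF W.generate_is_subgroup[OF Sigma_carrier] generate.incl])

lemma set_step_words: "set_pmf (step_words F d H) = {[s, k, s'] | s k s'. s \<in> R \<and> k \<in> HF \<and> s' \<in> R}"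
proof -
  have "R \<noteq> {}" "HF \<noteq> {}" using one_R one_HF by auto
  then show ?thesis using finite_R finite_HF by (auto simp: step_words_def)
qed

lemma finite_step_words: "finite (set_pmf (step_words F d H))"
proof -
  have "set_pmf (step_words F d H) \<subseteq> (\<lambda>(s, k, s'). [s, k, s']) ` (R \<times> HF \<times> R)"
  proof
    fix w assume "w \<in> set_pmf (step_words F d H)"
    then obtain s k s' where "w = [s, k, s']" "s \<in> R" "k \<in> HF" "s' \<in> R" unfolding set_step_words by blast
    then show "w \<in> (\<lambda>(s, k, s'). [s, k, s']) ` (R \<times> HF \<times> R)"
      by (intro image_eqI[of _ _ "(s, k, s')"]) simp_all
  qed
  then show ?thesis by (rule finite_subset) (simp add: finite_R finite_HF)
qed

lemma step_words_Sigma: "w \<in> set_pmf (step_words F d H) \<Longrightarrow> set w \<subseteq> \<Sigma>"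
  by (auto simp: set_step_words Sigma_set_def)

lemma step_law_words: "step_law F d H = map_pmf (wprod \<Gamma>) (step_words F d H)"
proof -
  have ne: "R \<noteq> {}" "HF \<noteq> {}" using one_R one_HF by auto
  have "s \<otimes>\<^bsub>W\<^esub> k \<otimes>\<^bsub>W\<^esub> s' = wprod \<Gamma> [s, k, s']" if "s \<in> R" "k \<in> HF" "s' \<in> R" for s k s'
  proof -
    have "s \<in> carrier W" "k \<in> carrier W" "s' \<in> carrier W"
      using that subgroup.subset[OF subgroup_R] subgroup.subset[OF subgroup_HF] by blast+
    then show ?thesis by (simp add: wprod_Gamma W.m_assoc)
  qed
  then show ?thesis unfolding step_law_def step_words_def map_bind_pmf map_return_pmf
    using ne finite_R finite_HF
    by (intro bind_pmf_cong refl arg_cong[of _ _ return_pmf]) auto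
qed

lemma map_inv_uniform:
  assumes "subgroup K W" "finite K"
  shows "map_pmf (\<lambda>a. inv\<^bsub>W\<^esub> a) (pmf_of_set K) = pmf_of_set K"
proof -
  have K: "K \<subseteq> carrier W" by (rule subgroup.subset[OF assms(1)])
  have ne: "K \<noteq> {}" using subgroup.one_closed[OF assms(1)] by auto
  have inj: "inj_on (\<lambda>a. inv\<^bsub>W\<^esub> a) K" by (rule inj_on_subset[OF W.inv_inj K])
  have "(\<lambda>a. inv\<^bsub>W\<^esub> a) ` K = K"
    by (rule endo_inj_surj[OF assms(2) image_subsetI inj]) (rule subgroup.m_inv_closed[OF assms(1)])
  then show ?thesis using map_pmf_of_set_inj[OF inj ne assms(2)] by simp
qed

text \<open>Reversal exchanges the two rooted letters, and the uniform law on a finite subgroup is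
  invariant under inversion; the rest is commutation of independent choices.\<close>

lemma step_words_symmetric:
  "map_pmf (\<lambda>w. rev (map (\<lambda>a. inv\<^bsub>\<Gamma>\<^esub> a) w)) (step_words F d H) = step_words F d H"
proof -
  let ?i = "\<lambda>a. inv\<^bsub>W\<^esub> a"
  have "map_pmf (\<lambda>w. rev (map (\<lambda>a. inv\<^bsub>\<Gamma>\<^esub> a) w)) (step_words F d H)
      = map_pmf (\<lambda>w. rev (map ?i w)) (step_words F d H)"
    by (rule map_pmf_cong[OF refl]) (use step_words_Sigma inv_Gamma in \<open>auto simp: subset_iff\<close>)
  also have "\<dots> = do { s \<leftarrow> map_pmf ?i (pmf_of_set R); k \<leftarrow> map_pmf ?i (pmf_of_set HF);
      s' \<leftarrow> map_pmf ?i (pmf_of_set R); return_pmf [s', k, s] }"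
    by (simp add: step_words_def map_bind_pmf bind_map_pmf)
  also have "\<dots> = do { s \<leftarrow> pmf_of_set R; k \<leftarrow> pmf_of_set HF; s' \<leftarrow> pmf_of_set R; return_pmf [s', k, s] }"
    by (simp only: map_inv_uniform subgroup_R subgroup_HF finite_R finite_HF)
  also have "\<dots> = do { s \<leftarrow> pmf_of_set R; s' \<leftarrow> pmf_of_set R; k \<leftarrow> pmf_of_set HF; return_pmf [s', k, s] }"
    by (rule bind_pmf_cong[OF refl]) (rule bind_commute_pmf)
  also have "\<dots> = do { s' \<leftarrow> pmf_of_set R; s \<leftarrow> pmf_of_set R; k \<leftarrow> pmf_of_set HF; return_pmf [s', k, s] }"
    by (rule bind_commute_pmf)
  also have "\<dots> = step_words F d H" unfolding step_words_def
    by (rule bind_pmf_cong[OF refl]) (rule bind_commute_pmf)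
  finally show ?thesis .
qed

lemma symmetric_walk: "symmetric_walk \<Gamma> \<Sigma> (step_words F d H)"
proof (intro symmetric_walk.intro symmetric_walk_axioms.intro)
  show "marked_group \<Gamma> \<Sigma>" by (rule marked_Gamma)
  show "finite (set_pmf (step_words F d H))" by (rule finite_step_words)
  show "set w \<subseteq> \<Sigma>" if "w \<in> set_pmf (step_words F d H)" for w using step_words_Sigma[OF that] .
  show "length w \<le> 3" if "w \<in> set_pmf (step_words F d H)" for w using that by (auto simp: set_step_words)
qed (rule step_words_symmetric)

end

section \<open>Random walk on a truncated biregular tree\<close>

text \<open>Vertices are alternating words in letters \<open>(b, i)\<close> with \<open>2 \<le> i \<le> m b\<close>, of length at most \<open>L\<close>:
  the coset tree of a free product of two finite groups acting on \<open>{1..m b}\<close>, where the point 1 is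
  identified with the vertex from which the letter \<open>b\<close> branches off.\<close>

definition tree_words :: "(bool \<Rightarrow> nat) \<Rightarrow> nat \<Rightarrow> (bool \<times> nat) list set" where
  "tree_words m L = {w. length w \<le> L \<and> (\<forall>p\<in>set w. 2 \<le> snd p \<and> snd p \<le> m (fst p)) \<and>
     successively (\<lambda>p q. fst p \<noteq> fst q) w}"

definition headed :: "bool \<Rightarrow> (bool \<times> nat) list \<Rightarrow> bool" where
  "headed b w \<longleftrightarrow> w \<noteq> [] \<and> fst (hd w) = b"

text \<open>The vertex from which the block of type b through w hangs; \<open>branch b w\<close> is
  the position of w in this block, 1 being the base itself. The outer end of a word is the head of
  the list.\<close>

definition base :: "bool \<Rightarrow> (bool \<times> nat) list \<Rightarrow> (bool \<times> nat) list" where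
  "base b w = (if headed b w then tl w else w)"

definition branch :: "bool \<Rightarrow> (bool \<times> nat) list \<Rightarrow> nat" where
  "branch b w = (if headed b w then snd (hd w) else 1)"

definition put :: "bool \<Rightarrow> nat \<Rightarrow> (bool \<times> nat) list \<Rightarrow> (bool \<times> nat) list" where
  "put b j w = (if j = 1 then w else (b, j) # w)"

text \<open>Blocks hanging from a vertex of maximal length L are left fixed, since their other
  points lie outside the truncated tree; every other block is contained in the truncated tree and is
  permuted as a whole.\<close>

definition turn :: "(bool \<Rightarrow> nat) \<Rightarrow> nat \<Rightarrow> bool \<Rightarrow> (nat \<Rightarrow> nat) \<Rightarrow> (bool \<times> nat) list \<Rightarrow> (bool \<times> nat) list" where
  "turn m L b \<tau> w = (if w \<in> tree_words m L \<and> length (base b w) < L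
     then put b (\<tau> (branch b w)) (base b w) else w)"

lemma finite_tree_words: "finite (tree_words m L)"
proof -
  have "tree_words m L \<subseteq> {w. set w \<subseteq> UNIV \<times> {..max (m True) (m False)} \<and> length w \<le> L}"
  proof
    fix w assume w: "w \<in> tree_words m L"
    have "p \<in> UNIV \<times> {..max (m True) (m False)}" if "p \<in> set w" for p
      using w that by (cases p; cases "fst p") (auto simp: tree_words_def le_max_iff_disj)
    then show "w \<in> {w. set w \<subseteq> UNIV \<times> {..max (m True) (m False)} \<and> length w \<le> L}"
      using w by (auto simp: tree_words_def)
  qed
  then show ?thesis by (rule finite_subset) (intro finite_lists_length_le, simp)
qed

lemma Nil_tree_words [simp]: "[] \<in> tree_words m L"
  by (simp add: tree_words_def)

lemma Cons_tree_words: "(b, j) # w \<in> tree_words m L \<longleftrightarrow>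
    w \<in> tree_words m L \<and> length w < L \<and> 2 \<le> j \<and> j \<le> m b \<and> \<not> headed b w"
  by (cases w) (auto simp: tree_words_def headed_def)

lemma base_put [simp]: "\<not> headed b v \<Longrightarrow> base b (put b j v) = v"
  by (auto simp: base_def put_def headed_def)

lemma branch_put [simp]: "\<not> headed b v \<Longrightarrow> branch b (put b j v) = j"
  by (auto simp: branch_def put_def headed_def)

lemma put_branch: "w \<in> tree_words m L \<Longrightarrow> put b (branch b w) (base b w) = w"
  by (cases w) (auto simp: base_def put_def headed_def branch_def Cons_tree_words)

lemma base_props:
  assumes "w \<in> tree_words m L"
  shows "base b w \<in> tree_words m L" "\<not> headed b (base b w)" "length (base b w) \<le> length w"
    "length w \<le> length (base b w) + 1"
  using assms by (cases w; auto simp: base_def headed_def Cons_tree_words)+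

lemma branch_range: "w \<in> tree_words m L \<Longrightarrow> 1 \<le> m b \<Longrightarrow> branch b w \<in> {1..m b}"
  by (cases w) (auto simp: branch_def headed_def Cons_tree_words)

lemma put_tree_words:
  "v \<in> tree_words m L \<Longrightarrow> \<not> headed b v \<Longrightarrow> length v < L \<Longrightarrow> j \<in> {1..m b} \<Longrightarrow> put b j v \<in> tree_words m L"
  by (auto simp: put_def Cons_tree_words)

lemma turn_closed:
  assumes "\<tau> permutes {1..m b}" "1 \<le> m b" "w \<in> tree_words m L"
  shows "turn m L b \<tau> w \<in> tree_words m L"
proof -
  have "\<tau> (branch b w) \<in> {1..m b}"
    using permutes_in_image[OF assms(1)] branch_range[where b = b and m = m, OF assms(3,2)] by blast
  then show ?thesis using base_props[OF assms(3), of b] assms(3)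
    by (auto simp: turn_def intro!: put_tree_words)
qed

lemma turn_comp:
  assumes "\<tau> permutes {1..m b}" "1 \<le> m b"
  shows "turn m L b \<tau>' (turn m L b \<tau> w) = turn m L b (\<tau>' \<circ> \<tau>) w"
proof (cases "w \<in> tree_words m L \<and> length (base b w) < L")
  case True
  then have w: "w \<in> tree_words m L" "length (base b w) < L" by auto
  have "turn m L b \<tau> w \<in> tree_words m L" using turn_closed[where m = m and b = b, OF assms w(1)] .
  moreover have "turn m L b \<tau> w = put b (\<tau> (branch b w)) (base b w)" using w by (simp add: turn_def)
  ultimately show ?thesis using w base_props(2)[OF w(1), of b] by (simp add: turn_def)
qed (auto simp: turn_def)

lemma turn_id [simp]: "turn m L b id w = w"
  by (auto simp: turn_def intro: put_branch)

lemma turn_permutes: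
  assumes t: "\<tau> permutes {1..m b}" and m: "1 \<le> m b"
  shows "turn m L b \<tau> permutes tree_words m L"
proof (rule bij_imp_permutes)
  let ?t = "inv_into UNIV \<tau>"
  have t': "?t permutes {1..m b}" by (rule permutes_inv[OF t])
  have "turn m L b ?t (turn m L b \<tau> w) = w" "turn m L b \<tau> (turn m L b ?t w) = w" for w
    using turn_comp[where m = m and b = b, OF t m, of L ?t w]
      turn_comp[where m = m and b = b, OF t' m, of L \<tau> w] permutes_inv_o[OF t]
    by simp_all
  then show "bij_betw (turn m L b \<tau>) (tree_words m L) (tree_words m L)"
    using turn_closed[where m = m and b = b, OF t m] turn_closed[where m = m and b = b, OF t' m]
    by (intro bij_betw_byWitness[of _ "turn m L b ?t"]) auto
qed (simp add: turn_def)

lemma length_turn: "length (turn m L b \<tau> w) \<le> length w + 1"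
  by (auto simp: turn_def put_def base_def)

text \<open>The mean of \<open>f\<close> over the block of type b through w, that is, the expected
  value after a uniform move of this type. It depends on w only through its block.\<close>

definition avg :: "(bool \<Rightarrow> nat) \<Rightarrow> bool \<Rightarrow> ((bool \<times> nat) list \<Rightarrow> real) \<Rightarrow> (bool \<times> nat) list \<Rightarrow> real" where
  "avg m b f w = (\<Sum>j = 1..m b. f (put b j (base b w))) / real (m b)"

lemma avg_mono:
  assumes "\<And>j. j \<in> {1..m b} \<Longrightarrow> f (put b j (base b w)) \<le> g (put b j (base b w))"
  shows "avg m b f w \<le> avg m b g w"
  unfolding avg_def using assms by (intro divide_right_mono sum_mono) auto

lemma avg_cong:
  assumes "\<And>j. j \<in> {1..m b} \<Longrightarrow> f (put b j (base b w)) = g (put b j (base b w))"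
  shows "avg m b f w = avg m b g w"
  unfolding avg_def using assms by (intro arg_cong2[of _ _ _ _ "(/)"] sum.cong) auto

lemma avg_add: "1 \<le> m b \<Longrightarrow> avg m b (\<lambda>v. f v + c) w = avg m b f w + c"
  by (simp add: avg_def sum.distrib add_divide_distrib)

text \<open>A second uniform move in the same block has no effect on the law, so only changes of
  type can produce drift.\<close>

lemma avg_avg:
  assumes "w \<in> tree_words m L" "1 \<le> m b"
  shows "avg m b (avg m b f) w = avg m b f w"
proof -
  have "avg m b f (put b j (base b w)) = avg m b f w" for j
    using base_props(2)[OF assms(1), of b] by (simp add: avg_def)
  then have "avg m b (avg m b f) w = (\<Sum>j = 1..m b. avg m b f w) / real (m b)" by (simp add: avg_def[of m b "avg m b f"])
  then show ?thesis using assms(2) by simp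
qed

lemma sum_from_1:
  fixes f :: "nat \<Rightarrow> real"
  shows "1 \<le> n \<Longrightarrow> (\<Sum>j = 1..n. f j) = f 1 + (\<Sum>j = 2..n. f j)"
  by (subst sum.atLeast_Suc_atMost) (auto simp: numeral_2_eq_2)

text \<open>Let n be the length of the base. With probability 1 - 1/m b the first move leads to a
  point of length n + 1 from which a new block of type b' hangs, giving mean length n + 2 - 1/m b';
  with probability 1/m b it leads to the base, where at worst one letter is lost, giving at least n
  - 1/m b'. The total exceeds n + 1 - 1/m b by the stated amount.\<close>

lemma avg_length_alternate:
  assumes w: "w \<in> tree_words m L" and m: "1 \<le> m True" "1 \<le> m False" and bb': "b' \<noteq> b"
  shows "avg m b (\<lambda>v. real (length v)) w + (1 - 1 / real (m b) - 1 / real (m b'))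
     \<le> avg m b (avg m b' (\<lambda>v. real (length v))) w"
proof -
  define v where "v = base b w"
  define n where "n = real (length v)"
  have v: "v \<in> tree_words m L" "\<not> headed b v" using base_props[OF w, of b] by (auto simp: v_def)
  have mb: "1 \<le> m b" "1 \<le> m b'" using m by (cases b; cases b'; auto)+
  have av: "avg m b' (\<lambda>v. real (length v)) u = real (length (base b' u)) + 1 - 1 / real (m b')" for u
    unfolding avg_def sum_from_1[OF mb(2)] using mb(2)
    by (simp add: put_def field_simps of_nat_diff)
  have j1: "n - 1 / real (m b') \<le> avg m b' (\<lambda>v. real (length v)) (put b 1 v)"
    using base_props(4)[OF v(1), of b'] by (simp add: av put_def n_def)
  have j2: "avg m b' (\<lambda>v. real (length v)) (put b j v) = n + 2 - 1 / real (m b')" if "j \<noteq> 1" for j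
    unfolding av using that bb' by (simp add: put_def n_def base_def headed_def)
  have "avg m b (avg m b' (\<lambda>v. real (length v))) w =
    (avg m b' (\<lambda>v. real (length v)) (put b 1 v) + (real (m b) - 1) * (n + 2 - 1 / real (m b'))) / real (m b)"
    unfolding avg_def[of m b "avg m b' _"] sum_from_1[OF mb(1)] v_def[symmetric]
    using mb(1) by (simp add: j2 of_nat_diff)
  also have "\<dots> \<ge> (n - 1 / real (m b') + (real (m b) - 1) * (n + 2 - 1 / real (m b'))) / real (m b)"
    using j1 by (intro divide_right_mono) auto
  finally have "(n - 1 / real (m b') + (real (m b) - 1) * (n + 2 - 1 / real (m b'))) / real (m b)
      \<le> avg m b (avg m b' (\<lambda>v. real (length v))) w" .
  moreover have "avg m b (\<lambda>v. real (length v)) w = n + 1 - 1 / real (m b)"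
    unfolding avg_def sum_from_1[OF mb(1)] v_def[symmetric] using mb(1)
    by (simp add: put_def n_def field_simps of_nat_diff)
  moreover have "(n - 1 / real (m b') + (real (m b) - 1) * (n + 2 - 1 / real (m b'))) / real (m b)
     = n + 1 - 1 / real (m b) + (1 - 1 / real (m b) - 1 / real (m b'))"
    using mb by (simp add: field_simps)
  ultimately show ?thesis by simp
qed

text \<open>Only the image of the current branch enters, so the one-point marginals of the random
  permutation determine the law; the bound on the length keeps w away from the truncation.\<close>

lemma expectation_turn:
  fixes f :: "(bool \<times> nat) list \<Rightarrow> real"
  assumes w: "w \<in> tree_words m L" "length w < L" and mb: "1 \<le> m b"
    and unif: "\<And>j. j \<in> {1..m b} \<Longrightarrow> map_pmf (\<lambda>a. \<tau> a j) p = pmf_of_set {1..m b}"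
  shows "measure_pmf.expectation p (\<lambda>a. f (turn m L b (\<tau> a) w)) = avg m b f w"
proof -
  have "length (base b w) < L" using base_props(3)[OF w(1), of b] w(2) by linarith
  then have "measure_pmf.expectation p (\<lambda>a. f (turn m L b (\<tau> a) w))
      = measure_pmf.expectation p (\<lambda>a. f (put b (\<tau> a (branch b w)) (base b w)))"
    using w by (simp add: turn_def)
  also have "\<dots> = measure_pmf.expectation (map_pmf (\<lambda>a. \<tau> a (branch b w)) p) (\<lambda>j. f (put b j (base b w)))"
    by simp
  also have "\<dots> = measure_pmf.expectation (pmf_of_set {1..m b}) (\<lambda>j. f (put b j (base b w)))"
    using unif[OF branch_range[where b = b and m = m, OF w(1) mb]] by simp
  also have "\<dots> = avg m b f w"
    using mb by (subst integral_pmf_of_set) (auto simp: avg_def)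
  finally show ?thesis .
qed

section \<open>Locally faithful finite actions\<close>

lemma (in group) translation_permutes:
  assumes fin: "finite (carrier G)" and e: "bij_betw e {1..card (carrier G)} (carrier G)"
    and c: "c \<in> carrier G"
  defines "\<rho> \<equiv> \<lambda>c j. if j \<in> {1..card (carrier G)} then inv_into {1..card (carrier G)} e (e j \<otimes> c) else j"
  shows "\<rho> c permutes {1..card (carrier G)}" "j \<in> {1..card (carrier G)} \<Longrightarrow> e (\<rho> c j) = e j \<otimes> c"
proof -
  let ?I = "{1..card (carrier G)}"
  have eI: "e j \<in> carrier G" if "j \<in> ?I" for j using bij_betwE[OF e] that by blast
  have e_rho: "e (\<rho> c j) = e j \<otimes> c" "\<rho> c j \<in> ?I" if "j \<in> ?I" for j
  proof -
    have m: "e j \<otimes> c \<in> e ` ?I" using eI[OF that] c e by (simp add: bij_betw_def)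
    show "e (\<rho> c j) = e j \<otimes> c" using f_inv_into_f[OF m] that by (simp add: \<rho>_def)
    show "\<rho> c j \<in> ?I" using inv_into_into[OF m] that by (simp add: \<rho>_def)
  qed
  then show "j \<in> ?I \<Longrightarrow> e (\<rho> c j) = e j \<otimes> c" by blast
  have inj: "inj_on (\<rho> c) ?I"
  proof (rule inj_onI)
    fix i j assume ij: "i \<in> ?I" "j \<in> ?I" "\<rho> c i = \<rho> c j"
    then have "e i \<otimes> c = e j \<otimes> c" using e_rho(1)[OF ij(1)] e_rho(1)[OF ij(2)] by simp
    then have "e i = e j" using eI[OF ij(1)] eI[OF ij(2)] c by simp
    then show "i = j" using ij e by (auto simp: bij_betw_def dest: inj_onD)
  qed
  have "\<rho> c ` ?I = ?I" by (rule endo_inj_surj[OF _ image_subsetI inj]) (simp, rule e_rho(2))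
  then show "\<rho> c permutes ?I" using inj by (intro bij_imp_permutes) (auto simp: bij_betw_def \<rho>_def)
qed

text \<open>Right translations transported to an initial segment: a uniform group element takes j to
  a uniform point because left multiplication by the element numbered j is injective. This supplies
  the action of K_k on its blocks.\<close>

lemma (in group) regular_representation:
  assumes fin: "finite (carrier G)"
  shows "\<exists>\<rho> :: 'a \<Rightarrow> nat \<Rightarrow> nat. (\<forall>c\<in>carrier G. \<rho> c permutes {1..card (carrier G)}) \<and>
     (\<forall>c\<in>carrier G. \<forall>c'\<in>carrier G. \<rho> (c \<otimes> c') = \<rho> c' \<circ> \<rho> c) \<and>
     (\<forall>j\<in>{1..card (carrier G)}. map_pmf (\<lambda>c. \<rho> c j) (pmf_of_set (carrier G)) = pmf_of_set {1..card (carrier G)})"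
proof -
  let ?I = "{1..card (carrier G)}"
  obtain e where e: "bij_betw e ?I (carrier G)"
    using ex_bij_betw_nat_finite_1[OF fin] by blast
  define \<rho> where "\<rho> = (\<lambda>c j. if j \<in> ?I then inv_into ?I e (e j \<otimes> c) else j)"
  have perm: "\<rho> c permutes ?I" and e_rho: "\<And>j. j \<in> ?I \<Longrightarrow> e (\<rho> c j) = e j \<otimes> c" if "c \<in> carrier G" for c
    unfolding \<rho>_def using translation_permutes[OF fin e that] by blast+
  have eI: "e j \<in> carrier G" if "j \<in> ?I" for j using bij_betwE[OF e] that by blast
  have einj: "i = j" if "i \<in> ?I" "j \<in> ?I" "e i = e j" for i j
    using e that by (auto simp: bij_betw_def dest: inj_onD)
  have comp: "\<rho> (c \<otimes> c') = \<rho> c' \<circ> \<rho> c" if c: "c \<in> carrier G" "c' \<in> carrier G" for c c'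
  proof
    fix j
    show "\<rho> (c \<otimes> c') j = (\<rho> c' \<circ> \<rho> c) j"
    proof (cases "j \<in> ?I")
      case True
      have r: "\<rho> c j \<in> ?I" "\<rho> (c \<otimes> c') j \<in> ?I" "\<rho> c' (\<rho> c j) \<in> ?I"
        using True permutes_in_image[OF perm] c by simp_all
      have "e (\<rho> (c \<otimes> c') j) = e (\<rho> c' (\<rho> c j))"
        using e_rho[OF c(2) r(1)] e_rho[OF c(1) True] e_rho[OF m_closed[OF c] True] eI[OF True] c
        by (simp add: m_assoc)
      then show ?thesis using einj r by simp
    qed (auto simp: \<rho>_def)
  qed
  have unif: "map_pmf (\<lambda>c. \<rho> c j) (pmf_of_set (carrier G)) = pmf_of_set ?I" if j: "j \<in> ?I" for j
  proof -
    have inj: "inj_on (\<lambda>c. \<rho> c j) (carrier G)"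
    proof (rule inj_onI)
      fix c c' assume c: "c \<in> carrier G" "c' \<in> carrier G" "\<rho> c j = \<rho> c' j"
      then have "e j \<otimes> c = e j \<otimes> c'" using e_rho[OF c(1) j] e_rho[OF c(2) j] by simp
      then show "c = c'" using eI[OF j] c by simp
    qed
    have sub: "(\<lambda>c. \<rho> c j) ` carrier G \<subseteq> ?I" using permutes_in_image[OF perm] j by blast
    have "(\<lambda>c. \<rho> c j) ` carrier G = ?I"
      by (rule card_subset_eq[OF _ sub]) (simp_all add: card_image[OF inj])
    moreover have "carrier G \<noteq> {}" using one_closed by blast
    ultimately show ?thesis using map_pmf_of_set_inj[OF inj _ fin] by simp
  qed
  show ?thesis using perm comp unif by (intro exI[of _ \<rho>]) blast
qed

lemma tree_aut_nth:
  assumes g: "g \<in> tree_aut d" and u: "u \<in> tree_vertices d" and i: "i < length u"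
  shows "g u ! i = aut_label d g (take i u) (u ! i)"
proof -
  have eq: "take (Suc i) u = take i u @ [u ! i]" using i by (rule take_Suc_conv_app_nth)
  have V: "take i u @ [u ! i] \<in> tree_vertices d" using take_tree_vertices[OF u, of "Suc i"] by (simp only: eq)
  have "take (Suc i) (g u) = g (take i u) @ [aut_label d g (take i u) (u ! i)]"
    using tree_autD(3)[OF g u, of "Suc i"] tree_aut_append[OF g V] by (simp only: eq)
  then have "take (Suc i) (g u) ! i = (g (take i u) @ [aut_label d g (take i u) (u ! i)]) ! i" by simp
  moreover have "length (g (take i u)) = i" using tree_autD(2)[OF g take_tree_vertices[OF u]] i by simp
  ultimately show ?thesis by (simp add: nth_append)
qed

text \<open>The least such m is one more than the last position with an entry different from 1, or 0
  if there is none: a measure of how far the vertex is from 1^k.\<close>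

definition flat :: "nat \<Rightarrow> nat list \<Rightarrow> bool" where
  "flat m u \<longleftrightarrow> (\<forall>i<length u. m \<le> i \<longrightarrow> u ! i = 1)"

lemma aut_label_ident [simp]: "aut_label d (\<lambda>a. a) v = id"
  using aut_label_id[of d v] by (simp only: id_def)

lemma turn_ident [simp]: "turn m L b (\<lambda>a. a) w = w"
  using turn_id[of m L b w] by (simp only: id_def)

text \<open>The predicate is tested where each letter is applied; the end point of the trajectory is
  not tested, as no letter acts there. The length bounds below depend on this.\<close>

primrec avoids :: "(nat list \<Rightarrow> bool) \<Rightarrow> ('l \<times> (nat list \<Rightarrow> nat list)) list \<Rightarrow> nat list \<Rightarrow> bool" where
  "avoids P [] v = True"
| "avoids P (a # w) v = (\<not> P v \<and> avoids P w (snd a v))"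

section \<open>The factor K_k and the action at level k\<close>

context saturated begin

definition level :: "nat \<Rightarrow> nat list set" where
  "level k = {u \<in> tree_vertices d. length u = k}"

definition sec :: "nat \<Rightarrow> (nat list \<Rightarrow> nat list) \<Rightarrow> nat list \<Rightarrow> nat list" where
  "sec k g y = drop k (g (replicate k 1 @ y))"

text \<open>The trace of a letter in K_k: its section at 1^k and its lamp at 1^\<infinity>. For
  rooted letters and k at least 1 it is that of the identity.\<close>

definition kel :: "nat \<Rightarrow> ((nat \<Rightarrow> nat) \<Rightarrow> 'f) \<times> (nat list \<Rightarrow> nat list) \<Rightarrow> (nat list \<Rightarrow> nat list) \<times> 'f" where
  "kel k a = (sec k (snd a), fst a ones_ray)"

definition Kgrp :: "nat \<Rightarrow> ((nat list \<Rightarrow> nat list) \<times> 'f) monoid" where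
  "Kgrp k = \<lparr>carrier = kel k ` HF, mult = (\<lambda>(s, f) (s', f'). (s' \<circ> s, f \<otimes>\<^bsub>F\<^esub> f')), one = kel k \<one>\<^bsub>W\<^esub>\<rparr>"

lemma H_sec:
  assumes "h \<in> H" shows "h (replicate k 1 @ y) = replicate k 1 @ sec k h y"
proof (cases "replicate k 1 @ y \<in> tree_vertices d")
  case True
  have "take k (h (replicate k 1 @ y)) = replicate k 1"
    using tree_autD(3)[OF H_aut[OF assms] True, of k] assms by simp
  then show ?thesis unfolding sec_def by (metis append_take_drop_id)
next
  case False
  then show ?thesis using tree_autD(4)[OF H_aut[OF assms] False] by (simp add: sec_def)
qed

lemma sec_comp:
  assumes "h \<in> H"
  shows "sec k (h' \<circ> h) = sec k h' \<circ> sec k h"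
proof
  fix y
  have "sec k (h' \<circ> h) y = drop k (h' (h (replicate k 1 @ y)))" by (simp add: sec_def)
  also have "\<dots> = sec k h' (sec k h y)" unfolding H_sec[OF assms] by (simp only: sec_def[of k h'])
  finally show "sec k (h' \<circ> h) y = (sec k h' \<circ> sec k h) y" by simp
qed

lemma kel_lamp [simp]: "kel k (lamp F d f, h) = (sec k h, f)"
  by (simp add: kel_def lamp_def)

lemma kel_mult: "a \<in> HF \<Longrightarrow> b \<in> HF \<Longrightarrow> kel k (a \<otimes>\<^bsub>W\<^esub> b) = kel k a \<otimes>\<^bsub>Kgrp k\<^esub> kel k b"
  by (elim HF_E) (simp add: lamp_mult Kgrp_def sec_comp)

lemma group_Kgrp: "group (Kgrp k)"
proof -
  interpret HFg: group "W\<lparr>carrier := HF\<rparr>" using subgroup.subgroup_is_group[OF subgroup_HF W.is_group] .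
  have "kel k \<in> hom (W\<lparr>carrier := HF\<rparr>) (Kgrp k)"
    by (rule homI) (auto simp: kel_mult, simp add: Kgrp_def)
  from HFg.hom_imp_img_group[OF this]
  show ?thesis by (simp add: Kgrp_def)
qed

lemma finite_Kgrp: "finite (carrier (Kgrp k))"
  by (simp add: Kgrp_def finite_HF)

definition rot :: "nat \<Rightarrow> (nat list \<Rightarrow> nat list) \<times> 'f \<Rightarrow> nat \<Rightarrow> nat" where
  "rot k = (SOME \<rho>. (\<forall>c\<in>carrier (Kgrp k). \<rho> c permutes {1..card (carrier (Kgrp k))}) \<and>
     (\<forall>c\<in>carrier (Kgrp k). \<forall>c'\<in>carrier (Kgrp k). \<rho> (c \<otimes>\<^bsub>Kgrp k\<^esub> c') = \<rho> c' \<circ> \<rho> c) \<and>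
     (\<forall>j\<in>{1..card (carrier (Kgrp k))}. map_pmf (\<lambda>c. \<rho> c j) (pmf_of_set (carrier (Kgrp k)))
        = pmf_of_set {1..card (carrier (Kgrp k))}))"

lemma rot:
  shows rot_permutes: "c \<in> carrier (Kgrp k) \<Longrightarrow> rot k c permutes {1..card (carrier (Kgrp k))}"
    and rot_mult: "c \<in> carrier (Kgrp k) \<Longrightarrow> c' \<in> carrier (Kgrp k) \<Longrightarrow>
       rot k (c \<otimes>\<^bsub>Kgrp k\<^esub> c') = rot k c' \<circ> rot k c"
    and rot_uniform: "j \<in> {1..card (carrier (Kgrp k))} \<Longrightarrow>
       map_pmf (\<lambda>c. rot k c j) (pmf_of_set (carrier (Kgrp k))) = pmf_of_set {1..card (carrier (Kgrp k))}"
  using someI_ex[OF group.regular_representation[OF group_Kgrp finite_Kgrp], of k]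
  unfolding rot_def[symmetric] by blast+

definition kperm :: "nat \<Rightarrow> ((nat \<Rightarrow> nat) \<Rightarrow> 'f) \<times> (nat list \<Rightarrow> nat list) \<Rightarrow> nat \<Rightarrow> nat" where
  "kperm k a = rot k (kel k a)"

text \<open>Type \<open>True\<close> is the factor permuting the \<open>d k\<close> children of a
  vertex of level k, type \<open>False\<close> the factor K_k acting on itself by
  translations.\<close>

definition arity :: "nat \<Rightarrow> bool \<Rightarrow> nat" where
  "arity k b = (if b then d k else card (carrier (Kgrp k)))"

lemma kel_carrier: "a \<in> HF \<Longrightarrow> kel k a \<in> carrier (Kgrp k)"
  by (simp add: Kgrp_def)

lemma arity_pos: "1 \<le> arity k b"
proof -
  have "card (carrier (Kgrp k)) \<noteq> 0" using finite_Kgrp kel_carrier[OF one_HF, of k] by auto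
  then show ?thesis using d_pos[of k] by (simp add: arity_def)
qed

lemma kperm_permutes: "a \<in> HF \<Longrightarrow> kperm k a permutes {1..arity k False}"
  using rot_permutes[OF kel_carrier] by (simp add: kperm_def arity_def)

lemma kperm_mult: "a \<in> HF \<Longrightarrow> b \<in> HF \<Longrightarrow> kperm k (a \<otimes>\<^bsub>W\<^esub> b) = kperm k b \<circ> kperm k a"
  by (simp add: kperm_def kel_mult rot_mult kel_carrier)

lemma kperm_one: "kperm k \<one>\<^bsub>W\<^esub> = id"
proof -
  have eq: "kperm k \<one>\<^bsub>W\<^esub> = kperm k \<one>\<^bsub>W\<^esub> \<circ> kperm k \<one>\<^bsub>W\<^esub>"
    using kperm_mult[OF one_HF one_HF, of k] by simp
  have inj: "inj (kperm k \<one>\<^bsub>W\<^esub>)" using permutes_inj[OF kperm_permutes[OF one_HF]] .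
  show ?thesis
  proof
    fix j
    have "kperm k \<one>\<^bsub>W\<^esub> (kperm k \<one>\<^bsub>W\<^esub> j) = kperm k \<one>\<^bsub>W\<^esub> j" using fun_cong[OF eq, of j] by simp
    then show "kperm k \<one>\<^bsub>W\<^esub> j = id j" using injD[OF inj] by simp
  qed
qed

lemma Sigma_cases [consumes 1, case_names R HF]:
  assumes "a \<in> \<Sigma>"
  obtains \<tau> where "\<tau> permutes {1..d 0}" "a = (lamp F d \<one>\<^bsub>F\<^esub>, rooted_aut d \<tau>)"
  | f h where "f \<in> carrier F" "h \<in> H" "a = (lamp F d f, h)"
  using assms unfolding Sigma_set_def by (auto simp: R_alt elim: HF_E)

lemma Sigma_aut: "a \<in> \<Sigma> \<Longrightarrow> snd a \<in> tree_aut d"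
  by (erule Sigma_cases) (simp_all add: rooted_closed H_aut)

lemma Sigma_label: "a \<in> \<Sigma> \<Longrightarrow> u \<in> tree_vertices d \<Longrightarrow> u \<noteq> [] \<Longrightarrow> \<not> special_vertex u \<Longrightarrow> aut_label d (snd a) u = id"
  by (erule Sigma_cases) (simp_all add: rooted_aut_label H_label)

lemma Sigma_append:
  assumes "a \<in> \<Sigma>" "u @ y \<in> tree_vertices d" "u \<noteq> replicate (length u) 1" "\<not> special_vertex u" "u \<noteq> []"
  shows "snd a (u @ y) = snd a u @ y"
  using assms by (elim Sigma_cases) (simp_all add: rooted_aut_append H_append)

lemma R_kel:
  assumes "\<tau> permutes {1..d 0}" "1 \<le> k"
  shows "kel k (lamp F d \<one>\<^bsub>F\<^esub>, rooted_aut d \<tau>) = kel k \<one>\<^bsub>W\<^esub>"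
proof -
  have "rooted_aut d \<tau> (replicate k 1 @ y) = rooted_aut d \<tau> (replicate k 1) @ y"
    if "replicate k 1 @ y \<in> tree_vertices d" for y
    using rooted_aut_append[of "replicate k 1" y d \<tau>] that assms(2) by simp
  moreover have "length (rooted_aut d \<tau> (replicate k 1)) = k"
    using tree_autD(2)[OF rooted_closed[OF assms(1)] ones_vertex[of k]] by simp
  ultimately have "sec k (rooted_aut d \<tau>) y = sec k id y" for y
    by (cases "replicate k 1 @ y \<in> tree_vertices d")
       (auto simp: sec_def tree_autD(4)[OF rooted_closed[OF assms(1)]])
  then have "sec k (rooted_aut d \<tau>) = sec k id" by (rule ext)
  then show ?thesis by (simp add: W_one)
qed

lemma Sigma_kperm:
  assumes "a \<in> \<Sigma>" "1 \<le> k"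
  obtains c where "c \<in> HF" "kel k a = kel k c" "kperm k a = kperm k c"
  using assms(1)
proof (cases rule: Sigma_cases)
  case (R \<tau>)
  then show ?thesis using that[OF one_HF] R_kel[OF R(1) assms(2)] by (simp add: kperm_def)
next
  case (HF f h)
  then show ?thesis using that[of a] HF_I by simp
qed

definition Zs :: "nat \<Rightarrow> nat \<Rightarrow> (nat list \<times> (bool \<times> nat) list) set" where
  "Zs k L = level k \<times> tree_words (arity k) L"

text \<open>The first component moves as in \<Gamma>. In place of the subtree below it, a copy of
  the truncated coset tree is attached to each vertex of level k. A letter turns this copy over 1^k
  by its trace in K_k, and elsewhere by its label, which for k at least 1 is trivial unless the
  vertex is special.\<close>

definition act :: "nat \<Rightarrow> nat \<Rightarrow> ((nat \<Rightarrow> nat) \<Rightarrow> 'f) \<times> (nat list \<Rightarrow> nat list) \<Rightarrow>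
    nat list \<times> (bool \<times> nat) list \<Rightarrow> nat list \<times> (bool \<times> nat) list" where
  "act k L a z = (if z \<in> Zs k L then (snd a (fst z),
     if fst z = replicate k 1 then turn (arity k) L False (kperm k a) (snd z)
     else turn (arity k) L True (aut_label d (snd a) (fst z)) (snd z)) else z)"

lemma finite_Zs: "finite (Zs k L)"
  by (simp add: Zs_def level_def finite_level finite_tree_words)

lemma level_aut: "g \<in> tree_aut d \<Longrightarrow> u \<in> level k \<Longrightarrow> g u \<in> level k"
  by (simp add: level_def tree_autD)

lemma label_arity: "g \<in> tree_aut d \<Longrightarrow> u \<in> level k \<Longrightarrow> aut_label d g u permutes {1..arity k True}"
  using aut_label_permutes[of g d u] by (auto simp: level_def arity_def)

lemma Sigma_kperm_permutes: "a \<in> \<Sigma> \<Longrightarrow> 1 \<le> k \<Longrightarrow> kperm k a permutes {1..arity k False}"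
  by (rule Sigma_kperm[of a k]) (simp_all only: kperm_permutes)

lemma act_permutes:
  assumes k: "1 \<le> k" and a: "a \<in> \<Sigma>"
  shows "act k L a permutes Zs k L"
proof (rule bij_imp_permutes)
  note T = turn_permutes[where m = "arity k" and L = L]
  note perm = Sigma_kperm_permutes[OF a k] label_arity[OF Sigma_aut[OF a]]
  have t: "turn (arity k) L False (kperm k a) permutes tree_words (arity k) L"
    "u \<in> level k \<Longrightarrow> turn (arity k) L True (aut_label d (snd a) u) permutes tree_words (arity k) L" for u
    using T[OF perm(1) arity_pos] T[OF perm(2) arity_pos] by blast+
  have into: "act k L a z \<in> Zs k L" if "z \<in> Zs k L" for z
    using that level_aut[OF Sigma_aut[OF a], of "fst z"]
      permutes_in_image[OF t(1), of "snd z"] permutes_in_image[OF t(2), of "fst z" "snd z"]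
    by (auto simp: act_def Zs_def)
  have inj: "inj_on (act k L a) (Zs k L)"
  proof (rule inj_onI)
    fix z z' assume z: "z \<in> Zs k L" "z' \<in> Zs k L" "act k L a z = act k L a z'"
    then have "snd a (fst z) = snd a (fst z')" by (simp add: act_def)
    then have 1: "fst z = fst z'" using tree_aut_inj[OF Sigma_aut[OF a]] by blast
    have lev: "fst z' \<in> level k" using z(2) by (auto simp: Zs_def)
    have "snd z = snd z'"
    proof (cases "fst z' = replicate k 1")
      case True
      then have "turn (arity k) L False (kperm k a) (snd z) = turn (arity k) L False (kperm k a) (snd z')"
        using z 1 by (simp add: act_def)
      then show ?thesis using permutes_inj[OF t(1)] by (simp add: inj_eq)
    next
      case False
      then have "turn (arity k) L True (aut_label d (snd a) (fst z')) (snd z)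
          = turn (arity k) L True (aut_label d (snd a) (fst z')) (snd z')"
        using z 1 by (simp add: act_def)
      then show ?thesis using permutes_inj[OF t(2)[OF lev]] by (simp add: inj_eq)
    qed
    with 1 show "z = z'" by (simp add: prod_eq_iff)
  qed
  have "act k L a ` Zs k L = Zs k L" by (rule endo_inj_surj[OF finite_Zs image_subsetI inj]) (rule into)
  with inj show "bij_betw (act k L a) (Zs k L) (Zs k L)" by (simp add: bij_betw_def)
qed (simp add: act_def)

text \<open>For i > m the prefix of length i ends in 1, so it is neither the root nor special, and
  the label acting on the entry i is trivial.\<close>

lemma flat_step:
  assumes a: "a \<in> \<Sigma>" and u: "u \<in> tree_vertices d" and m: "flat m u"
  shows "flat (Suc m) (snd a u)"
  unfolding flat_def
proof (intro allI impI)
  fix i assume i: "i < length (snd a u)" "Suc m \<le> i"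
  have iu: "i < length u" using i tree_autD(2)[OF Sigma_aut[OF a] u] by simp
  have "u ! (i - 1) = 1" "u ! i = 1" using m i iu by (auto simp: flat_def)
  moreover have "last (take i u) = u ! (i - 1)" using iu i(2) by (subst last_conv_nth) auto
  ultimately have "\<not> special_vertex (take i u)" by (auto simp: special_vertex_def)
  moreover have "take i u \<noteq> []" using i(2) iu by auto
  ultimately have "aut_label d (snd a) (take i u) = id"
    using Sigma_label[OF a take_tree_vertices[OF u]] by blast
  then show "snd a u ! i = 1" using tree_aut_nth[OF Sigma_aut[OF a] u iu] \<open>u ! i = 1\<close> by simp
qed

lemma snd_inv:
  assumes a: "a \<in> carrier W" shows "snd (inv\<^bsub>W\<^esub> a) (snd a u) = u"
proof -
  have "snd (a \<otimes>\<^bsub>W\<^esub> inv\<^bsub>W\<^esub> a) = id" using a by (simp add: wreath_one)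
  then show ?thesis unfolding snd_wreath_mult by (metis comp_apply id_apply)
qed

lemma flat_back:
  assumes a: "a \<in> \<Sigma>" and u: "u \<in> tree_vertices d" and m: "flat m (snd a u)"
  shows "flat (Suc m) u"
  using flat_step[OF Sigma_inv[OF a] tree_autD(5)[OF Sigma_aut[OF a] u] m] snd_inv[of a u] a Sigma_carrier
  by auto

text \<open>After j letters the entries from m + j on are ones; as long as m + j < k the last entry
  is 1, which excludes a special vertex.\<close>

lemma flat_avoids_special:
  "set w \<subseteq> \<Sigma> \<Longrightarrow> u \<in> level k \<Longrightarrow> flat m u \<Longrightarrow> m + length w \<le> k \<Longrightarrow> avoids special_vertex w u"
proof (induction w arbitrary: u m)
  case (Cons a w)
  have a: "a \<in> \<Sigma>" "set w \<subseteq> \<Sigma>" using Cons.prems(1) by auto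
  have u: "u \<in> tree_vertices d" "length u = k" using Cons.prems(2) by (auto simp: level_def)
  have "u \<noteq> []" "u ! (length u - 1) = 1" using Cons.prems(3,4) u by (auto simp: flat_def)
  then have "\<not> special_vertex u" by (simp add: special_vertex_def last_conv_nth)
  moreover have "avoids special_vertex w (snd a u)"
    using Cons.IH[OF a(2) level_aut[OF Sigma_aut[OF a(1)] Cons.prems(2)] flat_step[OF a(1) u(1) Cons.prems(3)]]
      Cons.prems(4) by simp
  ultimately show ?case by simp
qed simp

text \<open>Read backwards, each letter spoils at most one position: from a vertex that is not flat
  from m on, at least m + 1 letters are needed to arrive at 1^k, which is flat from 0.\<close>

lemma not_flat_avoids_ones:
  "set w \<subseteq> \<Sigma> \<Longrightarrow> u \<in> level k \<Longrightarrow> \<not> flat m u \<Longrightarrow> length w \<le> Suc m \<Longrightarrow> avoids (\<lambda>v. v = replicate k 1) w u"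
proof (induction w arbitrary: u m)
  case (Cons a w)
  have a: "a \<in> \<Sigma>" "set w \<subseteq> \<Sigma>" using Cons.prems(1) by auto
  have u: "u \<in> tree_vertices d" "length u = k" using Cons.prems(2) by (auto simp: level_def)
  have "u \<noteq> replicate k 1" using Cons.prems(3) by (auto simp: flat_def)
  moreover have "avoids (\<lambda>v. v = replicate k 1) w (snd a u)"
  proof (cases m)
    case 0
    then show ?thesis using Cons.prems(4) by simp
  next
    case (Suc m')
    then have "\<not> flat m' (snd a u)" using flat_back[OF a(1) u(1), of m'] Cons.prems(3) by blast
    from Cons.IH[OF a(2) level_aut[OF Sigma_aut[OF a(1)] Cons.prems(2)] this]
    show ?thesis using Cons.prems(4) Suc by simp
  qed
  ultimately show ?case by simp
qed simp

text \<open>The position of the last entry different from 1 moves by at most one per letter. So a word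
  of length at most \<open>k\<close> cannot visit both \<open>1\<^sup>k\<close> and a vertex \<open>1\<^sup>k\<^sup>-\<^sup>1t\<close>: along a given trajectory
  it contributes letters of only one of the two factors.\<close>

lemma avoids_dichotomy:
  "set w \<subseteq> \<Sigma> \<Longrightarrow> u \<in> level k \<Longrightarrow> length w \<le> k \<Longrightarrow>
    avoids (\<lambda>v. v = replicate k 1) w u \<or> avoids special_vertex w u"
proof (induction w arbitrary: u)
  case (Cons a w)
  have a: "a \<in> \<Sigma>" "set w \<subseteq> \<Sigma>" using Cons.prems(1) by auto
  consider "u = replicate k 1" | "special_vertex u" | "u \<noteq> replicate k 1" "\<not> special_vertex u" by blast
  then show ?case
  proof cases
    case 1
    then have "flat 0 u" by (simp add: flat_def)
    then show ?thesis using flat_avoids_special[OF Cons.prems(1,2), of 0] Cons.prems(3) by simp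
  next
    case 2
    have k: "length u = k" "0 < k" using Cons.prems by (auto simp: level_def)
    \<comment> \<open>The last entry itself differs from 1, the extreme case m = k - 1, which covers
      all words of length up to k.\<close>
    have "\<not> flat (k - 1) u" using 2 k by (auto simp: flat_def special_vertex_def last_conv_nth intro!: exI[of _ "k - 1"])
    then show ?thesis using not_flat_avoids_ones[OF Cons.prems(1,2), of "k - 1"] Cons.prems(3) k by simp
  next
    case 3
    then show ?thesis
      using Cons.IH[OF a(2) level_aut[OF Sigma_aut[OF a(1)] Cons.prems(2)]] Cons.prems(3) by simp
  qed
qed simp

lemma wprod_aut: "set w \<subseteq> \<Sigma> \<Longrightarrow> snd (wprod W w) \<in> tree_aut d"
  by (induction w) (auto simp: snd_wreath_mult Sigma_aut wreath_one simp del: comp_apply)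

text \<open>Only labels turn the attached tree along this trajectory, and they multiply by the
  cocycle rule, so the result depends only on the product of the word in the wreath product.\<close>

lemma run_avoids_ones:
  assumes k: "1 \<le> k"
  shows "set w \<subseteq> \<Sigma> \<Longrightarrow> u \<in> level k \<Longrightarrow> x \<in> tree_words (arity k) L \<Longrightarrow> avoids (\<lambda>v. v = replicate k 1) w u \<Longrightarrow>
    run (act k L) w (u, x) = (snd (wprod W w) u, turn (arity k) L True (aut_label d (snd (wprod W w)) u) x)"
proof (induction w arbitrary: u x)
  case Nil
  show ?case by (simp add: wreath_one)
next
  case (Cons a w)
  have a: "a \<in> \<Sigma>" "set w \<subseteq> \<Sigma>" using Cons.prems(1) by auto
  have u: "u \<in> tree_vertices d" using Cons.prems(2) by (simp add: level_def)
  let ?g = "snd a" and ?G = "snd (wprod W w)"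
  let ?x = "turn (arity k) L True (aut_label d ?g u) x"
  have lab: "aut_label d ?g u permutes {1..arity k True}" by (rule label_arity[OF Sigma_aut[OF a(1)] Cons.prems(2)])
  have x: "?x \<in> tree_words (arity k) L" by (rule turn_closed[where m = "arity k", OF lab arity_pos Cons.prems(3)])
  have "act k L a (u, x) = (?g u, ?x)" using Cons.prems by (simp add: act_def Zs_def)
  then have "run (act k L) (a # w) (u, x) = (?G (?g u), turn (arity k) L True (aut_label d ?G (?g u)) ?x)"
    using Cons.IH[OF a(2) level_aut[OF Sigma_aut[OF a(1)] Cons.prems(2)] x] Cons.prems(4) by simp
  also have "turn (arity k) L True (aut_label d ?G (?g u)) ?x
      = turn (arity k) L True (aut_label d (?G \<circ> ?g) u) x"
    unfolding turn_comp[where m = "arity k", OF lab arity_pos]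
    by (simp only: aut_label_comp[OF Sigma_aut[OF a(1)] wprod_aut[OF a(2)] u])
  finally have run: "run (act k L) (a # w) (u, x) = (?G (?g u), turn (arity k) L True (aut_label d (?G \<circ> ?g) u) x)" .
  have G: "snd (wprod W (a # w)) = ?G \<circ> ?g" by (simp only: wprod_Cons snd_wreath_mult)
  have Gu: "(?G \<circ> ?g) u = ?G (?g u)" by (rule comp_apply)
  show ?case unfolding run G Gu ..
qed

text \<open>The attached tree is turned only over 1^k, by a product of letters of HF collected in c.
  The last two clauses recover the trace of c in K_k from the product of the word: its section is
  read off from the subtree below u, its lamp from the ray u111..., since letters applied elsewhere
  move this subtree rigidly and put no lamp on that ray.\<close>

lemma run_avoids_special:
  assumes k: "1 \<le> k"
  shows "set w \<subseteq> \<Sigma> \<Longrightarrow> u \<in> level k \<Longrightarrow> x \<in> tree_words (arity k) L \<Longrightarrow> avoids special_vertex w u \<Longrightarrow>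
    \<exists>c\<in>HF. run (act k L) w (u, x) = (snd (wprod W w) u, turn (arity k) L False (kperm k c) x) \<and>
      (\<forall>y. u @ y \<in> tree_vertices d \<longrightarrow> snd (wprod W w) (u @ y) = snd (wprod W w) u @ sec k (snd c) y) \<and>
      (\<forall>r\<in>tree_boundary d. prefix_of r k = u \<longrightarrow> (\<forall>j\<ge>k. r j = 1) \<longrightarrow> fst (wprod W w) r = fst c ones_ray)"
proof (induction w arbitrary: u x)
  case Nil
  show ?case
    by (rule bexI[OF _ one_HF]) (simp add: wreath_one kperm_one[unfolded wreath_one] sec_def)
next
  case (Cons a w)
  have a: "a \<in> \<Sigma>" "set w \<subseteq> \<Sigma>" using Cons.prems(1) by auto
  have u: "u \<in> tree_vertices d" "length u = k" using Cons.prems(2) by (simp_all add: level_def)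
  have ns: "\<not> special_vertex u" "avoids special_vertex w (snd a u)" using Cons.prems(4) by auto
  have une: "u \<noteq> []" using u k by auto
  let ?g = "snd a" and ?G = "snd (wprod W w)"
  note lev = level_aut[OF Sigma_aut[OF a(1)] Cons.prems(2)]
  have G: "snd (wprod W (a # w)) = ?G \<circ> ?g" by (simp add: snd_wreath_mult)
  have Phi: "fst (wprod W (a # w)) r = fst a r \<otimes>\<^bsub>F\<^esub> fst (wprod W w) (aut_bd ?g r)" if "r \<in> tree_boundary d" for r
    using that by (simp add: fst_wreath_mult)
  show ?case
  proof (cases "u = replicate k 1")
    case False
    have x: "act k L a (u, x) = (?g u, x)"
      using False Cons.prems Sigma_label[OF a(1) u(1) une ns(1)] by (simp add: act_def Zs_def)
    obtain c where c: "c \<in> HF" "run (act k L) w (?g u, x) = (?G (?g u), turn (arity k) L False (kperm k c) x)"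
      "\<And>y. ?g u @ y \<in> tree_vertices d \<Longrightarrow> ?G (?g u @ y) = ?G (?g u) @ sec k (snd c) y"
      "\<And>r. r \<in> tree_boundary d \<Longrightarrow> prefix_of r k = ?g u \<Longrightarrow> \<forall>j\<ge>k. r j = 1 \<Longrightarrow> fst (wprod W w) r = fst c ones_ray"
      using Cons.IH[OF a(2) lev Cons.prems(3) ns(2)] by blast
    have app: "?g (u @ y) = ?g u @ y" if "u @ y \<in> tree_vertices d" for y
      using Sigma_append[OF a(1) that _ ns(1) une] False u by simp
    have "(?G \<circ> ?g) (u @ y) = (?G \<circ> ?g) u @ sec k (snd c) y" if "u @ y \<in> tree_vertices d" for y
      using c(3)[of y] app[OF that] tree_autD(5)[OF Sigma_aut[OF a(1)] that] by simp
    moreover have "fst (wprod W (a # w)) r = fst c ones_ray"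
      if r: "r \<in> tree_boundary d" "prefix_of r k = u" "\<forall>j\<ge>k. r j = 1" for r
    proof -
      have "r \<noteq> ones_ray" using r(2) False by auto
      then have "fst a r = \<one>\<^bsub>F\<^esub>" using a(1) r(1) by (elim Sigma_cases) (auto simp: lamp_def)
      moreover have "prefix_of (aut_bd ?g r) k = ?g u" using prefix_aut_bd[OF Sigma_aut[OF a(1)] r(1), of k] r(2) by simp
      moreover have "\<forall>j\<ge>k. aut_bd ?g r j = 1"
      proof (intro allI impI)
        fix j assume j: "k \<le> j"
        have eq: "prefix_of r (Suc j) = u @ map r [k..<Suc j]"
          using r(2) j by (metis le_Suc_eq le_add_diff_inverse map_append upt_add_eq_append zero_le)
        have "prefix_of (aut_bd ?g r) (Suc j) = ?g u @ map r [k..<Suc j]"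
          unfolding prefix_aut_bd[OF Sigma_aut[OF a(1)] r(1)] eq
          by (rule app) (use prefix_tree_vertices[OF r(1), of "Suc j"] in \<open>simp only: eq\<close>)
        then have "prefix_of (aut_bd ?g r) (Suc j) ! j = (?g u @ map r [k..<Suc j]) ! j" by simp
        moreover have "length (?g u) = k" using lev by (simp add: level_def)
        moreover have "prefix_of (aut_bd ?g r) (Suc j) ! j = aut_bd ?g r j" by (simp del: upt_Suc)
        moreover have "map r [k..<Suc j] ! (j - k) = r j" using j by (simp del: upt_Suc)
        ultimately show "aut_bd ?g r j = 1" using r(3) j by (simp add: nth_append del: upt_Suc)
      qed
      moreover have "fst c ones_ray \<in> carrier F" using c(1) by (elim HF_E) (simp add: lamp_def)
      ultimately show ?thesis using c(4)[OF aut_bd_closed[OF Sigma_aut[OF a(1)] r(1)]] by (simp only: Phi[OF r(1)]) simp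
    qed
    ultimately show ?thesis using c(1,2) x unfolding G by (intro bexI[OF _ c(1)]) simp
  next
    case True
    obtain b where b: "b \<in> HF" "kel k a = kel k b" "kperm k a = kperm k b" using Sigma_kperm[OF a(1) k] .
    have ga: "?g (u @ y) = ?g u @ sec k (snd b) y" if V: "u @ y \<in> tree_vertices d" for y
    proof -
      have "take k (?g (u @ y)) = ?g u" using tree_autD(3)[OF Sigma_aut[OF a(1)] V, of k] u by simp
      then have "?g (u @ y) = ?g u @ sec k ?g y" by (metis True append_take_drop_id sec_def)
      then show ?thesis using b(2) by (simp add: kel_def)
    qed
    have bo: "fst b ones_ray \<in> carrier F" using b(1) by (elim HF_E) (simp add: lamp_def)
    have bH: "snd b \<in> H" using b(1) by (elim HF_E) simp
    have kb: "kperm k b permutes {1..arity k False}" by (rule kperm_permutes[OF b(1)])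
    let ?x = "turn (arity k) L False (kperm k b) x"
    have x: "act k L a (u, x) = (?g u, ?x)" using True Cons.prems b(3) by (simp add: act_def Zs_def)
    have xL: "?x \<in> tree_words (arity k) L" by (rule turn_closed[where m = "arity k", OF kb arity_pos Cons.prems(3)])
    obtain c where c: "c \<in> HF" "run (act k L) w (?g u, ?x) = (?G (?g u), turn (arity k) L False (kperm k c) ?x)"
      "\<And>y. ?g u @ y \<in> tree_vertices d \<Longrightarrow> ?G (?g u @ y) = ?G (?g u) @ sec k (snd c) y"
      "\<And>r. r \<in> tree_boundary d \<Longrightarrow> prefix_of r k = ?g u \<Longrightarrow> \<forall>j\<ge>k. r j = 1 \<Longrightarrow> fst (wprod W w) r = fst c ones_ray"
      using Cons.IH[OF a(2) lev xL ns(2)] by blast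
    have cH: "snd c \<in> H" using c(1) by (elim HF_E) simp
    have bc: "b \<otimes>\<^bsub>W\<^esub> c \<in> HF" by (rule subgroup.m_closed[OF subgroup_HF b(1) c(1)])
    have kbc: "kel k (b \<otimes>\<^bsub>W\<^esub> c) = (sec k (snd c) \<circ> sec k (snd b), fst b ones_ray \<otimes>\<^bsub>F\<^esub> fst c ones_ray)"
      using kel_mult[OF b(1) c(1), of k] by (simp add: kel_def Kgrp_def)
    have "turn (arity k) L False (kperm k c) ?x = turn (arity k) L False (kperm k (b \<otimes>\<^bsub>W\<^esub> c)) x"
      unfolding turn_comp[where m = "arity k", OF kb arity_pos] kperm_mult[OF b(1) c(1)] ..
    moreover have "(?G \<circ> ?g) (u @ y) = (?G \<circ> ?g) u @ sec k (snd (b \<otimes>\<^bsub>W\<^esub> c)) y" if V: "u @ y \<in> tree_vertices d" for y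
    proof -
      have "?g u @ sec k (snd b) y \<in> tree_vertices d"
        using tree_autD(5)[OF Sigma_aut[OF a(1)] V] ga[OF V] by simp
      from c(3)[OF this] show ?thesis using ga[OF V] kbc by (simp add: kel_def)
    qed
    moreover have "fst (wprod W (a # w)) r = fst (b \<otimes>\<^bsub>W\<^esub> c) ones_ray"
      if r: "r \<in> tree_boundary d" "prefix_of r k = u" "\<forall>j\<ge>k. r j = 1" for r
    proof -
      have ro: "r = ones_ray"
      proof
        fix j show "r j = ones_ray j"
        proof (cases "j < k")
          case j: True
          have "prefix_of r k ! j = replicate k 1 ! j" using r(2) True by simp
          then show ?thesis using j by (simp add: ones_ray_def)
        qed (use r(3) in \<open>simp add: ones_ray_def\<close>)
      qed
      let ?r = "aut_bd ?g ones_ray"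
      have pre: "prefix_of ?r k = ?g u" using prefix_aut_bd[OF Sigma_aut[OF a(1)] r(1), of k] r(2) ro by simp
      have "\<forall>j\<ge>k. ?r j = 1"
      proof (intro allI impI)
        fix j assume j: "k \<le> j"
        define y where "y = replicate (Suc j - k) (Suc 0)"
        have uy: "u @ y = replicate (Suc j) 1" using True j by (simp add: y_def flip: replicate_add)
        have V: "u @ y \<in> tree_vertices d" using uy ones_vertex[of "Suc j"] by simp
        have sy: "sec k (snd b) y = y"
          using H_sec[OF bH, of k y] uy True H_ones[OF bH, of "Suc j"] by simp
        have "prefix_of ?r (Suc j) = ?g (u @ y)"
          unfolding prefix_aut_bd[OF Sigma_aut[OF a(1)] ones_boundary] ones_prefix uy ..
        then have "prefix_of ?r (Suc j) = ?g u @ y" unfolding ga[OF V] sy .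
        then have "prefix_of ?r (Suc j) ! j = (?g u @ y) ! j" by simp
        moreover have "length (?g u) = k" using lev by (simp add: level_def)
        moreover have "prefix_of ?r (Suc j) ! j = ?r j" by (simp del: upt_Suc)
        ultimately show "?r j = 1" using j by (simp add: nth_append y_def del: upt_Suc)
      qed
      from c(4)[OF aut_bd_closed[OF Sigma_aut[OF a(1)] ones_boundary] pre this]
      have "fst (wprod W (a # w)) r = fst a ones_ray \<otimes>\<^bsub>F\<^esub> fst c ones_ray" using Phi[OF r(1)] ro by simp
      then show ?thesis using b(2) kbc by (simp add: kel_def)
    qed
    ultimately show ?thesis using c(2) x unfolding G by (intro bexI[OF _ bc]) simp
  qed
qed

text \<open>By the dichotomy the word acts through one factor only, and in either case its effect is
  determined by its product in \<Gamma>: the label at u, or the trace of c in K_k, both trivial for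
  a relator.\<close>

lemma act_local:
  assumes w: "set w \<subseteq> \<Sigma>" "length w \<le> k" "wprod W w = \<one>\<^bsub>W\<^esub>" and k: "1 \<le> k"
  shows "run (act k L) w z = z"
proof (cases "z \<in> Zs k L")
  case False
  have "run (act k L) w permutes Zs k L"
    by (rule run_permutes[OF _ w(1)]) (rule act_permutes[OF k])
  then show ?thesis using False by (rule permutes_not_in)
next
  case True
  obtain u x where z: "z = (u, x)" "u \<in> level k" "x \<in> tree_words (arity k) L"
    using True by (auto simp: Zs_def)
  have id: "snd (wprod W w) = id" by (simp add: w(3) wreath_one)
  have u: "u \<in> tree_vertices d" "length u = k" using z(2) by (simp_all add: level_def)
  from avoids_dichotomy[OF w(1) z(2) w(2)] show ?thesis
  proof
    assume "avoids (\<lambda>v. v = replicate k 1) w u"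
    from run_avoids_ones[OF k w(1) z(2,3) this] show ?thesis by (simp add: z(1) id)
  next
    assume "avoids special_vertex w u"
    from run_avoids_special[OF k w(1) z(2,3) this] obtain c where c: "c \<in> HF"
      "run (act k L) w (u, x) = (u, turn (arity k) L False (kperm k c) x)"
      "\<And>y. u @ y \<in> tree_vertices d \<Longrightarrow> u @ y = u @ sec k (snd c) y"
      "\<And>r. r \<in> tree_boundary d \<Longrightarrow> prefix_of r k = u \<Longrightarrow> \<forall>j\<ge>k. r j = 1 \<Longrightarrow> fst (wprod W w) r = fst c ones_ray"
      unfolding id by auto
    have cH: "snd c \<in> H" using c(1) by (elim HF_E) simp
    have "sec k (snd c) y = sec k id y" for y
    proof (cases "replicate k 1 @ y \<in> tree_vertices d")
      case True
      then have "u @ y \<in> tree_vertices d"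
        using u by (auto simp: tree_vertices_def nth_append)
      from c(3)[OF this] show ?thesis by (simp add: sec_def[of k id])
    next
      case False
      then show ?thesis using tree_autD(4)[OF H_aut[OF cH] False] by (simp add: sec_def)
    qed
    then have sec: "sec k (snd c) = sec k id" by (rule ext)
    \<comment> \<open>The ray u111... serves to read off the lamp of c from the product of the word,
      which is trivial.\<close>
    define r where "r j = (if j < k then u ! j else 1)" for j
    have r: "r \<in> tree_boundary d" using u d_pos by (auto simp: r_def tree_boundary_def tree_vertices_def)
    have "prefix_of r k = u" by (rule nth_equalityI) (use u in \<open>auto simp: r_def\<close>)
    from c(4)[OF r this] have "fst c ones_ray = \<one>\<^bsub>F\<^esub>" using r by (simp add: r_def w(3) wreath_one)
    with sec have "kel k c = kel k \<one>\<^bsub>W\<^esub>" by (simp add: kel_def wreath_one)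
    then have "kperm k c = id" using kperm_one[of k] by (simp add: kperm_def)
    then show ?thesis using c(2) by (simp add: z(1))
  qed
qed

end

section \<open>Linear drift of the approximating actions\<close>

text \<open>Injections of A that carry any given fibre into any other force all fibres to have the
  same size.\<close>

lemma map_pmf_uniformI:
  assumes A: "finite A" "A \<noteq> {}" and fA: "f ` A = B"
    and T: "\<And>b b'. b \<in> B \<Longrightarrow> b' \<in> B \<Longrightarrow> \<exists>T. inj_on T A \<and> T ` A \<subseteq> A \<and> (\<forall>a\<in>A. f a = b \<longrightarrow> f (T a) = b')"
  shows "map_pmf f (pmf_of_set A) = pmf_of_set B"
proof (rule pmf_eqI)
  fix x
  have B: "finite B" "B \<noteq> {}" using A fA by auto
  define fib where "fib b = {a \<in> A. f a = b}" for b
  have fin: "finite (fib b)" for b using A by (simp add: fib_def)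
  have le: "card (fib b) \<le> card (fib b')" if bb: "b \<in> B" "b' \<in> B" for b b'
  proof -
    obtain T where "inj_on T A" "T ` A \<subseteq> A" "\<forall>a\<in>A. f a = b \<longrightarrow> f (T a) = b'" using T[OF bb] by blast
    then have "inj_on T (fib b)" "T ` fib b \<subseteq> fib b'" by (auto simp: fib_def inj_on_def)
    then show ?thesis using card_inj_on_le fin by blast
  qed
  have pm: "pmf (map_pmf f (pmf_of_set A)) x = real (card (fib x)) / real (card A)"
  proof -
    have "A \<inter> f -` {x} = fib x" by (auto simp: fib_def)
    then show ?thesis using A by (simp add: pmf_map measure_pmf_of_set)
  qed
  show "pmf (map_pmf f (pmf_of_set A)) x = pmf (pmf_of_set B) x"
  proof (cases "x \<in> B")
    case True
    have "A = (\<Union>b\<in>B. fib b)" using fA by (auto simp: fib_def)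
    then have "card A = card (\<Union>b\<in>B. fib b)" by simp
    also have "\<dots> = (\<Sum>b\<in>B. card (fib b))"
      by (rule card_UN_disjoint) (use B fin in \<open>auto simp: fib_def\<close>)
    also have "\<dots> = (\<Sum>b\<in>B. card (fib x))"
      by (rule sum.cong[OF refl]) (use le True in \<open>auto intro: antisym\<close>)
    finally have cA: "card A = card B * card (fib x)" by simp
    moreover have "card A \<noteq> 0" using A by simp
    ultimately have "card (fib x) \<noteq> 0" by auto
    then show ?thesis unfolding pm using True B cA by (simp add: field_simps)
  next
    case False
    then have "fib x = {}" using fA by (auto simp: fib_def)
    then show ?thesis unfolding pm using False B by simp
  qed
qed

lemma uniform_hom_image:
  assumes "group G" "finite (carrier G)" "group K" "h \<in> hom G K"
  shows "map_pmf h (pmf_of_set (carrier G)) = pmf_of_set (h ` carrier G)"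
proof (rule map_pmf_uniformI)
  interpret group_hom G K h using assms by (simp add: group_hom_def group_hom_axioms_def)
  show "carrier G \<noteq> {}" using G.one_closed by blast
  fix b b' assume "b \<in> h ` carrier G" "b' \<in> h ` carrier G"
  then obtain x y where xy: "x \<in> carrier G" "y \<in> carrier G" "b = h x" "b' = h y" by blast
  define t where "t = inv\<^bsub>G\<^esub> x \<otimes>\<^bsub>G\<^esub> y"
  have t: "t \<in> carrier G" using xy by (simp add: t_def)
  show "\<exists>T. inj_on T (carrier G) \<and> T ` carrier G \<subseteq> carrier G \<and> (\<forall>a\<in>carrier G. h a = b \<longrightarrow> h (T a) = b')"
  proof (intro exI[of _ "\<lambda>a. a \<otimes>\<^bsub>G\<^esub> t"] conjI ballI impI)
    show "inj_on (\<lambda>a. a \<otimes>\<^bsub>G\<^esub> t) (carrier G)" using t by (auto intro!: inj_onI)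
    show "(\<lambda>a. a \<otimes>\<^bsub>G\<^esub> t) ` carrier G \<subseteq> carrier G" using t by auto
    fix a assume a: "a \<in> carrier G" "h a = b"
    have "h (a \<otimes>\<^bsub>G\<^esub> t) = h x \<otimes>\<^bsub>K\<^esub> (inv\<^bsub>K\<^esub> (h x) \<otimes>\<^bsub>K\<^esub> h y)"
      using a t xy by (simp add: t_def)
    also have "\<dots> = h y" using xy by (simp add: H.m_assoc[symmetric])
    finally show "h (a \<otimes>\<^bsub>G\<^esub> t) = b'" using xy by simp
  qed
qed (use assms in auto)

lemma uniform_permutation_eval:
  assumes "finite A" "j \<in> A"
  shows "map_pmf (\<lambda>p. p j) (pmf_of_set {p. p permutes A}) = pmf_of_set A"
proof (rule map_pmf_uniformI)
  show "finite {p. p permutes A}" using finite_permutations[OF assms(1)] .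
  show "{p. p permutes A} \<noteq> {}" using permutes_id by blast
  have tr: "Transposition.transpose i i' permutes A" if "i \<in> A" "i' \<in> A" for i i'
    using that by (rule permutes_swap_id)
  have inj: "inj (Transposition.transpose i i')" for i i' :: 'a by simp
  show "(\<lambda>p. p j) ` {p. p permutes A} = A"
  proof (intro equalityI subsetI)
    fix i assume "i \<in> A"
    then show "i \<in> (\<lambda>p. p j) ` {p. p permutes A}"
      using tr[OF assms(2)] by (intro image_eqI[of _ _ "Transposition.transpose j i"]) auto
  qed (use assms(2) in \<open>auto simp: permutes_in_image\<close>)
  fix b b' assume b: "b \<in> A" "b' \<in> A"
  show "\<exists>T. inj_on T {p. p permutes A} \<and> T ` {p. p permutes A} \<subseteq> {p. p permutes A} \<and>
      (\<forall>p\<in>{p. p permutes A}. p j = b \<longrightarrow> (T p) j = b')"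
  proof (intro exI[of _ "\<lambda>p. Transposition.transpose b b' \<circ> p"] conjI)
    show "inj_on (\<lambda>p. Transposition.transpose b b' \<circ> p) {p. p permutes A}"
      by (rule inj_onI) (metis comp_assoc comp_id id_comp transpose_comp_involutory)
    show "(\<lambda>p. Transposition.transpose b b' \<circ> p) ` {p. p permutes A} \<subseteq> {p. p permutes A}"
      using tr[OF b] by (auto intro: permutes_compose)
  qed auto
qed

text \<open>Letters act from left to right, so a first-step analysis has to split off the first
  word, while the definition appends the last one.\<close>

lemma word_law_Suc_left:
  "word_law \<nu> (Suc n) = bind_pmf \<nu> (\<lambda>v. map_pmf (\<lambda>u. v @ u) (word_law \<nu> n))"
proof (induction n)
  case 0
  have "(@) [] = (\<lambda>x :: 'a list. x)" by (rule ext) simp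
  then show ?case by (simp add: bind_return_pmf map_pmf_def[symmetric] bind_return_pmf')
next
  case (Suc n)
  have e: "(@) (x @ y) = (\<lambda>z. x @ y @ z)" for x y :: "'a list" by (rule ext) simp
  have "word_law \<nu> (Suc (Suc n)) = bind_pmf \<nu> (\<lambda>v. bind_pmf (word_law \<nu> n) (\<lambda>u. map_pmf (\<lambda>v'. v @ u @ v') \<nu>))"
    by (subst word_law.simps(2), subst Suc) (simp add: bind_assoc_pmf bind_map_pmf e)
  then show ?case by (simp add: map_bind_pmf map_pmf_comp)
qed

lemma expectation_word_law_Suc:
  fixes f :: "'a list \<Rightarrow> real"
  assumes "finite (set_pmf \<nu>)"
  shows "measure_pmf.expectation (word_law \<nu> (Suc n)) f
    = measure_pmf.expectation \<nu> (\<lambda>v. measure_pmf.expectation (word_law \<nu> n) (\<lambda>u. f (v @ u)))"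
  unfolding word_law_Suc_left
  by (subst expectation_bind_pmf) (use assms finite_set_word_law[OF assms] in auto)

lemma avg_expectation:
  assumes "finite (set_pmf p)"
  shows "avg m b (\<lambda>x. measure_pmf.expectation p (\<lambda>a. f a x)) w = measure_pmf.expectation p (\<lambda>a. avg m b (f a) w)"
  unfolding avg_def by (simp add: Bochner_Integration.integral_sum integrable_measure_pmf_finite[OF assms])

lemma expectation_ge_zero_pmf:
  "(\<And>x. x \<in> set_pmf p \<Longrightarrow> 0 \<le> f x) \<Longrightarrow> 0 \<le> measure_pmf.expectation p (f :: _ \<Rightarrow> real)"
  by (rule integral_nonneg_AE) (simp add: AE_measure_pmf_iff)

lemma expectation_zeroD:
  fixes f :: "'a \<Rightarrow> real"
  assumes fin: "finite (set_pmf p)" and nn: "\<And>x. x \<in> set_pmf p \<Longrightarrow> 0 \<le> f x"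
    and zero: "measure_pmf.expectation p f = 0" and x: "x \<in> set_pmf p"
  shows "f x = 0"
proof -
  have "(\<Sum>a\<in>set_pmf p. pmf p a * f a) = 0"
    using zero integral_measure_pmf[OF fin, of p f] by simp
  then have "pmf p x * f x = 0"
    using sum_nonneg_eq_0_iff[OF fin, of "\<lambda>a. pmf p a * f a"] nn x by simp
  then show ?thesis using x by (simp add: set_pmf_iff)
qed

context saturated begin

lemma set_R [simp]: "set_pmf (pmf_of_set R) = R"
  using one_R finite_R by (intro set_pmf_of_set) auto

lemma set_HF [simp]: "set_pmf (pmf_of_set HF) = HF"
  using one_HF finite_HF by (intro set_pmf_of_set) auto

lemma fin_R: "finite (set_pmf (pmf_of_set R))"
  by (simp add: finite_R)

lemma fin_HF: "finite (set_pmf (pmf_of_set HF))"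
  by (simp add: finite_HF)

lemma R_Sigma: "a \<in> R \<Longrightarrow> a \<in> \<Sigma>" and HF_Sigma: "a \<in> HF \<Longrightarrow> a \<in> \<Sigma>"
  by (simp_all add: Sigma_set_def)

abbreviation ER :: "(_ \<Rightarrow> real) \<Rightarrow> real" where "ER \<equiv> measure_pmf.expectation (pmf_of_set R)"
abbreviation EK :: "(_ \<Rightarrow> real) \<Rightarrow> real" where "EK \<equiv> measure_pmf.expectation (pmf_of_set HF)"

lemma expectation_step_words:
  fixes f :: "_ \<Rightarrow> real"
  shows "measure_pmf.expectation (step_words F d H) f = ER (\<lambda>s. EK (\<lambda>a. ER (\<lambda>s'. f [s, a, s'])))"
  unfolding step_words_def
  by (simp add: expectation_bind_pmf finite_R finite_HF)

lemma ER_mono: "(\<And>s. s \<in> R \<Longrightarrow> f s \<le> g s) \<Longrightarrow> ER f \<le> ER g"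
  by (rule pmf_expectation_mono[OF fin_R]) simp

lemma EK_mono: "(\<And>s. s \<in> HF \<Longrightarrow> f s \<le> g s) \<Longrightarrow> EK f \<le> EK g"
  by (rule pmf_expectation_mono[OF fin_HF]) simp

lemma ER_cong: "(\<And>s. s \<in> R \<Longrightarrow> f s = g s) \<Longrightarrow> ER f = ER g"
  by (rule pmf_expectation_cong) simp

lemma EK_cong: "(\<And>s. s \<in> HF \<Longrightarrow> f s = g s) \<Longrightarrow> EK f = EK g"
  by (rule pmf_expectation_cong) simp

lemma ER_add: "ER (\<lambda>s. c + f s) = c + ER f"
  by (simp add: integrable_measure_pmf_finite[OF fin_R])

lemma EK_add: "EK (\<lambda>s. c + f s) = c + EK f"
  by (simp add: integrable_measure_pmf_finite[OF fin_HF])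

subsection \<open>Transitivity on levels and uniformity\<close>

definition reach :: "nat list \<Rightarrow> nat list \<Rightarrow> bool" where
  "reach u v \<longleftrightarrow> (\<exists>w. set w \<subseteq> \<Sigma> \<and> snd (wprod W w) u = v)"

lemma reach_letter: "a \<in> \<Sigma> \<Longrightarrow> reach u (snd a u)"
  unfolding reach_def
  by (rule exI[of _ "[a]"]) (simp add: snd_wreath_mult wreath_one)

lemma reach_trans: assumes "reach u v" "reach v x" shows "reach u x"
proof -
  obtain w w' where w: "set w \<subseteq> \<Sigma>" "snd (wprod W w) u = v" "set w' \<subseteq> \<Sigma>" "snd (wprod W w') v = x"
    using assms unfolding reach_def by (elim exE conjE)
  have "wprod W (w @ w') = wprod W w \<otimes>\<^bsub>W\<^esub> wprod W w'"
    by (rule W.wprod_append) (use w Sigma_carrier in auto)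
  then have "snd (wprod W (w @ w')) u = x" using w by (simp add: snd_wreath_mult)
  then show ?thesis unfolding reach_def using w by (intro exI[of _ "w @ w'"]) simp
qed

lemma reach_sym: assumes "reach u v" shows "reach v u"
proof -
  obtain w where w: "set w \<subseteq> \<Sigma>" "snd (wprod W w) u = v"
    using assms unfolding reach_def by (elim exE conjE)
  let ?w = "rev (map (\<lambda>a. inv\<^bsub>W\<^esub> a) w)"
  have wW: "set w \<subseteq> carrier W" using w Sigma_carrier by auto
  have "snd (wprod W ?w) v = u"
    unfolding W.wprod_rev_inv[OF wW] w(2)[symmetric] by (rule snd_inv[OF W.wprod_closed[OF wW]])
  moreover have "set ?w \<subseteq> \<Sigma>" using w Sigma_inv by auto
  ultimately show ?thesis unfolding reach_def by blast
qed

lemma H_label_surj: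
  assumes "1 \<le> k" "p permutes {1..d k}"
  obtains h where "h \<in> H" "aut_label d h (replicate (k - 1) 1 @ [2]) = p"
proof -
  have "finite {p. p permutes {1..d k}}" "{p. p permutes {1..d k}} \<noteq> {}"
    using finite_permutations[of "{1..d k}"] permutes_id by blast+
  then have "set_pmf (pmf_of_set {p. p permutes {1..d k}}) = {p. p permutes {1..d k}}" by (rule set_pmf_of_set[rotated])
  moreover have "H \<noteq> {}" using H_id by blast
  then have "set_pmf (pmf_of_set H) = H" using H_fin by (intro set_pmf_of_set)
  ultimately have "(\<lambda>h. aut_label d h (replicate (k - 1) 1 @ [2])) ` H = {p. p permutes {1..d k}}"
    using H_unif[OF assms(1), of 2] d_ge2[of "k - 1"] by (metis (mono_tags, lifting) order_refl set_map_pmf)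
  then show ?thesis using assms(2) that by (metis (mono_tags, lifting) imageE mem_Collect_eq)
qed

text \<open>Induction on the level. Both vertices are moved below a special vertex 1...12 of the
  level above, whose children are permuted arbitrarily by elements of H because a uniform label has
  full support; level 1 is served by the rooted letters.\<close>

lemma reach_level: "u \<in> level k \<Longrightarrow> v \<in> level k \<Longrightarrow> reach u v"
proof (induction k arbitrary: u v)
  case 0
  have "u = v" using 0 by (simp add: level_def)
  moreover have "reach v v" unfolding reach_def by (rule exI[of _ "[]"]) (simp add: wreath_one)
  ultimately show ?case by simp
next
  case (Suc k)
  show ?case
  proof (cases "k = 0")
    case True
    obtain i j where ij: "u = [i]" "v = [j]" using Suc.prems True by (auto simp: level_def length_Suc_conv)
    have "i \<in> {1..d 0}" "j \<in> {1..d 0}" using Suc.prems ij by (auto simp: level_def Cons_tree_vertices)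
    then have t: "Transposition.transpose i j permutes {1..d 0}" by (rule permutes_swap_id)
    define a where "a = (lamp F d \<one>\<^bsub>F\<^esub>, rooted_aut d (Transposition.transpose i j))"
    have "a \<in> \<Sigma>" using t by (auto simp: a_def R_alt intro!: R_Sigma)
    moreover have "snd a u = v" using Suc.prems by (simp add: a_def ij level_def rooted_aut_Cons)
    ultimately show ?thesis using reach_letter by metis
  next
    case False
    define p where "p = replicate (k - 1) 1 @ [2 :: nat]"
    have "replicate (k - 1) (Suc 0) @ [2] \<in> tree_vertices d"
      using d_ge2[of "k - 1"] by (simp add: snoc_tree_vertices)
    then have p: "p \<in> level k" "special_vertex p" using False by (auto simp: p_def level_def special_vertex_alt)
    have to_p: "\<exists>i\<in>{1..d k}. reach x (p @ [i])" if x: "x \<in> level (Suc k)" for x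
    proof -
      have eq: "x = butlast x @ [last x]" using x by (cases x rule: rev_cases) (auto simp: level_def)
      define y where "y = butlast x"
      define i where "i = last x"
      have x': "x = y @ [i]" using eq by (simp add: y_def i_def)
      have yi: "y @ [i] \<in> tree_vertices d" "length y = k" using x x' by (auto simp: level_def)
      have "y \<in> level k" using yi by (simp add: level_def snoc_tree_vertices)
      then obtain w where w: "set w \<subseteq> \<Sigma>" "snd (wprod W w) y = p"
        using Suc.IH[OF _ p(1)] unfolding reach_def by blast
      note G = wprod_aut[OF w(1)]
      have "snd (wprod W w) x = p @ [aut_label d (snd (wprod W w)) y i]"
        unfolding x' tree_aut_append[OF G yi(1)] w(2) ..
      moreover from this have "p @ [aut_label d (snd (wprod W w)) y i] \<in> tree_vertices d"
        using tree_autD(5)[OF G, of x] x by (simp add: level_def)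
      then have "aut_label d (snd (wprod W w)) y i \<in> {1..d k}"
        using p(1) by (simp add: snoc_tree_vertices level_def)
      ultimately show ?thesis using w(1) unfolding reach_def by blast
    qed
    obtain i j where ij: "i \<in> {1..d k}" "j \<in> {1..d k}" "reach u (p @ [i])" "reach v (p @ [j])"
      using to_p[OF Suc.prems(1)] to_p[OF Suc.prems(2)] by blast
    have t: "Transposition.transpose i j permutes {1..d k}" using ij(1,2) by (rule permutes_swap_id)
    obtain h where h: "h \<in> H" "aut_label d h p = Transposition.transpose i j"
      using H_label_surj[OF _ t] False unfolding p_def by auto
    have V: "p @ [i] \<in> tree_vertices d" using ij(1) p(1) by (simp add: snoc_tree_vertices level_def)
    have "h (p @ [i]) = p @ [j]"
      using tree_aut_append[OF H_aut[OF h(1)] V] H_special_fix[OF h(1) _ p(2)] p(1) h(2) by (simp add: level_def)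
    moreover have "(lamp F d \<one>\<^bsub>F\<^esub>, h) \<in> \<Sigma>" using HF_I[OF F.one_closed h(1)] by (rule HF_Sigma)
    ultimately have "reach (p @ [i]) (p @ [j])" using reach_letter[of "(lamp F d \<one>\<^bsub>F\<^esub>, h)" "p @ [i]"] by simp
    then show ?thesis using ij reach_trans reach_sym by blast
  qed
qed

lemma snd_HF_uniform: "map_pmf snd (pmf_of_set HF) = pmf_of_set H"
proof -
  have "group (W\<lparr>carrier := HF\<rparr>)" using subgroup.subgroup_is_group[OF subgroup_HF W.is_group] .
  moreover have "snd \<in> hom (W\<lparr>carrier := HF\<rparr>) (aut_group d)"
    by (rule homI) (auto simp: aut_group_def snd_wreath_mult elim!: HF_E intro: H_aut)
  ultimately have "map_pmf snd (pmf_of_set HF) = pmf_of_set (snd ` HF)"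
    using uniform_hom_image[OF _ _ group_aut_group, of "W\<lparr>carrier := HF\<rparr>" snd d] finite_HF by simp
  moreover have "snd ` HF = H"
  proof (intro equalityI subsetI)
    fix h assume "h \<in> H"
    then show "h \<in> snd ` HF" using HF_I[OF F.one_closed, of h] by (metis image_eqI snd_conv)
  qed (auto elim: HF_E)
  ultimately show ?thesis by simp
qed

text \<open>A uniform element of HF has a uniform trace in K_k, which in the regular representation
  moves every point uniformly: this gives the uniform moves of type \<open>False\<close>.\<close>

lemma kperm_uniform:
  assumes "j \<in> {1..arity k False}"
  shows "map_pmf (\<lambda>a. kperm k a j) (pmf_of_set HF) = pmf_of_set {1..arity k False}"
proof -
  have "group (W\<lparr>carrier := HF\<rparr>)" using subgroup.subgroup_is_group[OF subgroup_HF W.is_group] .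
  moreover have "kel k \<in> hom (W\<lparr>carrier := HF\<rparr>) (Kgrp k)"
    by (rule homI) (simp_all add: kel_mult kel_carrier)
  ultimately have "map_pmf (kel k) (pmf_of_set HF) = pmf_of_set (kel k ` HF)"
    using uniform_hom_image[OF _ _ group_Kgrp, of "W\<lparr>carrier := HF\<rparr>" "kel k" k] finite_HF by simp
  then have "map_pmf (\<lambda>a. kperm k a j) (pmf_of_set HF) = map_pmf (\<lambda>c. rot k c j) (pmf_of_set (carrier (Kgrp k)))"
    by (simp add: kperm_def map_pmf_comp[of "\<lambda>c. rot k c j" "kel k", symmetric] Kgrp_def)
  then show ?thesis using rot_uniform[of j k] assms by (simp add: arity_def)
qed

text \<open>Saturation enters the drift here: over a special vertex a uniform letter of HF induces a
  uniform permutation of the children, hence a uniform move of type \<open>True\<close>.\<close>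

lemma label_uniform:
  assumes u: "u \<in> level k" "special_vertex u" and j: "j \<in> {1..arity k True}"
  shows "map_pmf (\<lambda>a. aut_label d (snd a) u j) (pmf_of_set HF) = pmf_of_set {1..arity k True}"
proof -
  obtain m t where mt: "u = replicate m 1 @ [t]" "t \<noteq> 1" using u(2) by (auto simp: special_vertex_alt)
  have k: "k = Suc m" using u(1) mt by (simp add: level_def)
  have "replicate m 1 @ [t] \<in> tree_vertices d" using u(1) mt by (simp add: level_def)
  then have t: "2 \<le> t" "t \<le> d (k - 1)" using mt(2) k by (auto simp: snoc_tree_vertices)
  have "map_pmf (\<lambda>a. aut_label d (snd a) u) (pmf_of_set HF) = map_pmf (\<lambda>h. aut_label d h u) (pmf_of_set H)"
    by (simp add: snd_HF_uniform[symmetric] map_pmf_comp)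
  also have "\<dots> = pmf_of_set {p. p permutes {1..d k}}"
    using H_unif[of k t] t k mt(1) by simp
  finally have "map_pmf (\<lambda>a. aut_label d (snd a) u j) (pmf_of_set HF)
      = map_pmf (\<lambda>p. p j) (pmf_of_set {p. p permutes {1..d k}})"
    by (simp add: map_pmf_comp[of "\<lambda>p. p j" "\<lambda>a. aut_label d (snd a) u", symmetric])
  then show ?thesis using uniform_permutation_eval[of "{1..d k}" j] j by (simp add: arity_def)
qed

lemma HF_fix:
  assumes "a \<in> HF" "v \<in> level k" "v = replicate k 1 \<or> special_vertex v"
  shows "snd a v = v"
proof -
  have h: "snd a \<in> H" using assms(1) by (elim HF_E) simp
  from assms(3) show ?thesis
  proof
    assume "v = replicate k 1"
    then show ?thesis using H_ones[OF h, of k] by simp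
  next
    assume "special_vertex v"
    then show ?thesis using H_special_fix[OF h] assms(2) by (simp add: level_def)
  qed
qed

subsection \<open>Counting changes of type\<close>

text \<open>The type of the last block in which a turn was made: vertices other than 1^k and the
  special ones turn nothing and keep the old type.\<close>

definition type_after :: "nat list \<Rightarrow> bool \<Rightarrow> bool" where
  "type_after v b = (if v = replicate (length v) 1 then False else if special_vertex v then True else b)"

text \<open>Expected number of type changes in n steps when the last turn had type b. The vertex is
  tested after the first rooted letter, where the letter of HF is applied; rooted letters turn
  nothing.\<close>

primrec changes :: "nat \<Rightarrow> bool \<Rightarrow> nat list \<Rightarrow> real" where
  "changes 0 b u = 0"
| "changes (Suc n) b u = ER (\<lambda>s. EK (\<lambda>a. ER (\<lambda>s'.
     of_bool (type_after (snd s u) b \<noteq> b)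
       + changes n (type_after (snd s u) b) (snd s' (snd a (snd s u))))))"

lemma changes_nonneg: "0 \<le> changes n b u"
  by (induction n arbitrary: b u) (auto intro!: expectation_ge_zero_pmf)

text \<open>By the Markov property a bound valid for all starting states is collected once more by m
  additional steps.\<close>

lemma changes_add:
  assumes m: "\<And>b u. u \<in> level k \<Longrightarrow> c \<le> changes m b u" and u: "u \<in> level k"
  shows "changes n b u + c \<le> changes (n + m) b u"
  using u
proof (induction n arbitrary: b u)
  case 0
  then show ?case using m by simp
next
  case (Suc n)
  have "changes (Suc n) b u + c = ER (\<lambda>s. EK (\<lambda>a. ER (\<lambda>s'. c + (
     of_bool (type_after (snd s u) b \<noteq> b)
       + changes n (type_after (snd s u) b) (snd s' (snd a (snd s u)))))))"
    by (simp only: changes.simps ER_add EK_add)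
  also have "\<dots> \<le> changes (Suc n + m) b u"
    unfolding add_Suc changes.simps
  proof (intro ER_mono EK_mono)
    fix s a s' assume "s \<in> R" "a \<in> HF" "s' \<in> R"
    then have "snd s' (snd a (snd s u)) \<in> level k"
      using Suc.prems by (simp add: level_aut Sigma_aut R_Sigma HF_Sigma)
    from Suc.IH[OF this, of "type_after (snd s u) b"]
    show "c + (of_bool (type_after (snd s u) b \<noteq> b) + changes n (type_after (snd s u) b) (snd s' (snd a (snd s u))))
      \<le> of_bool (type_after (snd s u) b \<noteq> b) + changes (n + m) (type_after (snd s u) b) (snd s' (snd a (snd s u)))"
      by linarith
  qed
  finally show ?case .
qed

lemma changes_mono: "u \<in> level k \<Longrightarrow> n \<le> n' \<Longrightarrow> changes n b u \<le> changes n' b u"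
  using changes_add[of k 0 "n' - n" u n b] changes_nonneg by simp

lemma changes_zeroD:
  assumes z: "changes (Suc n) b u = 0" and sa: "s \<in> R" "a \<in> HF" "s' \<in> R"
  shows "type_after (snd s u) b = b" "changes n b (snd s' (snd a (snd s u))) = 0"
proof -
  define f where "f s a s' = of_bool (type_after (snd s u) b \<noteq> b)
       + changes n (type_after (snd s u) b) (snd s' (snd a (snd s u)))"
    for s a s' :: "((nat \<Rightarrow> nat) \<Rightarrow> 'f) \<times> (nat list \<Rightarrow> nat list)"
  have nn: "0 \<le> f s a s'" for s a s' using changes_nonneg by (simp add: f_def)
  have nn2: "0 \<le> ER (f s a)" for s a by (rule expectation_ge_zero_pmf) (rule nn)
  have nn3: "0 \<le> EK (\<lambda>a. ER (f s a))" for s by (rule expectation_ge_zero_pmf) (rule nn2)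
  have zf: "ER (\<lambda>s. EK (\<lambda>a. ER (f s a))) = 0" using z unfolding f_def[abs_def] changes.simps .
  have "EK (\<lambda>a. ER (f s a)) = 0"
    by (rule expectation_zeroD[OF fin_R nn3 zf]) (simp add: sa)
  then have "ER (f s a) = 0"
    by (rule expectation_zeroD[OF fin_HF nn2]) (simp add: sa)
  then have f0: "f s a s' = 0"
    by (rule expectation_zeroD[OF fin_R nn]) (simp add: sa)
  then show t: "type_after (snd s u) b = b"
    using changes_nonneg[of n "type_after (snd s u) b" "snd s' (snd a (snd s u))"]
    unfolding f_def by (cases "type_after (snd s u) b = b") auto
  show "changes n b (snd s' (snd a (snd s u))) = 0" using f0 unfolding f_def t by simp
qed

lemma snd_one: "snd \<one>\<^bsub>W\<^esub> v = v"
  by (simp add: wreath_one)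

text \<open>If no change ever had positive probability, the type would stay b at every vertex of the
  level, as all of them are reachable; but 1^k forces type \<open>False\<close> and 1^(k-1)2 forces
  type \<open>True\<close>.\<close>

lemma changes_pos:
  assumes k: "1 \<le> k" and u: "u \<in> level k"
  shows "\<exists>n. 0 < changes n b u"
proof (rule ccontr)
  assume "\<nexists>n. 0 < changes n b u"
  then have zero: "changes n b u = 0" for n using changes_nonneg[of n b u] by (metis order_le_less)
  \<comment> \<open>The identity lies in both \<open>R\<close> and \<open>HF\<close>, so a single
    letter can be regarded as a step with two trivial letters.\<close>
  have closed: "changes n b (snd c v) = 0" if v: "\<And>n. changes n b v = 0" and c: "c \<in> \<Sigma>" for c v n
  proof -
    consider "c \<in> R" | "c \<in> HF" using c by (auto simp: Sigma_set_def)
    then show ?thesis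
    proof cases
      case 1
      then show ?thesis using changes_zeroD(2)[OF v[of "Suc n"] 1 one_HF one_R] by (simp add: snd_one)
    next
      case 2
      then show ?thesis using changes_zeroD(2)[OF v[of "Suc n"] one_R 2 one_R] by (simp add: snd_one)
    qed
  qed
  have all: "changes n b (snd (wprod W w) v) = 0" if "set w \<subseteq> \<Sigma>" "\<And>n. changes n b v = 0" for w v n
    using that
  proof (induction w arbitrary: v)
    case Nil
    then show ?case by (simp add: snd_one)
  next
    case (Cons a w)
    have "changes n b (snd a v) = 0" for n using closed[of v a n] Cons.prems by simp
    then show ?case using Cons.IH[of "snd a v"] Cons.prems by (simp add: snd_wreath_mult)
  qed
  have type: "type_after v b = b" if v: "v \<in> level k" for v
  proof -
    obtain w where w: "set w \<subseteq> \<Sigma>" "snd (wprod W w) u = v" using reach_level[OF u v] unfolding reach_def by blast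
    have "changes 1 b v = 0" using all[OF w(1) zero, of 1] w(2) by simp
    then show ?thesis using changes_zeroD(1)[of 0 b v, OF _ one_R one_HF one_R] by (simp add: snd_one)
  qed
  define p where "p = replicate (k - 1) 1 @ [2 :: nat]"
  have "replicate (k - 1) (Suc 0) @ [2] \<in> tree_vertices d"
    using d_ge2[of "k - 1"] by (simp add: snoc_tree_vertices)
  then have p: "p \<in> level k" "special_vertex p" using k by (auto simp: p_def level_def special_vertex_alt)
  have "type_after p b = True"
    using p(2) replicate_not_special[of "length p"] by (auto simp: type_after_def)
  moreover have "type_after (replicate k 1) b = False" by (simp add: type_after_def)
  moreover have "replicate k 1 \<in> level k" by (simp add: level_def)
  ultimately show False using type p(1) by metis
qed

text \<open>The walk on level k together with its type has finitely many states, so one M and one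
  \<epsilon> serve all of them, and the gains of successive blocks of M steps add up.\<close>

lemma changes_linear:
  assumes k: "1 \<le> k"
  obtains \<epsilon> M where "0 < \<epsilon>" "1 \<le> M" "\<And>j b u. u \<in> level k \<Longrightarrow> \<epsilon> * real j \<le> changes (M * j) b u"
proof -
  have fin: "finite (level k \<times> (UNIV :: bool set))" by (simp add: level_def finite_level)
  have "\<forall>p\<in>level k \<times> (UNIV :: bool set). \<exists>n. 0 < changes n (snd p) (fst p)" using changes_pos[OF k] by auto
  then obtain N where N: "\<And>p. p \<in> level k \<times> (UNIV :: bool set) \<Longrightarrow> 0 < changes (N p) (snd p) (fst p)" by metis
  define M where "M = Max (insert 1 (N ` (level k \<times> (UNIV :: bool set))))"
  have M: "1 \<le> M" "\<And>p. p \<in> level k \<times> (UNIV :: bool set) \<Longrightarrow> N p \<le> M" using fin by (auto simp: M_def)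
  define \<epsilon> where "\<epsilon> = Min (insert 1 ((\<lambda>p. changes M (snd p) (fst p)) ` (level k \<times> (UNIV :: bool set))))"
  have pos: "0 < changes M b u" if "u \<in> level k" for b u
    using N[of "(u, b)"] changes_mono[OF that M(2)[of "(u, b)"], of b] that by simp
  have e: "0 < \<epsilon>" "\<And>b u. u \<in> level k \<Longrightarrow> \<epsilon> \<le> changes M b u"
  proof -
    show "0 < \<epsilon>" unfolding \<epsilon>_def using fin pos by (subst Min_gr_iff) auto
    fix b u assume "u \<in> level k"
    then show "\<epsilon> \<le> changes M b u" unfolding \<epsilon>_def
      using fin by (intro Min_le) (auto intro!: image_eqI[of _ _ "(u, b)"])
  qed
  have "\<epsilon> * real j \<le> changes (M * j) b u" if u: "u \<in> level k" for j b u
  proof (induction j)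
    case (Suc j)
    then show ?case using changes_add[of k \<epsilon> M u "M * j" b] e(2) u by (simp add: algebra_simps)
  qed simp
  then show ?thesis using that e(1) M(1) by blast
qed

subsection \<open>The drift inequality\<close>

definition mean_len :: "nat \<Rightarrow> nat \<Rightarrow> nat \<Rightarrow> nat list \<Rightarrow> (bool \<times> nat) list \<Rightarrow> real" where
  "mean_len k L n u x = measure_pmf.expectation (word_law (step_words F d H) n)
     (\<lambda>w. real (length (snd (run (act k L) w (u, x)))))"

lemma act_R:
  assumes s: "s \<in> R" and k: "1 \<le> k" and z: "u \<in> level k" "x \<in> tree_words (arity k) L"
  shows "act k L s (u, x) = (snd s u, x)"
proof -
  obtain \<tau> where t: "\<tau> permutes {1..d 0}" "s = (lamp F d \<one>\<^bsub>F\<^esub>, rooted_aut d \<tau>)" using s by (auto simp: R_alt)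
  have u: "u \<in> tree_vertices d" "u \<noteq> []" using z k by (auto simp: level_def)
  have "aut_label d (snd s) u = id" unfolding t(2) snd_conv by (rule rooted_aut_label[OF u(2,1)])
  moreover have "kperm k s = id" using R_kel[OF t(1) k] kperm_one[of k] by (simp add: t(2) kperm_def)
  ultimately show ?thesis using z by (simp add: act_def Zs_def)
qed

lemma act_avg:
  assumes k: "1 \<le> k" and z: "v \<in> level k" "x \<in> tree_words (arity k) L" "length x < L"
    and v: "v = replicate k 1 \<or> special_vertex v"
  shows "EK (\<lambda>a. f (act k L a (v, x))) = avg (arity k) (type_after v b) (\<lambda>x. f (v, x)) x"
proof -
  have len: "length v = k" using z by (simp add: level_def)
  have fix_v: "snd a v = v" if "a \<in> HF" for a
    by (rule HF_fix[OF that z(1) v])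
  show ?thesis
  proof (cases "v = replicate k 1")
    case True
    have "EK (\<lambda>a. f (act k L a (v, x))) = EK (\<lambda>a. f (v, turn (arity k) L False (kperm k a) x))"
      by (rule EK_cong) (use True z fix_v in \<open>simp add: act_def Zs_def\<close>)
    also have "\<dots> = avg (arity k) False (\<lambda>x. f (v, x)) x"
      by (rule expectation_turn[where \<tau> = "kperm k", OF z(2,3) arity_pos kperm_uniform])
    finally show ?thesis using True len by (simp add: type_after_def)
  next
    case False
    then have sp: "special_vertex v" using v by simp
    have "EK (\<lambda>a. f (act k L a (v, x))) = EK (\<lambda>a. f (v, turn (arity k) L True (aut_label d (snd a) v) x))"
      by (rule EK_cong) (use False z fix_v in \<open>simp add: act_def Zs_def\<close>)
    also have "\<dots> = avg (arity k) True (\<lambda>x. f (v, x)) x"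
      by (rule expectation_turn[where \<tau> = "\<lambda>a. aut_label d (snd a) v", OF z(2,3) arity_pos label_uniform[OF z(1) sp]])
    finally show ?thesis using False len sp by (simp add: type_after_def)
  qed
qed

lemma act_other:
  assumes k: "1 \<le> k" and z: "v \<in> level k" "x \<in> tree_words (arity k) L"
    and v: "v \<noteq> replicate k 1" "\<not> special_vertex v" and a: "a \<in> HF"
  shows "act k L a (v, x) = (snd a v, x)"
proof -
  have "v \<in> tree_vertices d" "v \<noteq> []" using z k by (auto simp: level_def)
  then have "aut_label d (snd a) v = id" using Sigma_label[OF HF_Sigma[OF a]] v by blast
  then show ?thesis using z v by (simp add: act_def Zs_def)
qed

lemma mean_len_Suc:
  assumes k: "1 \<le> k" and u: "u \<in> level k" and x: "x \<in> tree_words (arity k) L"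
  shows "mean_len k L (Suc n) u x = ER (\<lambda>s. EK (\<lambda>a. ER (\<lambda>s'.
     mean_len k L n (snd s' (fst (act k L a (snd s u, x)))) (snd (act k L a (snd s u, x))))))"
  unfolding mean_len_def expectation_word_law_Suc[OF finite_step_words] expectation_step_words
proof (intro ER_cong EK_cong)
  fix s a s' assume s: "s \<in> R" "a \<in> HF" "s' \<in> R"
  have su: "snd s u \<in> level k" using level_aut[OF Sigma_aut[OF R_Sigma[OF s(1)]] u] .
  define z where "z = act k L a (snd s u, x)"
  have "(snd s u, x) \<in> Zs k L" using su x by (simp add: Zs_def)
  then have "z \<in> Zs k L" unfolding z_def using permutes_in_image[OF act_permutes[OF k HF_Sigma[OF s(2)]]] by blast
  then have "fst z \<in> level k" "snd z \<in> tree_words (arity k) L" by (auto simp: Zs_def)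
  then have "act k L s' z = (snd s' (fst z), snd z)" using act_R[OF s(3) k, of "fst z" "snd z" L] by simp
  moreover have "act k L s (u, x) = (snd s u, x)" by (rule act_R[OF s(1) k u x])
  ultimately have "run (act k L) ([s, a, s'] @ w) (u, x) = run (act k L) w (snd s' (fst z), snd z)" for w
    by (simp add: z_def)
  then show "measure_pmf.expectation (word_law (step_words F d H) n)
      (\<lambda>w. real (length (snd (run (act k L) ([s, a, s'] @ w) (u, x))))) =
    measure_pmf.expectation (word_law (step_words F d H) n) (\<lambda>w. real (length (snd (run (act k L) w
      (snd s' (fst (act k L a (snd s u, x))), snd (act k L a (snd s u, x)))))))"
    by (simp only: z_def)
qed

text \<open>The gain of mean length at each change of type, positive when the blocks of the two
  types have at least two and three points.\<close>

definition gap :: "nat \<Rightarrow> real" where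
  "gap k = 1 - 1 / real (arity k True) - 1 / real (arity k False)"

lemma avg_len_type:
  assumes x: "x \<in> tree_words (arity k) L"
  shows "avg (arity k) b (\<lambda>v. real (length v)) x + gap k * of_bool (c \<noteq> b)
     \<le> avg (arity k) b (avg (arity k) c (\<lambda>v. real (length v))) x"
proof (cases "c = b")
  case True
  then show ?thesis using avg_avg[OF x arity_pos] by simp
next
  case False
  have "gap k = 1 - 1 / real (arity k b) - 1 / real (arity k c)" using False by (cases b; cases c) (auto simp: gap_def)
  then show ?thesis using avg_length_alternate[OF x arity_pos arity_pos False] False by simp
qed

text \<open>Both sides are averaged over the block of the last turn, since a single turn may shorten
  the word and only the average over the previous block gains \<open>gap k\<close> at a change of
  type. The condition on L leaves room for one letter per step and for the initial averaging, so the
  truncation is never felt.\<close>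

lemma avg_mean_len:
  assumes k: "1 \<le> k"
  shows "u \<in> level k \<Longrightarrow> x \<in> tree_words (arity k) L \<Longrightarrow> length x + n + 1 \<le> L \<Longrightarrow>
    avg (arity k) b (\<lambda>v. real (length v)) x + gap k * changes n b u \<le> avg (arity k) b (mean_len k L n u) x"
proof (induction n arbitrary: b u x)
  case 0
  then show ?case by (simp add: mean_len_def)
next
  case (Suc n)
  let ?m = "arity k"
  let ?len = "\<lambda>v :: (bool \<times> nat) list. real (length v)"
  have bx: "put b j (base b x) \<in> tree_words ?m L" "length (put b j (base b x)) \<le> length x + 1"
    if "j \<in> {1..?m b}" for j
    using put_tree_words[of "base b x" ?m L b j] base_props[OF Suc.prems(2), of b] that Suc.prems(3)
    by (auto simp: put_def)
  let ?V = "\<lambda>s y. EK (\<lambda>a. ER (\<lambda>s'. mean_len k L n (snd s' (fst (act k L a (snd s u, y)))) (snd (act k L a (snd s u, y)))))"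
  let ?C = "\<lambda>s. EK (\<lambda>a. ER (\<lambda>s'. of_bool (type_after (snd s u) b \<noteq> b)
       + changes n (type_after (snd s u) b) (snd s' (snd a (snd s u)))))"
  have "avg ?m b (mean_len k L (Suc n) u) x = avg ?m b (\<lambda>y. ER (\<lambda>s. ?V s y)) x"
    by (rule avg_cong) (rule mean_len_Suc[OF k Suc.prems(1) bx(1)])
  also have "\<dots> = ER (\<lambda>s. avg ?m b (?V s) x)" by (rule avg_expectation[OF fin_R])
  finally have V: "avg ?m b (mean_len k L (Suc n) u) x = ER (\<lambda>s. avg ?m b (?V s) x)" .
  have "avg ?m b ?len x + gap k * changes (Suc n) b u = ER (\<lambda>s. avg ?m b ?len x + gap k * ?C s)"
    unfolding ER_add changes.simps by simp
  also have "\<dots> \<le> ER (\<lambda>s. avg ?m b (?V s) x)"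
  proof (rule ER_mono)
    fix s assume s: "s \<in> R"
    define v where "v = snd s u"
    define c where "c = type_after v b"
    have v: "v \<in> level k" unfolding v_def by (rule level_aut[OF Sigma_aut[OF R_Sigma[OF s]] Suc.prems(1)])
    have lv: "length v = k" using v by (simp add: level_def)
    have s'v: "snd s' y \<in> level k" if "s' \<in> R" "y \<in> level k" for s' y
      by (rule level_aut[OF Sigma_aut[OF R_Sigma[OF that(1)]] that(2)])
    show "avg ?m b ?len x + gap k * ?C s \<le> avg ?m b (?V s) x"
    proof (cases "v = replicate k 1 \<or> special_vertex v")
      case True
      have fix_v: "snd a v = v" if "a \<in> HF" for a
        by (rule HF_fix[OF that v True])
      have C: "?C s = of_bool (c \<noteq> b) + ER (\<lambda>s'. changes n c (snd s' v))"
      proof -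
        have "?C s = EK (\<lambda>a. of_bool (c \<noteq> b) + ER (\<lambda>s'. changes n c (snd s' v)))"
          unfolding v_def[symmetric] c_def[symmetric] by (rule EK_cong) (simp only: ER_add fix_v)
        then show ?thesis by simp
      qed
      have "avg ?m c ?len y + gap k * ER (\<lambda>s'. changes n c (snd s' v)) \<le> ?V s y"
        if y: "y \<in> tree_words ?m L" "length y \<le> length x + 1" for y
      proof -
        have yl: "length y < L" "length y + n + 1 \<le> L" using y Suc.prems(3) by auto
        have "?V s y = avg ?m c (\<lambda>y. ER (\<lambda>s'. mean_len k L n (snd s' v) y)) y"
          using act_avg[OF k v y(1) yl(1) True, of "\<lambda>z. ER (\<lambda>s'. mean_len k L n (snd s' (fst z)) (snd z))" b]
          by (simp add: v_def c_def)
        also have "\<dots> = ER (\<lambda>s'. avg ?m c (mean_len k L n (snd s' v)) y)" by (rule avg_expectation[OF fin_R])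
        also have "\<dots> \<ge> ER (\<lambda>s'. avg ?m c ?len y + gap k * changes n c (snd s' v))"
          by (rule ER_mono) (rule Suc.IH[OF s'v[OF _ v] y(1) yl(2)])
        finally show ?thesis unfolding ER_add by simp
      qed
      then have "avg ?m b (\<lambda>y. avg ?m c ?len y + gap k * ER (\<lambda>s'. changes n c (snd s' v))) x \<le> avg ?m b (?V s) x"
        by (intro avg_mono) (use bx in auto)
      then show ?thesis using avg_len_type[OF Suc.prems(2), of b c] unfolding C avg_add[OF arity_pos]
        by (simp add: algebra_simps)
    next
      case False
      \<comment> \<open>Nothing is turned at this vertex; the average over the old block is carried
        on to the next step.\<close>
      have c: "c = b" using False lv by (simp add: c_def type_after_def)
      have "avg ?m b (?V s) x = avg ?m b (\<lambda>y. EK (\<lambda>a. ER (\<lambda>s'. mean_len k L n (snd s' (snd a v)) y))) x"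
      proof (rule avg_cong, rule EK_cong)
        fix j a assume "j \<in> {1..?m b}" "a \<in> HF"
        then have "act k L a (v, put b j (base b x)) = (snd a v, put b j (base b x))"
          using act_other[OF k v bx(1)] False by blast
        then show "ER (\<lambda>s'. mean_len k L n (snd s' (fst (act k L a (snd s u, put b j (base b x)))))
            (snd (act k L a (snd s u, put b j (base b x)))))
          = ER (\<lambda>s'. mean_len k L n (snd s' (snd a v)) (put b j (base b x)))"
          by (simp add: v_def)
      qed
      also have "\<dots> = EK (\<lambda>a. ER (\<lambda>s'. avg ?m b (mean_len k L n (snd s' (snd a v))) x))"
        by (simp only: avg_expectation[OF fin_HF] avg_expectation[OF fin_R])
      also have "\<dots> \<ge> EK (\<lambda>a. ER (\<lambda>s'. avg ?m b ?len x + gap k * changes n b (snd s' (snd a v))))"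
      proof (intro EK_mono ER_mono)
        fix a s' assume "a \<in> HF" "s' \<in> R"
        then show "avg ?m b ?len x + gap k * changes n b (snd s' (snd a v)) \<le> avg ?m b (mean_len k L n (snd s' (snd a v))) x"
          using Suc.IH[OF s'v[OF _ level_aut[OF Sigma_aut[OF HF_Sigma] v]] Suc.prems(2), of s' a b] Suc.prems(3) by simp
      qed
      finally show ?thesis
        unfolding ER_add EK_add v_def[symmetric] c_def[symmetric] using c by simp
    qed
  qed
  finally show ?case unfolding V .
qed

text \<open>\<rho> is the length of the attached word. Since the drift estimate concerns an average
  over the block of type \<open>True\<close> at the root, some point of this block does at least as
  well and is taken, over 1^k, as the starting point.\<close>

lemma act_drift:
  assumes k: "1 \<le> k" and big: "3 \<le> card (carrier (Kgrp k))"
  shows "\<exists>c>0. \<forall>N. \<exists>n\<ge>N. \<exists>L z\<^sub>0. \<exists>\<rho>::_ \<Rightarrow> nat.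
        (\<forall>s\<in>\<Sigma>. \<forall>z. \<rho> (act k L s z) \<le> \<rho> z + 1) \<and>
        c * real n \<le> measure_pmf.expectation (word_law (step_words F d H) n) (\<lambda>w. real (\<rho> (run (act k L) w z\<^sub>0)))
                      - real (\<rho> z\<^sub>0)"
proof -
  obtain \<epsilon> M where e: "0 < \<epsilon>" "1 \<le> M" "\<And>j b u. u \<in> level k \<Longrightarrow> \<epsilon> * real j \<le> changes (M * j) b u"
    by (rule changes_linear[OF k]) (rule that; assumption)
  have "2 \<le> real (arity k True)" "3 \<le> real (arity k False)" using d_ge2[of k] big by (simp_all add: arity_def)
  then have "1 / real (arity k True) \<le> 1 / 2" "1 / real (arity k False) \<le> 1 / 3" by (simp_all add: divide_simps)
  then have gap: "0 < gap k" by (simp add: gap_def)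
  \<comment> \<open>In n = M j steps the gain is at least
    \<open>gap k * \<epsilon> * real j\<close>; half of it is given away for the initial length,
    which is at most 1, once the gain is at least 2.\<close>
  define c where "c = gap k * \<epsilon> / (2 * real M)"
  have c: "0 < c" using gap e by (simp add: c_def)
  have main: "\<exists>n\<ge>N. \<exists>L z\<^sub>0. \<exists>\<rho>::_ \<Rightarrow> nat.
        (\<forall>s\<in>\<Sigma>. \<forall>z. \<rho> (act k L s z) \<le> \<rho> z + 1) \<and>
        c * real n \<le> measure_pmf.expectation (word_law (step_words F d H) n) (\<lambda>w. real (\<rho> (run (act k L) w z\<^sub>0)))
                      - real (\<rho> z\<^sub>0)" for N
  proof -
    obtain j0 where j0: "2 / (gap k * \<epsilon>) \<le> real j0" using real_arch_simple by blast
    define j where "j = j0 + N"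
    define n where "n = M * j"
    define L where "L = n + 1"
    define u where "u = replicate k (1 :: nat)"
    have u: "u \<in> level k" by (simp add: u_def level_def)
    have "1 * j \<le> M * j" by (rule mult_le_mono1[OF e(2)])
    then have "j \<le> n" by (simp only: n_def mult_1)
    then have nN: "N \<le> n" by (simp add: j_def)
    have "2 \<le> gap k * \<epsilon> * real j0" using j0 gap e(1) by (simp add: field_simps)
    moreover have "0 \<le> gap k * \<epsilon> * real N" using gap e(1) by simp
    ultimately have gj: "2 \<le> gap k * \<epsilon> * real j" by (simp add: j_def distrib_left)
    define y where "y i = put True i ([] :: (bool \<times> nat) list)" for i
    have base_Nil: "base True [] = []" by (simp add: base_def headed_def)
    have "gap k * changes n True u \<le> avg (arity k) True (mean_len k L n u) []"
    proof -
      have "0 \<le> avg (arity k) True (\<lambda>v. real (length v)) []" by (simp add: avg_def sum_nonneg)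
      moreover have "avg (arity k) True (\<lambda>v. real (length v)) [] + gap k * changes n True u
          \<le> avg (arity k) True (mean_len k L n u) []"
        by (rule avg_mean_len[OF k u]) (simp_all add: L_def)
      ultimately show ?thesis by linarith
    qed
    moreover have "gap k * (\<epsilon> * real j) \<le> gap k * changes n True u"
      using e(3)[OF u, of j True] gap by (simp add: n_def)
    ultimately have avg: "gap k * \<epsilon> * real j \<le> avg (arity k) True (mean_len k L n u) []" by (simp add: mult.assoc)
    have "\<exists>i\<in>{1..arity k True}. gap k * \<epsilon> * real j \<le> mean_len k L n u (y i)"
    proof (rule ccontr)
      assume "\<not> ?thesis"
      then have "(\<Sum>i = 1..arity k True. mean_len k L n u (y i)) < (\<Sum>i = 1..arity k True. gap k * \<epsilon> * real j)"
        using arity_pos[of k True] by (intro sum_strict_mono) (auto simp: not_le)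
      then have "avg (arity k) True (mean_len k L n u) [] < gap k * \<epsilon> * real j"
        using arity_pos[of k True] by (simp add: avg_def base_Nil y_def field_simps)
      then show False using avg by simp
    qed
    then obtain i where i: "gap k * \<epsilon> * real j \<le> mean_len k L n u (y i)" by blast
    define \<rho> where "\<rho> z = length (snd z)" for z :: "nat list \<times> (bool \<times> nat) list"
    have lip: "\<rho> (act k L s z) \<le> \<rho> z + 1" for s z
      using length_turn[of "arity k" L] by (auto simp: \<rho>_def act_def)
    have "\<rho> (u, y i) \<le> 1" by (simp add: \<rho>_def y_def put_def)
    moreover have "c * real n = gap k * \<epsilon> * real j / 2" using e(2) by (simp add: c_def n_def)
    ultimately have "c * real n \<le> mean_len k L n u (y i) - real (\<rho> (u, y i))" using i gj by linarith
    then have "c * real n \<le> measure_pmf.expectation (word_law (step_words F d H) n)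
        (\<lambda>w. real (\<rho> (run (act k L) w (u, y i)))) - real (\<rho> (u, y i))"
      by (simp add: mean_len_def \<rho>_def)
    then show ?thesis using nN lip by (intro exI[of _ n] conjI exI[of _ L] exI[of _ "(u, y i)"] exI[of _ \<rho>]) auto
  qed
  show ?thesis by (rule exI[of _ c]) (use c main in blast)
qed

end

section \<open>A maximal inequality for symmetric random walks\<close>

text \<open>The maximum runs over all prefixes letter by letter, not only over the times at which a
  step is complete, because lamps can be lit in the middle of a step.\<close>

primrec max_norm :: "('a, 'm) monoid_scheme \<Rightarrow> 'a set \<Rightarrow> 'a \<Rightarrow> 'a list \<Rightarrow> nat" where
  "max_norm G S y [] = word_norm G S y"
| "max_norm G S y (a # w) = max (word_norm G S y) (max_norm G S (y \<otimes>\<^bsub>G\<^esub> a) w)"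

lemma word_law_add:
  "word_law \<nu> (i + j) = bind_pmf (word_law \<nu> i) (\<lambda>u. map_pmf (\<lambda>v. u @ v) (word_law \<nu> j))"
proof (induction j)
  case 0
  show ?case by (simp add: map_pmf_def bind_return_pmf bind_return_pmf')
next
  case (Suc j)
  have e: "(@) (x @ y) = (\<lambda>z. x @ y @ z)" for x y :: "'a list" by (rule ext) simp
  show ?case by (simp add: Suc bind_assoc_pmf bind_map_pmf map_bind_pmf map_pmf_comp e)
qed

lemma map_inv_word_law:
  assumes "map_pmf (\<lambda>w. rev (map f w)) \<nu> = \<nu>"
  shows "map_pmf (\<lambda>w. rev (map f w)) (word_law \<nu> n) = word_law \<nu> n"
proof (induction n)
  case (Suc n)
  let ?r = "\<lambda>w. rev (map f w)"
  have "map_pmf ?r (word_law \<nu> (Suc n))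
      = bind_pmf (word_law \<nu> n) (\<lambda>u. bind_pmf \<nu> (\<lambda>v. return_pmf (?r v @ ?r u)))"
    by (simp add: map_bind_pmf map_pmf_comp map_pmf_def bind_assoc_pmf bind_return_pmf)
  also have "\<dots> = bind_pmf \<nu> (\<lambda>v. bind_pmf (word_law \<nu> n) (\<lambda>u. return_pmf (?r v @ ?r u)))"
    by (rule bind_commute_pmf)
  also have "\<dots> = bind_pmf (map_pmf ?r \<nu>) (\<lambda>v. bind_pmf (map_pmf ?r (word_law \<nu> n)) (\<lambda>u. return_pmf (v @ u)))"
    by (simp add: bind_map_pmf)
  also have "\<dots> = bind_pmf \<nu> (\<lambda>v. map_pmf (\<lambda>u. v @ u) (word_law \<nu> n))"
    unfolding assms Suc by (simp add: map_pmf_def)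
  also have "\<dots> = word_law \<nu> (Suc n)" by (rule word_law_Suc_left[symmetric])
  finally show ?case .
qed simp

context symmetric_walk begin

abbreviation nrm :: "'a \<Rightarrow> nat" where "nrm \<equiv> word_norm G S"
abbreviation E :: "nat \<Rightarrow> ('a list \<Rightarrow> real) \<Rightarrow> real" where "E n f \<equiv> measure_pmf.expectation (word_law \<nu> n) f"

lemma fin_E: "finite (set_pmf (word_law \<nu> n))"
  by (rule finite_set_word_law[OF fin_nu])

lemma E_S: "w \<in> set_pmf (word_law \<nu> n) \<Longrightarrow> set w \<subseteq> S"
  by (rule word_law_set[OF nu_S])

lemma E_mono: "(\<And>w. set w \<subseteq> S \<Longrightarrow> w \<in> set_pmf (word_law \<nu> n) \<Longrightarrow> f w \<le> g w) \<Longrightarrow> E n f \<le> E n g"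
  by (rule pmf_expectation_mono[OF fin_E]) (simp add: E_S)

lemma E_add: "E n (\<lambda>w. f w + g w) = E n f + E n g"
  by (simp add: integrable_measure_pmf_finite[OF fin_E])

lemma E_affine: "E n (\<lambda>w. c + a * f w) = c + a * E n f"
  by (simp add: integrable_measure_pmf_finite[OF fin_E])

lemma E_sum: "E n (\<lambda>w. \<Sum>r\<in>A. f r w) = (\<Sum>r\<in>A. E n (f r))"
  by (simp add: Bochner_Integration.integral_sum integrable_measure_pmf_finite[OF fin_E])

lemma E_split: "E (i + j) f = E i (\<lambda>u. E j (\<lambda>v. f (u @ v)))"
  unfolding word_law_add by (subst expectation_bind_pmf) (use fin_E in auto)

lemma E_inv: "E n (\<lambda>w. f (rev (map (\<lambda>a. inv a) w))) = E n f"
proof -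
  have "E n (\<lambda>w. f (rev (map (\<lambda>a. inv a) w)))
      = measure_pmf.expectation (map_pmf (\<lambda>w. rev (map (\<lambda>a. inv a) w)) (word_law \<nu> n)) f" by simp
  then show ?thesis unfolding map_inv_word_law[OF nu_sym] .
qed

lemma nrm_triangle:
  assumes "g \<in> carrier G" "h \<in> carrier G"
  shows "nrm h \<le> nrm (g \<otimes> h) + nrm g" "nrm g \<le> nrm (g \<otimes> h) + nrm h"
proof -
  have "nrm (inv g \<otimes> (g \<otimes> h)) \<le> nrm g + nrm (g \<otimes> h)"
    using word_norm_mult[of "inv g" "g \<otimes> h"] assms by simp
  then show "nrm h \<le> nrm (g \<otimes> h) + nrm g" using assms by (simp add: m_assoc[symmetric])
  have "nrm (g \<otimes> h \<otimes> inv h) \<le> nrm (g \<otimes> h) + nrm h"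
    using word_norm_mult[of "g \<otimes> h" "inv h"] assms by simp
  then show "nrm g \<le> nrm (g \<otimes> h) + nrm h" using assms by (simp add: m_assoc)
qed

text \<open>If \<open>Y\<^sub>n = A Z\<close> and \<open>Z'\<close> is an independent copy of \<open>Z\<close>, then \<open>Z\<^sup>-\<^sup>1 Z'\<close> is the walk at an even time,
  and its norm is at most the sum of the norms of \<open>A Z\<close> and \<open>A Z'\<close>.\<close>

lemma tail_even:
  assumes "i \<le> n"
  shows "E (i + i) (\<lambda>w. of_bool (2 * r \<le> nrm (wprod G w))) \<le> 2 * E n (\<lambda>w. of_bool (r \<le> nrm (wprod G w)))"
proof -
  define P where "P = E (i + i) (\<lambda>w. of_bool (2 * r \<le> nrm (wprod G w)))"
  \<comment> \<open>Symmetry: the first half of the word is replaced by its reversed inverse, which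
    has the same law, so P concerns the quotient of two independent copies.\<close>
  have eq: "P = E i (\<lambda>u. E i (\<lambda>v. of_bool (2 * r \<le> nrm (wprod G (rev (map (\<lambda>a. inv a) u) @ v)))))"
    unfolding P_def E_split E_inv[of i "\<lambda>u. E i (\<lambda>v. of_bool (2 * r \<le> nrm (wprod G (u @ v))))"] ..
  \<comment> \<open>For every fixed beginning a, one of the words a u and a v has norm at least r.
    Averaging over a turns each of them into the walk at time n.\<close>
  have "P \<le> 2 * E i (\<lambda>v. of_bool (r \<le> nrm (wprod G (a @ v))))" if a: "set a \<subseteq> S" for a
  proof -
    have "P \<le> E i (\<lambda>u. E i (\<lambda>v. of_bool (r \<le> nrm (wprod G (a @ u))) + of_bool (r \<le> nrm (wprod G (a @ v)))))"
      unfolding eq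
    proof (intro E_mono)
      fix u v assume uv: "set u \<subseteq> S" "set v \<subseteq> S"
      let ?A = "wprod G a" and ?u = "wprod G u" and ?v = "wprod G v"
      have c: "?A \<in> carrier G" "?u \<in> carrier G" "?v \<in> carrier G" using a uv wprod_S by auto
      have iu: "set (rev (map (\<lambda>a. inv a) u)) \<subseteq> S" using uv inv_S by auto
      have uS: "set u \<subseteq> carrier G" using uv S_carrier by auto
      have "wprod G (rev (map (\<lambda>a. inv a) u) @ v) = inv ?u \<otimes> ?v"
        unfolding wprod_S_append[OF iu uv(2)] wprod_rev_inv[OF uS] ..
      also have "\<dots> = inv (?A \<otimes> ?u) \<otimes> (?A \<otimes> ?v)"
      proof -
        have "inv (?A \<otimes> ?u) \<otimes> (?A \<otimes> ?v) = inv ?u \<otimes> (inv ?A \<otimes> (?A \<otimes> ?v))"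
          using c by (simp add: inv_mult_group m_assoc)
        also have "inv ?A \<otimes> (?A \<otimes> ?v) = ?v" using c by (simp add: m_assoc[symmetric])
        finally show ?thesis by simp
      qed
      finally have "nrm (wprod G (rev (map (\<lambda>a. inv a) u) @ v)) \<le> nrm (wprod G (a @ u)) + nrm (wprod G (a @ v))"
        using word_norm_mult[of "inv (?A \<otimes> ?u)" "?A \<otimes> ?v"] c a uv by (simp add: wprod_S_append)
      then show "of_bool (2 * r \<le> nrm (wprod G (rev (map (\<lambda>a. inv a) u) @ v)))
        \<le> (of_bool (r \<le> nrm (wprod G (a @ u))) + of_bool (r \<le> nrm (wprod G (a @ v))) :: real)"
        by (auto simp: of_bool_def)
    qed
    also have "\<dots> = 2 * E i (\<lambda>v. of_bool (r \<le> nrm (wprod G (a @ v))))"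
      unfolding E_add by simp
    finally show ?thesis .
  qed
  then have "E (n - i) (\<lambda>_. P) \<le> E (n - i) (\<lambda>a. 2 * E i (\<lambda>v. of_bool (r \<le> nrm (wprod G (a @ v)))))"
    by (intro E_mono) blast
  also have "\<dots> = 2 * E (n - i + i) (\<lambda>w. of_bool (r \<le> nrm (wprod G w)))"
    unfolding E_split by simp
  finally show ?thesis using assms by (simp add: P_def)
qed

text \<open>An odd time is one step away from an even one, and a step changes the norm by at most
  3.\<close>

lemma tail_bound:
  assumes "j \<le> n"
  shows "E j (\<lambda>w. of_bool (2 * r + 3 \<le> nrm (wprod G w))) \<le> 2 * E n (\<lambda>w. of_bool (r \<le> nrm (wprod G w)))"
proof -
  define i where "i = j div 2"
  have i: "i \<le> n" using assms by (simp add: i_def)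
  have "E j (\<lambda>w. of_bool (2 * r + 3 \<le> nrm (wprod G w))) \<le> E (i + i) (\<lambda>w. of_bool (2 * r \<le> nrm (wprod G w)))"
  proof (cases "even j")
    case True
    then have "j = i + i" by (auto simp: i_def)
    then show ?thesis by (auto intro!: E_mono)
  next
    case False
    then have j: "j = (i + i) + 1" by (auto simp: i_def elim!: oddE)
    have "E j (\<lambda>w. of_bool (2 * r + 3 \<le> nrm (wprod G w)))
        = E (i + i) (\<lambda>u. E 1 (\<lambda>v. of_bool (2 * r + 3 \<le> nrm (wprod G (u @ v)))))"
      unfolding j by (rule E_split)
    also have "\<dots> \<le> E (i + i) (\<lambda>u. E 1 (\<lambda>v. of_bool (2 * r \<le> nrm (wprod G u))))"
    proof (intro E_mono)
      fix u v assume u: "set u \<subseteq> S" and v: "set v \<subseteq> S" "v \<in> set_pmf (word_law \<nu> 1)"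
      have "length v \<le> 3" using word_law_length[OF nu_len v(2)] by simp
      then have "nrm (wprod G v) \<le> 3" using word_norm_le[OF v(1), of G] by linarith
      then have "nrm (wprod G (u @ v)) \<le> nrm (wprod G u) + 3"
        using word_norm_mult[OF wprod_S[OF u] wprod_S[OF v(1)]] by (simp add: wprod_S_append u v(1))
      then show "of_bool (2 * r + 3 \<le> nrm (wprod G (u @ v))) \<le> (of_bool (2 * r \<le> nrm (wprod G u)) :: real)"
        by (auto simp: of_bool_def)
    qed
    finally show ?thesis by simp
  qed
  then show ?thesis using tail_even[OF i, of r] by linarith
qed

lemma max_norm_append:
  assumes "y \<in> carrier G" "set u \<subseteq> S" "set v \<subseteq> S"
  shows "max_norm G S y (u @ v) \<le> max (nrm y + length u) (max_norm G S (y \<otimes> wprod G u) v)"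
  using assms(1,2)
proof (induction u arbitrary: y)
  case Nil
  then show ?case by simp
next
  case (Cons a u)
  have a: "a \<in> carrier G" "a \<in> S" "set u \<subseteq> S" using Cons.prems S_carrier by auto
  have "nrm a \<le> 1" using word_norm_le[of "[a]" S G] a by simp
  then have "nrm (y \<otimes> a) \<le> nrm y + 1" using word_norm_mult[OF Cons.prems(1) a(1)] by linarith
  moreover have "y \<otimes> a \<otimes> wprod G u = y \<otimes> wprod G (a # u)"
    using Cons.prems(1) a wprod_S by (simp add: m_assoc)
  ultimately show ?case using Cons.IH[of "y \<otimes> a"] Cons.prems a by auto
qed

text \<open>Etemadi's inequality, by induction on the number of remaining steps in place of a
  stopping time. From a point of norm at least 3r + 3 either the walk ends at norm r or more, or the
  remaining increment is at least 2r + 3. Below that norm the first step cannot yet reach 3r + 6, so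
  it can be split off.\<close>

lemma etemadi:
  assumes T: "\<And>j. j \<le> n \<Longrightarrow> E j (\<lambda>w. of_bool (2 * r + 3 \<le> nrm (wprod G w))) \<le> T"
    and y: "y \<in> carrier G"
  shows "E n (\<lambda>w. of_bool (3 * r + 6 \<le> max_norm G S y w)) \<le> E n (\<lambda>w. of_bool (r \<le> nrm (y \<otimes> wprod G w))) + T"
  using assms
proof (induction n arbitrary: y)
  case 0
  have "0 \<le> T" using "0.prems"(1)[of 0] by (auto simp: of_bool_def split: if_splits)
  then show ?case using "0.prems" by (auto simp: of_bool_def)
next
  case (Suc n)
  show ?case
  proof (cases "3 * r + 3 \<le> nrm y")
    case True
    have "E (Suc n) (\<lambda>w. of_bool (3 * r + 6 \<le> max_norm G S y w)) \<le> E (Suc n) (\<lambda>w.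
        of_bool (r \<le> nrm (y \<otimes> wprod G w)) + of_bool (2 * r + 3 \<le> nrm (wprod G w)))"
    proof (rule E_mono)
      fix w assume "set w \<subseteq> S"
      from nrm_triangle(2)[OF Suc.prems(2) wprod_S[OF this]]
      have "r \<le> nrm (y \<otimes> wprod G w) \<or> 2 * r + 3 \<le> nrm (wprod G w)" using True by linarith
      then show "of_bool (3 * r + 6 \<le> max_norm G S y w) \<le>
        (of_bool (r \<le> nrm (y \<otimes> wprod G w)) + of_bool (2 * r + 3 \<le> nrm (wprod G w)) :: real)"
        by (auto simp: of_bool_def)
    qed
    also have "\<dots> \<le> E (Suc n) (\<lambda>w. of_bool (r \<le> nrm (y \<otimes> wprod G w))) + T"
      unfolding E_add using Suc.prems(1)[of "Suc n"] by simp
    finally show ?thesis .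
  next
    case False
    have "E (1 + n) (\<lambda>w. of_bool (3 * r + 6 \<le> max_norm G S y w))
        \<le> E 1 (\<lambda>u. E n (\<lambda>v. of_bool (3 * r + 6 \<le> max_norm G S (y \<otimes> wprod G u) v)))"
      unfolding E_split
    proof (intro E_mono)
      fix u v assume u: "set u \<subseteq> S" "u \<in> set_pmf (word_law \<nu> 1)" and v: "set v \<subseteq> S"
      have "length u \<le> 3" using word_law_length[OF nu_len u(2)] by simp
      then have "3 * r + 6 \<le> max_norm G S (y \<otimes> wprod G u) v" if "3 * r + 6 \<le> max_norm G S y (u @ v)"
        using max_norm_append[OF Suc.prems(2) u(1) v] False that by linarith
      then show "of_bool (3 * r + 6 \<le> max_norm G S y (u @ v)) \<le>
         (of_bool (3 * r + 6 \<le> max_norm G S (y \<otimes> wprod G u) v) :: real)"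
        by (auto simp: of_bool_def)
    qed
    also have "\<dots> \<le> E 1 (\<lambda>u. E n (\<lambda>v. of_bool (r \<le> nrm (y \<otimes> wprod G u \<otimes> wprod G v))) + T)"
    proof (rule E_mono)
      fix u assume u: "set u \<subseteq> S"
      show "E n (\<lambda>v. of_bool (3 * r + 6 \<le> max_norm G S (y \<otimes> wprod G u) v))
        \<le> E n (\<lambda>v. of_bool (r \<le> nrm (y \<otimes> wprod G u \<otimes> wprod G v))) + T"
        by (rule Suc.IH) (use Suc.prems u wprod_S in auto)
    qed
    also have "\<dots> = E 1 (\<lambda>u. E n (\<lambda>v. of_bool (r \<le> nrm (y \<otimes> wprod G u \<otimes> wprod G v)))) + T"
      unfolding E_add by simp
    also have "\<dots> = E 1 (\<lambda>u. E n (\<lambda>v. of_bool (r \<le> nrm (y \<otimes> wprod G (u @ v))))) + T"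
    proof -
      have "E 1 (\<lambda>u. E n (\<lambda>v. of_bool (r \<le> nrm (y \<otimes> wprod G u \<otimes> wprod G v))))
        = E 1 (\<lambda>u. E n (\<lambda>v. of_bool (r \<le> nrm (y \<otimes> wprod G (u @ v)))))"
      proof (rule pmf_expectation_cong, rule pmf_expectation_cong)
        fix u v assume "u \<in> set_pmf (word_law \<nu> 1)" "v \<in> set_pmf (word_law \<nu> n)"
        then have uv: "set u \<subseteq> S" "set v \<subseteq> S" using E_S by blast+
        then have "y \<otimes> wprod G u \<otimes> wprod G v = y \<otimes> wprod G (u @ v)"
          using Suc.prems(2) wprod_S by (simp add: wprod_S_append m_assoc)
        then show "of_bool (r \<le> nrm (y \<otimes> wprod G u \<otimes> wprod G v)) = (of_bool (r \<le> nrm (y \<otimes> wprod G (u @ v))) :: real)"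
          by simp
      qed
      then show ?thesis by simp
    qed
    also have "\<dots> = E (1 + n) (\<lambda>w. of_bool (r \<le> nrm (y \<otimes> wprod G w))) + T"
      unfolding E_split ..
    finally show ?thesis by simp
  qed
qed

lemma max_norm_length: "y \<in> carrier G \<Longrightarrow> set w \<subseteq> S \<Longrightarrow> max_norm G S y w \<le> nrm y + length w"
proof (induction w arbitrary: y)
  case (Cons a w)
  have a: "a \<in> carrier G" "a \<in> S" "set w \<subseteq> S" using Cons.prems S_carrier by auto
  have "nrm a \<le> 1" using word_norm_le[of "[a]" S G] a by simp
  then have "nrm (y \<otimes> a) \<le> nrm y + 1" using word_norm_mult[OF Cons.prems(1) a(1)] by linarith
  then show ?case using Cons.IH[of "y \<otimes> a"] Cons.prems a by auto
qed simp

lemma le_count_thirds: "m \<le> 3 * card {r \<in> {1..B}. 3 * r + 6 \<le> m} + 8" if "m \<le> (B :: nat)"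
proof (cases "m \<le> 8")
  case False
  have "{1..(m - 6) div 3} \<subseteq> {r \<in> {1..B}. 3 * r + 6 \<le> m}" using that False by auto
  then have "card {1..(m - 6) div 3} \<le> card {r \<in> {1..B}. 3 * r + 6 \<le> m}" by (intro card_mono) auto
  then have "(m - 6) div 3 \<le> card {r \<in> {1..B}. 3 * r + 6 \<le> m}" by simp
  then show ?thesis using False by linarith
qed simp

text \<open>Summation of the tail estimates over r. The thresholds 3r + 6 recover a number up to a
  factor 3 and an error 8, and each tail is bounded by one plus two tails of the final norm, hence 9
  as 3 times 3.\<close>

lemma expected_max_norm:
  "E n (\<lambda>w. real (max_norm G S \<one> w)) \<le> 8 + 9 * E n (\<lambda>w. real (nrm (wprod G w)))"
proof -
  define B where "B = 3 * n"
  have sum_card: "(\<Sum>r = 1..B. of_bool (Q r)) = real (card {r \<in> {1..B}. Q r})" for Q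
    by (simp add: of_bool_def sum.If_cases Int_def)
  have "E n (\<lambda>w. real (max_norm G S \<one> w)) \<le> E n (\<lambda>w. 8 + 3 * (\<Sum>r = 1..B. of_bool (3 * r + 6 \<le> max_norm G S \<one> w)))"
  proof (rule E_mono)
    fix w assume w: "set w \<subseteq> S" "w \<in> set_pmf (word_law \<nu> n)"
    have "max_norm G S \<one> w \<le> B"
      using max_norm_length[OF one_closed w(1)] word_law_length[OF nu_len w(2)] by (simp add: B_def)
    from le_count_thirds[OF this]
    show "real (max_norm G S \<one> w) \<le> 8 + 3 * (\<Sum>r = 1..B. of_bool (3 * r + 6 \<le> max_norm G S \<one> w))"
      unfolding sum_card by linarith
  qed
  also have "\<dots> = 8 + 3 * (\<Sum>r = 1..B. E n (\<lambda>w. of_bool (3 * r + 6 \<le> max_norm G S \<one> w)))"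
    unfolding E_affine E_sum ..
  also have "(\<Sum>r = 1..B. E n (\<lambda>w. of_bool (3 * r + 6 \<le> max_norm G S \<one> w)))
      \<le> (\<Sum>r = 1..B. 3 * E n (\<lambda>w. of_bool (r \<le> nrm (wprod G w))))"
  proof (rule sum_mono)
    fix r
    have "E n (\<lambda>w. of_bool (3 * r + 6 \<le> max_norm G S \<one> w)) \<le> E n (\<lambda>w. of_bool (r \<le> nrm (\<one> \<otimes> wprod G w)))
        + 2 * E n (\<lambda>w. of_bool (r \<le> nrm (wprod G w)))"
      by (rule etemadi[OF tail_bound one_closed])
    also have "E n (\<lambda>w. of_bool (r \<le> nrm (\<one> \<otimes> wprod G w))) = E n (\<lambda>w. of_bool (r \<le> nrm (wprod G w)))"
      by (rule pmf_expectation_cong) (use E_S wprod_S in auto)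
    finally show "E n (\<lambda>w. of_bool (3 * r + 6 \<le> max_norm G S \<one> w)) \<le> 3 * E n (\<lambda>w. of_bool (r \<le> nrm (wprod G w)))"
      by simp
  qed
  also have "(\<Sum>r = 1..B. 3 * E n (\<lambda>w. of_bool (r \<le> nrm (wprod G w))))
      = 3 * E n (\<lambda>w. \<Sum>r = 1..B. of_bool (r \<le> nrm (wprod G w)))"
    unfolding E_sum by (simp only: sum_distrib_left)
  also have "E n (\<lambda>w. \<Sum>r = 1..B. of_bool (r \<le> nrm (wprod G w))) \<le> E n (\<lambda>w. real (nrm (wprod G w)))"
  proof (rule E_mono)
    fix w
    have "card {r \<in> {1..B}. r \<le> nrm (wprod G w)} \<le> card {1..nrm (wprod G w)}" by (intro card_mono) auto
    then show "(\<Sum>r = 1..B. of_bool (r \<le> nrm (wprod G w))) \<le> real (nrm (wprod G w))" unfolding sum_card by simp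
  qed
  finally show ?thesis by simp
qed

end

section \<open>The virtually abelian case\<close>

definition bool_grp :: "bool monoid" where
  "bool_grp = \<lparr>carrier = UNIV, mult = (\<noteq>), one = False\<rparr>"

lemma bool_grp_simps [simp]:
  "carrier bool_grp = UNIV" "a \<otimes>\<^bsub>bool_grp\<^esub> b \<longleftrightarrow> a \<noteq> b" "\<one>\<^bsub>bool_grp\<^esub> \<longleftrightarrow> False"
  by (auto simp: bool_grp_def)

lemma group_bool_grp: "group bool_grp"
  by (rule groupI) (auto simp: bool_grp_def)

text \<open>The conditions on the tree and on H do not involve the lamp group, so the whole
  construction is available with lamps in \<int>/2.\<close>

lemma (in saturated) saturated_bool: "saturated d bool_grp H"
proof (rule saturated.intro)
  show "group bool_grp" by (rule group_bool_grp)
  show "finite (carrier bool_grp)" by simp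
qed (fact d_ge2 H_sub H_fin H_Hd H_unif)+

definition tail_of :: "nat \<Rightarrow> (nat \<Rightarrow> nat) \<Rightarrow> nat \<Rightarrow> nat" where
  "tail_of k x = (\<lambda>j. x (j + k))"

definition swap12 :: "(nat \<Rightarrow> nat) \<Rightarrow> nat \<Rightarrow> nat" where
  "swap12 y = y(0 := Transposition.transpose 1 2 (y 0))"

lemma swap12_swap12 [simp]: "swap12 (swap12 y) = y"
  by (rule ext) (simp add: swap12_def)

text \<open>A word acts letter by letter from the left, so a lamp letter inserted after the prefix \<open>q1\<close>
  lights the lamp at the point which \<open>q1\<close> carries to \<open>1\<^sup>\<infinity>\<close>: the lamps a word can light are those at
  its inverted orbit.\<close>

definition visits :: "(nat list \<Rightarrow> nat list) list \<Rightarrow> (nat \<Rightarrow> nat) \<Rightarrow> bool" where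
  "visits q x \<longleftrightarrow> (\<exists>q1 q2. q = q1 @ q2 \<and> run aut_bd q1 x = ones_ray)"

lemma visits_Nil: "visits [] x \<longleftrightarrow> x = ones_ray"
  by (simp add: visits_def)

lemma visits_Cons: "visits (g # q) x \<longleftrightarrow> x = ones_ray \<or> visits q (aut_bd g x)"
proof
  assume "visits (g # q) x"
  then obtain q1 q2 where "g # q = q1 @ q2" "run aut_bd q1 x = ones_ray" unfolding visits_def by blast
  then show "x = ones_ray \<or> visits q (aut_bd g x)"
    unfolding visits_def by (cases q1) auto
next
  assume "x = ones_ray \<or> visits q (aut_bd g x)"
  then show "visits (g # q) x"
  proof
    assume "x = ones_ray"
    then show ?thesis unfolding visits_def by (intro exI[of _ "[]"] exI[of _ "g # q"]) simp
  next
    assume "visits q (aut_bd g x)"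
    then obtain q1 q2 where "q = q1 @ q2" "run aut_bd q1 (aut_bd g x) = ones_ray" unfolding visits_def by blast
    then show ?thesis unfolding visits_def by (intro exI[of _ "g # q1"] exI[of _ q2]) simp
  qed
qed

lemma visits_ones: "visits q ones_ray"
  by (cases q) (simp_all add: visits_Nil visits_Cons)

lemma visits_append: "visits (q1 @ q2) x \<longleftrightarrow> visits q1 x \<or> visits q2 (run aut_bd q1 x)"
proof (induction q1 arbitrary: x)
  case Nil
  show ?case using visits_ones[of q2] by (auto simp: visits_Nil)
next
  case (Cons g q1)
  then show ?case by (simp add: visits_Cons)
qed

section \<open>Rigid paths between vertices of level k and a loop at 1^k\<close>

context saturated begin

definition letters :: "(nat list \<Rightarrow> nat list) set" where
  "letters = rooted_aut d ` {\<tau>. \<tau> permutes {1..d 0}} \<union> H"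

lemma letters_Sigma:
  assumes "g \<in> letters" shows "(lamp F d \<one>\<^bsub>F\<^esub>, g) \<in> \<Sigma>"
  using assms
  unfolding letters_def
proof (elim UnE imageE)
  assume "g \<in> H"
  then show ?thesis by (intro HF_Sigma HF_I) simp_all
next
  fix \<tau> assume "g = rooted_aut d \<tau>" "\<tau> \<in> {\<tau>. \<tau> permutes {1..d 0}}"
  then show ?thesis by (intro R_Sigma) (simp add: R_alt)
qed

lemma snd_Sigma: "a \<in> \<Sigma> \<Longrightarrow> snd a \<in> letters"
  by (erule Sigma_cases) (auto simp: letters_def)

lemma letters_aut: "g \<in> letters \<Longrightarrow> g \<in> tree_aut d"
  using Sigma_aut[OF letters_Sigma] by simp

lemma letters_inv:
  assumes "g \<in> letters" shows "\<exists>g'\<in>letters. g' \<circ> g = id"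
proof -
  let ?a = "(lamp F d \<one>\<^bsub>F\<^esub>, g)"
  have a: "?a \<in> \<Sigma>" "?a \<in> carrier W" using letters_Sigma[OF assms] Sigma_carrier by auto
  have "snd (inv\<^bsub>W\<^esub> ?a) \<circ> g = id" using snd_inv[OF a(2)] by (auto simp: fun_eq_iff)
  then show ?thesis using snd_Sigma[OF Sigma_inv[OF a(1)]] by blast
qed

lemma run_bd_closed: "set q \<subseteq> letters \<Longrightarrow> x \<in> tree_boundary d \<Longrightarrow> run aut_bd q x \<in> tree_boundary d"
  by (induction q arbitrary: x) (auto simp: aut_bd_closed letters_aut)

lemma run_bd_wprod: "set w \<subseteq> \<Sigma> \<Longrightarrow> x \<in> tree_boundary d \<Longrightarrow>
    run aut_bd (map snd w) x = aut_bd (snd (wprod W w)) x"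
proof (induction w arbitrary: x)
  case Nil
  have "aut_bd (snd \<one>\<^bsub>W\<^esub>) x = aut_bd id x" by (simp only: wreath_one snd_conv)
  then show ?case by (simp only: list.map run_Nil wprod_Nil aut_bd_id)
next
  case (Cons a w)
  have aw: "a \<in> \<Sigma>" "set w \<subseteq> \<Sigma>" using Cons.prems by auto
  have "aut_bd (snd (wprod W (a # w))) x = aut_bd (snd (wprod W w)) (aut_bd (snd a) x)"
    unfolding wprod_Cons snd_wreath_mult
    by (rule aut_bd_comp[OF Sigma_aut[OF aw(1)] wprod_aut[OF aw(2)] Cons.prems(2)])
  then show ?case using Cons.IH[OF aw(2) aut_bd_closed[OF Sigma_aut[OF aw(1)] Cons.prems(2)]] by simp
qed

lemma letters_reverse:
  assumes "set q \<subseteq> letters"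
  shows "\<exists>q'. set q' \<subseteq> letters \<and> (\<forall>x\<in>tree_boundary d. run aut_bd q' (run aut_bd q x) = x)"
  using assms
proof (induction q)
  case Nil
  then show ?case by (intro exI[of _ "[]"]) simp
next
  case (Cons g q)
  then obtain q' where q': "set q' \<subseteq> letters" "\<And>x. x \<in> tree_boundary d \<Longrightarrow> run aut_bd q' (run aut_bd q x) = x" by auto
  obtain g' where g': "g' \<in> letters" "g' \<circ> g = id" using letters_inv[of g] Cons.prems by auto
  have g: "g \<in> tree_aut d" using letters_aut Cons.prems by simp
  have "aut_bd g' (aut_bd g x) = x" if "x \<in> tree_boundary d" for x
    using aut_bd_comp[OF g letters_aut[OF g'(1)] that] g'(2) by simp
  then show ?case using q' g' g
    by (intro exI[of _ "q' @ [g']"]) (simp add: aut_bd_closed)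
qed

lemma aut_bd_label:
  assumes g: "g \<in> tree_aut d" and x: "x \<in> tree_boundary d"
  shows "aut_bd g x j = aut_label d g (prefix_of x j) (x j)"
proof -
  have V: "prefix_of x j @ [x j] \<in> tree_vertices d" using prefix_tree_vertices[OF x, of "Suc j"] by simp
  have "aut_bd g x j = (g (prefix_of x j @ [x j])) ! j" by (simp add: aut_bd_def)
  also have "\<dots> = (g (prefix_of x j) @ [aut_label d g (prefix_of x j) (x j)]) ! j"
    unfolding tree_aut_append[OF g V] ..
  finally show ?thesis using tree_autD(2)[OF g prefix_tree_vertices[OF x], of j] by (simp add: nth_append)
qed

lemma special_label_surj:
  assumes v: "v \<in> level k" "special_vertex v" and p: "p permutes {1..d k}"
  obtains h where "h \<in> H" "aut_label d h v = p"
proof -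
  obtain m t where mt: "v = replicate m 1 @ [t]" "t \<noteq> 1" using v(2) by (auto simp: special_vertex_alt)
  have k: "k = Suc m" using v(1) mt by (simp add: level_def)
  have "replicate m 1 @ [t] \<in> tree_vertices d" using v(1) mt by (simp add: level_def)
  then have t: "2 \<le> t" "t \<le> d (k - 1)" using mt(2) k by (auto simp: snoc_tree_vertices)
  have "finite {p. p permutes {1..d k}}" "{p. p permutes {1..d k}} \<noteq> {}"
    using finite_permutations[of "{1..d k}"] permutes_id by blast+
  then have "set_pmf (pmf_of_set {p. p permutes {1..d k}}) = {p. p permutes {1..d k}}" by (rule set_pmf_of_set[rotated])
  moreover have "H \<noteq> {}" using H_id by blast
  then have "set_pmf (pmf_of_set H) = H" using H_fin by (intro set_pmf_of_set)
  moreover have "set_pmf (map_pmf (\<lambda>h. aut_label d h v) (pmf_of_set H)) = set_pmf (pmf_of_set {p. p permutes {1..d k}})"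
    using H_unif[of k t] t k mt(1) by simp
  ultimately have "(\<lambda>h. aut_label d h v) ` H = {p. p permutes {1..d k}}" by simp
  then have "p \<in> (\<lambda>h. aut_label d h v) ` H" using p by simp
  then show ?thesis using that by (elim imageE) simp
qed

lemma prefix_split: "prefix_of x (k + n) = prefix_of x k @ prefix_of (tail_of k x) n"
  by (rule nth_equalityI) (auto simp: nth_append tail_of_def)

lemma H_tail:
  assumes h: "h \<in> H" and x: "x \<in> tree_boundary d" "prefix_of x k = replicate k 1"
  shows "prefix_of (aut_bd h x) k = replicate k 1" "tail_of k (aut_bd h x) = aut_bd (sec k h) (tail_of k x)"
proof -
  show "prefix_of (aut_bd h x) k = replicate k 1"
    unfolding prefix_aut_bd[OF H_aut[OF h] x(1)] x(2) using h by simp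
  show "tail_of k (aut_bd h x) = aut_bd (sec k h) (tail_of k x)"
  proof
    fix j
    have "tail_of k (aut_bd h x) j = h (prefix_of x (k + Suc j)) ! (k + j)"
      by (simp add: tail_of_def aut_bd_def add.commute del: upt_Suc)
    also have "h (prefix_of x (k + Suc j)) = replicate k 1 @ sec k h (prefix_of (tail_of k x) (Suc j))"
      unfolding prefix_split x(2) by (rule H_sec[OF h])
    finally show "tail_of k (aut_bd h x) j = aut_bd (sec k h) (tail_of k x) j"
      by (simp add: aut_bd_def nth_append del: upt_Suc)
  qed
qed

text \<open>Some word carries the whole subtree below u onto the one below v by the obvious
  identification.\<close>

definition trivial_path :: "nat \<Rightarrow> nat list \<Rightarrow> nat list \<Rightarrow> bool" where
  "trivial_path k u v \<longleftrightarrow> (\<exists>q. set q \<subseteq> letters \<and> (\<forall>x\<in>tree_boundary d. prefix_of x k = u \<longrightarrow>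
      prefix_of (run aut_bd q x) k = v \<and> tail_of k (run aut_bd q x) = tail_of k x))"

lemma trivial_path_refl: "trivial_path k u u"
  unfolding trivial_path_def by (rule exI[of _ "[]"]) simp

lemma trivial_path_step:
  assumes uv: "trivial_path k u v" and g: "g \<in> letters" and v: "v \<in> level k"
    and triv: "g \<in> H \<Longrightarrow> v \<noteq> replicate k 1 \<and> \<not> special_vertex v" and k: "1 \<le> k"
  shows "trivial_path k u (g v)"
proof -
  obtain q where q: "set q \<subseteq> letters" "\<And>x. x \<in> tree_boundary d \<Longrightarrow> prefix_of x k = u \<Longrightarrow>
      prefix_of (run aut_bd q x) k = v \<and> tail_of k (run aut_bd q x) = tail_of k x"
    using uv unfolding trivial_path_def by blast
  have step: "prefix_of (aut_bd g y) k = g v \<and> tail_of k (aut_bd g y) = tail_of k y"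
    if y: "y \<in> tree_boundary d" "prefix_of y k = v" for y
  proof
    show "prefix_of (aut_bd g y) k = g v" unfolding prefix_aut_bd[OF letters_aut[OF g] y(1)] y(2) ..
    show "tail_of k (aut_bd g y) = tail_of k y"
    proof
      fix j
      have V: "prefix_of y (k + j) \<in> tree_vertices d" "prefix_of y (k + j) \<noteq> []"
        using prefix_tree_vertices[OF y(1)] k by auto
      have "aut_label d g (prefix_of y (k + j)) = id"
      proof (cases "g \<in> H")
        case True
        note t = triv[OF True]
        have "\<not> special_vertex (prefix_of y (k + j))"
        proof
          assume sp: "special_vertex (prefix_of y (k + j))"
          show False
          proof (cases "j = 0")
            case True
            then show False using sp t y(2) by simp
          next
            case False
            have "v = replicate k 1"
            proof (rule nth_equalityI)
              show "length v = length (replicate k (1 :: nat))" using v by (simp add: level_def)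
              fix i assume "i < length v"
              then have i: "i < k" using v by (simp add: level_def)
              have "v ! i = prefix_of y (k + j) ! i" using i y(2)[symmetric] by simp
              also have "\<dots> = 1" using sp i False unfolding special_vertex_def by simp
              finally show "v ! i = replicate k 1 ! i" using i by simp
            qed
            then show False using t by blast
          qed
        qed
        then show ?thesis using H_label[OF True V(1)] by blast
      next
        case False
        then obtain \<tau> where "g = rooted_aut d \<tau>" using g by (auto simp: letters_def)
        then show ?thesis using rooted_aut_label[OF V(2,1)] by simp
      qed
      then show "tail_of k (aut_bd g y) j = tail_of k y j"
        using aut_bd_label[OF letters_aut[OF g] y(1), of "k + j"] by (simp add: tail_of_def add.commute)
    qed
  qed
  have "prefix_of (run aut_bd (q @ [g]) x) k = g v \<and> tail_of k (run aut_bd (q @ [g]) x) = tail_of k x"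
    if x: "x \<in> tree_boundary d" "prefix_of x k = u" for x
    using step[OF run_bd_closed[OF q(1) x(1)]] q(2)[OF x] by simp
  then show ?thesis unfolding trivial_path_def using q(1) g by (intro exI[of _ "q @ [g]"]) simp
qed

text \<open>Along a path from 1^k to a special vertex, letters of H met at 1^k are omitted: they fix
  this vertex but could change the tail. The path is cut off at its first special vertex, before
  which no remaining letter touches the tail.\<close>

lemma special_by_trivial_path_aux:
  assumes k: "1 \<le> k"
  shows "set w \<subseteq> \<Sigma> \<Longrightarrow> u \<in> level k \<Longrightarrow> trivial_path k (replicate k 1) u \<Longrightarrow> special_vertex (snd (wprod W w) u) \<Longrightarrow>
    \<exists>v\<in>level k. special_vertex v \<and> trivial_path k (replicate k 1) v"
proof (induction w arbitrary: u)
  case Nil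
  then show ?case by (auto simp: wreath_one)
next
  case (Cons a w)
  have a: "a \<in> \<Sigma>" "set w \<subseteq> \<Sigma>" using Cons.prems(1) by auto
  note lev = level_aut[OF Sigma_aut[OF a(1)] Cons.prems(2)]
  have sp: "special_vertex (snd (wprod W w) (snd a u))" using Cons.prems(4) by (simp add: snd_wreath_mult)
  consider "special_vertex u" | "snd a \<in> H" "u = replicate k 1" | "snd a \<in> H \<Longrightarrow> u \<noteq> replicate k 1 \<and> \<not> special_vertex u"
    by blast
  then show ?case
  proof cases
    case 1
    then show ?thesis using Cons.prems by blast
  next
    case 2
    then have "snd a u = u" using H_ones[OF 2(1), of k] by simp
    then show ?thesis using Cons.IH[OF a(2) Cons.prems(2,3)] sp by simp
  next
    case 3
    have "trivial_path k (replicate k 1) (snd a u)"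
      by (rule trivial_path_step[OF Cons.prems(3) snd_Sigma[OF a(1)] Cons.prems(2) 3 k])
    then show ?thesis using Cons.IH[OF a(2) lev _ sp] by blast
  qed
qed

lemma special_by_trivial_path:
  assumes k: "1 \<le> k"
  shows "\<exists>v\<in>level k. special_vertex v \<and> trivial_path k (replicate k 1) v"
proof -
  define p where "p = replicate (k - 1) 1 @ [2 :: nat]"
  have "replicate (k - 1) (Suc 0) @ [2] \<in> tree_vertices d"
    using d_ge2[of "k - 1"] by (simp add: snoc_tree_vertices)
  then have p: "p \<in> level k" "special_vertex p" using k by (auto simp: p_def level_def special_vertex_alt)
  have o: "replicate k 1 \<in> level k" by (simp add: level_def)
  obtain w where "set w \<subseteq> \<Sigma>" "snd (wprod W w) (replicate k 1) = p"
    using reach_level[OF o p(1)] unfolding reach_def by blast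
  then show ?thesis using special_by_trivial_path_aux[OF k _ o trivial_path_refl] p(2) by blast
qed

text \<open>A conjugate: a rigid path leads to a special vertex, an element of H acts whose label
  there is the transposition of the two children, and the path is traced back. Labels below the
  special vertex are trivial, so later entries of the tail are unchanged.\<close>

lemma swap_loop:
  assumes k: "1 \<le> k" and dk: "d k = 2"
  shows "\<exists>q. set q \<subseteq> letters \<and> (\<forall>x\<in>tree_boundary d. prefix_of x k = replicate k 1 \<longrightarrow>
     prefix_of (run aut_bd q x) k = replicate k 1 \<and> tail_of k (run aut_bd q x) = swap12 (tail_of k x))"
proof -
  obtain v where v: "v \<in> level k" "special_vertex v" "trivial_path k (replicate k 1) v"
    using special_by_trivial_path[OF k] by blast
  obtain q where q: "set q \<subseteq> letters" "\<And>x. x \<in> tree_boundary d \<Longrightarrow> prefix_of x k = replicate k 1 \<Longrightarrow>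
      prefix_of (run aut_bd q x) k = v \<and> tail_of k (run aut_bd q x) = tail_of k x"
    using v(3) unfolding trivial_path_def by blast
  obtain q' where q': "set q' \<subseteq> letters" "\<And>x. x \<in> tree_boundary d \<Longrightarrow> run aut_bd q' (run aut_bd q x) = x"
    using letters_reverse[OF q(1)] by blast
  have "Transposition.transpose 1 2 permutes {1..d k}" unfolding dk by (rule permutes_swap_id) auto
  then obtain h where h: "h \<in> H" "aut_label d h v = Transposition.transpose 1 2"
    using special_label_surj[OF v(1,2)] by blast
  have hl: "h \<in> letters" using h(1) by (simp add: letters_def)
  have main: "prefix_of (run aut_bd (q @ [h] @ q') x) k = replicate k 1 \<and>
      tail_of k (run aut_bd (q @ [h] @ q') x) = swap12 (tail_of k x)"
    if x: "x \<in> tree_boundary d" "prefix_of x k = replicate k 1" for x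
  proof -
    define z where "z j = (if j = k then Transposition.transpose 1 2 (x k) else x j)" for j
    have xk: "1 \<le> x k" "x k \<le> 2" using x(1) dk by (auto simp: tree_boundary_def dest!: spec[of _ k])
    have z: "z \<in> tree_boundary d"
      using x(1) xk dk by (auto simp: z_def tree_boundary_def Transposition.transpose_def)
    have "prefix_of z k = prefix_of x k" by (simp add: z_def)
    then have zk: "prefix_of z k = replicate k 1" unfolding x(2) .
    have zt: "tail_of k z = swap12 (tail_of k x)" by (rule ext) (simp add: z_def tail_of_def swap12_def)
    define y where "y = run aut_bd q x"
    have y: "y \<in> tree_boundary d" "prefix_of y k = v" "tail_of k y = tail_of k x"
      using q(2)[OF x] run_bd_closed[OF q(1) x(1)] by (auto simp: y_def)
    have "aut_bd h y = run aut_bd q z"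
    proof (rule prefix_of_eqI)
      have 1: "prefix_of (aut_bd h y) k = prefix_of (run aut_bd q z) k"
        using prefix_aut_bd[OF H_aut[OF h(1)] y(1), of k] y(2) H_special_fix[OF h(1) _ v(2)] v(1) q(2)[OF z zk]
        by (simp add: level_def)
      have 2: "tail_of k (aut_bd h y) = tail_of k (run aut_bd q z)"
      proof
        fix j
        have "tail_of k (aut_bd h y) j = aut_label d h (prefix_of y (k + j)) (y (k + j))"
          using aut_bd_label[OF H_aut[OF h(1)] y(1), of "k + j"] by (simp add: tail_of_def add.commute)
        also have "\<dots> = swap12 (tail_of k x) j"
        proof (cases "j = 0")
          case True
          have "y k = x k" using fun_cong[OF y(3), of 0] by (simp add: tail_of_def)
          then show ?thesis using True y(2) h(2) by (simp add: swap12_def tail_of_def)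
        next
          case False
          have "\<not> special_vertex (prefix_of y (k + j))"
          proof
            assume sp: "special_vertex (prefix_of y (k + j))"
            have "last v = v ! (k - 1)" using v(1) k by (subst last_conv_nth) (auto simp: level_def)
            also have "\<dots> = prefix_of y (k + j) ! (k - 1)" using y(2)[symmetric] k by simp
            also have "\<dots> = 1" using sp k False unfolding special_vertex_def by simp
            finally show False using v(2) by (simp add: special_vertex_def)
          qed
          then have "aut_label d h (prefix_of y (k + j)) = id"
            using H_label[OF h(1) prefix_tree_vertices[OF y(1)]] by blast
          moreover have "y (k + j) = x (k + j)" using fun_cong[OF y(3), of j] by (simp add: tail_of_def add.commute)
          ultimately show ?thesis using False by (simp add: swap12_def tail_of_def add.commute)
        qed
        also have "\<dots> = tail_of k (run aut_bd q z) j" using q(2)[OF z zk] zt by simp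
        finally show "tail_of k (aut_bd h y) j = tail_of k (run aut_bd q z) j" .
      qed
      fix n
      have "prefix_of (aut_bd h y) (k + n) = prefix_of (run aut_bd q z) (k + n)"
        unfolding prefix_split 1 2 ..
      then show "prefix_of (aut_bd h y) n = prefix_of (run aut_bd q z) n" by auto
    qed
    then have "run aut_bd (q @ [h] @ q') x = z" using q'(2)[OF z] by (simp add: y_def)
    then show ?thesis using zk zt by simp
  qed
  show ?thesis
    by (rule exI[of _ "q @ [h] @ q'"]) (use main q(1) q'(1) hl in simp)
qed

end

section \<open>Tails on a half-line when K_k has at most two elements\<close>

locale degenerate = saturated d F H
  for d :: "nat \<Rightarrow> nat" and F :: "('f, 'm) monoid_scheme" and H :: "(nat list \<Rightarrow> nat list) set" +
  fixes k :: nat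
  assumes k: "1 \<le> k" and dk: "d k = 2" and F_trivial: "carrier F = {\<one>\<^bsub>F\<^esub>}" and sec2: "card (sec k ` H) \<le> 2"
begin

sublocale L: saturated d bool_grp H by (rule saturated_bool)

abbreviation "WB \<equiv> wreath bool_grp d"
abbreviation "SB \<equiv> Sigma_set bool_grp d H"
abbreviation "GB \<equiv> Gamma_grp bool_grp d H"
abbreviation lift :: "(nat list \<Rightarrow> nat list) \<Rightarrow> ((nat \<Rightarrow> nat) \<Rightarrow> bool) \<times> (nat list \<Rightarrow> nat list)" where
  "lift g \<equiv> (lamp bool_grp d False, g)"
abbreviation drop_lamps :: "((nat \<Rightarrow> nat) \<Rightarrow> bool) \<times> (nat list \<Rightarrow> nat list) \<Rightarrow> ((nat \<Rightarrow> nat) \<Rightarrow> 'f) \<times> (nat list \<Rightarrow> nat list)" where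
  "drop_lamps a \<equiv> (lamp F d \<one>\<^bsub>F\<^esub>, snd a)"

lemma sec_id: "sec k id = id"
  by (rule ext) (simp add: sec_def)

text \<open>Represents the nontrivial section at 1^k if there is one; \<open>flip\<close> is the
  action of this section on tails.\<close>

definition h0 :: "nat list \<Rightarrow> nat list" where
  "h0 = (SOME h. h \<in> H \<and> sec k ` H \<subseteq> {id, sec k h})"

lemma h0: "h0 \<in> H" "h \<in> H \<Longrightarrow> sec k h = id \<or> sec k h = sec k h0"
proof -
  have "\<exists>h. h \<in> H \<and> sec k ` H \<subseteq> {id, sec k h}"
  proof (cases "\<exists>h\<in>H. sec k h \<noteq> id")
    case True
    then obtain h where h: "h \<in> H" "sec k h \<noteq> id" by blast
    have sub: "{id, sec k h} \<subseteq> sec k ` H" using h H_id sec_id by (auto intro: image_eqI[of _ _ id])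
    have "card {id, sec k h} = 2" using h(2) by auto
    then have "{id, sec k h} = sec k ` H"
      using card_seteq[OF _ sub] H_fin sec2 by simp
    then show ?thesis using h(1) by blast
  next
    case False
    then show ?thesis using H_id by blast
  qed
  then have *: "h0 \<in> H \<and> sec k ` H \<subseteq> {id, sec k h0}" unfolding h0_def by (rule someI_ex)
  then show "h0 \<in> H" by blast
  assume "h \<in> H"
  then have "sec k h \<in> {id, sec k h0}" using * by blast
  then show "sec k h = id \<or> sec k h = sec k h0" by simp
qed

definition flip :: "(nat \<Rightarrow> nat) \<Rightarrow> nat \<Rightarrow> nat" where
  "flip = aut_bd (sec k h0)"

text \<open>The sections of H at 1^k form a group with at most two elements.\<close>

lemma sec_h0_square: "sec k h0 \<circ> sec k h0 = id"
proof -
  have sq: "sec k (h0 \<circ> h0) = sec k h0 \<circ> sec k h0" by (rule sec_comp[OF h0(1)])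
  from h0(2)[OF H_comp[OF h0(1) h0(1)]] show ?thesis
  proof
    assume "sec k (h0 \<circ> h0) = sec k h0"
    then have idem: "sec k h0 \<circ> sec k h0 = sec k h0" using sq by simp
    let ?g = "inv_into UNIV h0"
    have "sec k ?g \<circ> sec k h0 = id"
      using sec_comp[OF h0(1), of k ?g] inv_tree_aut(2)[OF H_aut[OF h0(1)]] sec_id by simp
    then have "sec k h0 = sec k ?g \<circ> (sec k h0 \<circ> sec k h0)" by (metis comp_assoc id_comp)
    then have "sec k h0 = id" using idem \<open>sec k ?g \<circ> sec k h0 = id\<close> by simp
    then show ?thesis by simp
  qed (simp add: sq)
qed

definition tails :: "(nat \<Rightarrow> nat) set" where
  "tails = tail_of k ` tree_boundary d"

lemma tails_embed:
  assumes "y \<in> tails"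
  shows "\<exists>x\<in>tree_boundary d. prefix_of x k = replicate k 1 \<and> tail_of k x = y"
proof -
  obtain x where x: "x \<in> tree_boundary d" "y = tail_of k x" using assms by (auto simp: tails_def)
  define z where "z j = (if j < k then 1 else x j)" for j
  have "z \<in> tree_boundary d" using x(1) d_pos by (auto simp: z_def tree_boundary_def)
  moreover have "prefix_of z k = replicate k 1" by (rule nth_equalityI) (auto simp: z_def)
  moreover have "tail_of k z = y" unfolding x(2) by (rule ext) (simp add: z_def tail_of_def)
  ultimately show ?thesis by blast
qed

lemma flip_tails:
  assumes "y \<in> tails" shows "flip y \<in> tails" "flip (flip y) = y"
proof -
  obtain x where x: "x \<in> tree_boundary d" "prefix_of x k = replicate k 1" "tail_of k x = y"
    using tails_embed[OF assms] by blast
  note t = H_tail[OF h0(1) x(1,2)]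
  have b: "aut_bd h0 x \<in> tree_boundary d" by (rule aut_bd_closed[OF H_aut[OF h0(1)] x(1)])
  have fy: "flip y = tail_of k (aut_bd h0 x)" using t(2) x(3) by (simp add: flip_def)
  then show "flip y \<in> tails" using b by (simp add: tails_def)
  have "flip (flip y) = tail_of k (aut_bd h0 (aut_bd h0 x))"
    using H_tail(2)[OF h0(1) b t(1)] by (simp add: fy) (simp add: flip_def)
  also have "aut_bd h0 (aut_bd h0 x) = aut_bd (h0 \<circ> h0) x"
    by (rule aut_bd_comp[OF H_aut[OF h0(1)] H_aut[OF h0(1)] x(1), symmetric])
  also have "tail_of k (aut_bd (h0 \<circ> h0) x) = aut_bd (sec k (h0 \<circ> h0)) (tail_of k x)"
    by (rule H_tail(2)[OF H_comp[OF h0(1) h0(1)] x(1,2)])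
  also have "sec k (h0 \<circ> h0) = id" unfolding sec_comp[OF h0(1)] by (rule sec_h0_square)
  finally show "flip (flip y) = y" using x(3) by (simp only: aut_bd_id)
qed

lemma tail_range: "y \<in> tails \<Longrightarrow> y 0 = 1 \<or> y 0 = 2"
proof -
  assume "y \<in> tails"
  then obtain x where x: "x \<in> tree_boundary d" "y = tail_of k x" by (auto simp: tails_def)
  have "1 \<le> x k \<and> x k \<le> d k" using x(1) by (simp add: tree_boundary_def)
  then show ?thesis using x(2) dk by (auto simp: tail_of_def)
qed

lemma swap_tails: "y \<in> tails \<Longrightarrow> swap12 y \<in> tails"
proof -
  assume y: "y \<in> tails"
  obtain x where x: "x \<in> tree_boundary d" "tail_of k x = y"
    using tails_embed[OF y] by blast
  define z where "z j = (if j = k then Transposition.transpose 1 2 (x k) else x j)" for j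
  have "x k = y 0" using x(2) by (auto simp: tail_of_def)
  then have "z \<in> tree_boundary d"
    using x(1) tail_range[OF y] dk by (auto simp: z_def tree_boundary_def)
  moreover have "swap12 y = tail_of k z"
    unfolding x(2)[symmetric] by (rule ext) (simp add: z_def tail_of_def swap12_def)
  ultimately show ?thesis unfolding tails_def by (intro image_eqI[of _ _ z])
qed

lemma flip_ones: "flip ones_ray = ones_ray"
proof -
  have "tail_of k ones_ray = ones_ray" by (rule ext) (simp add: tail_of_def ones_ray_def)
  then show ?thesis using H_tail(2)[OF h0(1) ones_boundary, of k] H_bd_ones[OF h0(1)]
    by (simp add: flip_def)
qed

text \<open>Enumerates the tails met in the orbit of 1^\<infinity> along a half-line: starting from
  the end point, which \<open>flip\<close> fixes, edges of the involutions \<open>swap12\<close> and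
  \<open>flip\<close> alternate.\<close>

primrec ray :: "nat \<Rightarrow> nat \<Rightarrow> nat" where
  "ray 0 = ones_ray"
| "ray (Suc i) = (if even i then swap12 (ray i) else flip (ray i))"

lemma ray_tails: "ray i \<in> tails"
proof (induction i)
  case 0
  have "tail_of k ones_ray = ones_ray" by (rule ext) (simp add: tail_of_def ones_ray_def)
  then show ?case using ones_boundary unfolding tails_def ray.simps by (metis image_eqI)
qed (simp add: swap_tails flip_tails)

lemma swap_ray: "\<exists>j\<le>Suc i. swap12 (ray i) = ray j"
proof (cases "even i")
  case True
  then show ?thesis by (intro exI[of _ "Suc i"]) simp
next
  case False
  then obtain j where "i = Suc j" "even j" by (cases i) auto
  then show ?thesis by (intro exI[of _ j]) simp
qed

lemma flip_ray: "\<exists>j\<le>Suc i. flip (ray i) = ray j"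
proof (cases i)
  case 0
  then show ?thesis using flip_ones by (intro exI[of _ 0]) simp
next
  case (Suc j)
  show ?thesis
  proof (cases "even j")
    case True
    then show ?thesis using Suc by (intro exI[of _ "Suc i"]) simp
  next
    case False
    then show ?thesis using Suc flip_tails(2)[OF ray_tails] by (intro exI[of _ j]) simp
  qed
qed

text \<open>An element of H at the prefix 1^k acts by its section. In all other cases only the first
  entry of the tail can change, and with two children this means nothing or a swap.\<close>

lemma letter_tail:
  assumes g: "g \<in> letters" and x: "x \<in> tree_boundary d"
  shows "tail_of k (aut_bd g x) \<in> {tail_of k x, swap12 (tail_of k x), flip (tail_of k x)}"
proof (cases "g \<in> H \<and> prefix_of x k = replicate k 1")
  case True
  then have "tail_of k (aut_bd g x) = aut_bd (sec k g) (tail_of k x)" using H_tail(2)[OF _ x] by blast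
  moreover have "sec k g = id \<or> sec k g = sec k h0" using h0(2) True by blast
  ultimately show ?thesis by (auto simp: flip_def)
next
  case False
  have V: "prefix_of x (k + j) \<in> tree_vertices d" "prefix_of x (k + j) \<noteq> []" for j
    using prefix_tree_vertices[OF x] k by auto
  have lab: "aut_label d g (prefix_of x (k + j)) = id" if "j \<noteq> 0" for j
  proof (cases "g \<in> H")
    case True
    have "\<not> special_vertex (prefix_of x (k + j))"
    proof
      assume sp: "special_vertex (prefix_of x (k + j))"
      have "prefix_of x k = replicate k 1"
      proof (rule nth_equalityI)
        fix i assume "i < length (prefix_of x k)"
        then have i: "i < k" by simp
        have "prefix_of x (k + j) ! i = 1" using sp i that unfolding special_vertex_def by simp
        then show "prefix_of x k ! i = replicate k 1 ! i" using i by simp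
      qed simp
      then show False using False True by blast
    qed
    then show ?thesis using H_label[OF True V(1)] by blast
  next
    case False
    then obtain \<tau> where "g = rooted_aut d \<tau>" using g by (auto simp: letters_def)
    then show ?thesis using rooted_aut_label[OF V(2,1)] by simp
  qed
  have t: "tail_of k (aut_bd g x) j = aut_label d g (prefix_of x (k + j)) (tail_of k x j)" for j
    using aut_bd_label[OF letters_aut[OF g] x, of "k + j"] by (simp add: tail_of_def add.commute)
  have t0: "tail_of k (aut_bd g x) j = tail_of k x j" if "j \<noteq> 0" for j
    using t[of j] lab[OF that] by simp
  have "aut_bd g x \<in> tree_boundary d" by (rule aut_bd_closed[OF letters_aut[OF g] x])
  then have r: "tail_of k (aut_bd g x) 0 = 1 \<or> tail_of k (aut_bd g x) 0 = 2" "tail_of k x 0 = 1 \<or> tail_of k x 0 = 2"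
    using x tail_range by (auto simp: tails_def)
  show ?thesis
  proof (cases "tail_of k (aut_bd g x) 0 = tail_of k x 0")
    case True
    then have "tail_of k (aut_bd g x) = tail_of k x" using t0 by (metis ext)
    then show ?thesis by simp
  next
    case False
    then have "tail_of k (aut_bd g x) 0 = Transposition.transpose 1 2 (tail_of k x 0)" using r by auto
    then have "tail_of k (aut_bd g x) j = swap12 (tail_of k x) j" for j
      using t0[of j] by (cases "j = 0") (simp_all add: swap12_def)
    then have "tail_of k (aut_bd g x) = swap12 (tail_of k x)" by (rule ext)
    then show ?thesis by simp
  qed
qed

text \<open>Linear growth of the Schreier graph: a letter raises the index on the half-line by at
  most 1.\<close>

lemma run_tail:
  "set q \<subseteq> letters \<Longrightarrow> x \<in> tree_boundary d \<Longrightarrow> tail_of k x = ray i \<Longrightarrow>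
    \<exists>j\<le>i + length q. tail_of k (run aut_bd q x) = ray j"
proof (induction q arbitrary: x i)
  case (Cons g q)
  have g: "g \<in> letters" "set q \<subseteq> letters" using Cons.prems(1) by auto
  consider "tail_of k (aut_bd g x) = ray i" | "tail_of k (aut_bd g x) = swap12 (ray i)"
    | "tail_of k (aut_bd g x) = flip (ray i)"
    using letter_tail[OF g(1) Cons.prems(2)] unfolding Cons.prems(3) by blast
  then have "\<exists>j\<le>Suc i. tail_of k (aut_bd g x) = ray j"
  proof cases
    case 1
    then show ?thesis by (intro exI[of _ i]) simp
  next
    case 2
    then show ?thesis using swap_ray[of i] by simp
  next
    case 3
    then show ?thesis using flip_ray[of i] by simp
  qed
  then obtain j where j: "j \<le> Suc i" "tail_of k (aut_bd g x) = ray j" by blast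
  from Cons.IH[OF g(2) aut_bd_closed[OF letters_aut[OF g(1)] Cons.prems(2)] j(2)]
  obtain l where l: "l \<le> j + length q" "tail_of k (run aut_bd q (aut_bd g x)) = ray l" by blast
  then show ?case using j(1) by (intro exI[of _ l]) simp
qed auto

definition loop :: "(nat list \<Rightarrow> nat list) list" where
  "loop = (SOME q. set q \<subseteq> letters \<and> (\<forall>x\<in>tree_boundary d. prefix_of x k = replicate k 1 \<longrightarrow>
     prefix_of (run aut_bd q x) k = replicate k 1 \<and> tail_of k (run aut_bd q x) = swap12 (tail_of k x)))"

lemma loop:
  shows loop_letters: "set loop \<subseteq> letters"
    and loop_run: "x \<in> tree_boundary d \<Longrightarrow> prefix_of x k = replicate k 1 \<Longrightarrow>
     prefix_of (run aut_bd loop x) k = replicate k 1 \<and> tail_of k (run aut_bd loop x) = swap12 (tail_of k x)"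
proof -
  have "set loop \<subseteq> letters \<and> (\<forall>x\<in>tree_boundary d. prefix_of x k = replicate k 1 \<longrightarrow>
     prefix_of (run aut_bd loop x) k = replicate k 1 \<and> tail_of k (run aut_bd loop x) = swap12 (tail_of k x))"
    unfolding loop_def by (rule someI_ex[OF swap_loop[OF k dk]])
  then show "set loop \<subseteq> letters" "x \<in> tree_boundary d \<Longrightarrow> prefix_of x k = replicate k 1 \<Longrightarrow>
     prefix_of (run aut_bd loop x) k = replicate k 1 \<and> tail_of k (run aut_bd loop x) = swap12 (tail_of k x)"
    by blast+
qed

text \<open>The walk down the half-line. The flag is \<open>True\<close> at an odd index, where the
  edge towards the end point is a swap, realised by \<open>loop\<close>; at an even index it is a
  flip, realised by \<open>h0\<close>.\<close>

primrec zigzag :: "nat \<Rightarrow> bool \<Rightarrow> (nat list \<Rightarrow> nat list) list" where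
  "zigzag 0 c = []"
| "zigzag (Suc m) c = (if c then loop else [h0]) @ zigzag m (\<not> c)"

lemma h0_letter: "h0 \<in> letters"
  using h0(1) by (simp add: letters_def)

lemma zigzag_letters: "set (zigzag m c) \<subseteq> letters"
  using loop_letters h0_letter by (induction m arbitrary: c) auto

lemma zigzag_length: "length (zigzag m c) \<le> (length loop + 1) * m"
proof (induction m arbitrary: c)
  case (Suc m)
  have "length (zigzag (Suc m) c) \<le> (length loop + 1) + length (zigzag m (\<not> c))" by simp
  also have "\<dots> \<le> (length loop + 1) + (length loop + 1) * m" using Suc[of "\<not> c"] by (rule add_left_mono)
  finally show ?case by simp
qed simp

lemma ones_ray_eq: "prefix_of x k = replicate k 1 \<Longrightarrow> tail_of k x = ones_ray \<Longrightarrow> x = ones_ray"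
proof
  fix j assume p: "prefix_of x k = replicate k 1" and t: "tail_of k x = ones_ray"
  show "x j = ones_ray j"
  proof (cases "j < k")
    case True
    then have "prefix_of x k ! j = replicate k 1 ! j" using p by simp
    then show ?thesis using True by (simp add: ones_ray_def)
  next
    case False
    then show ?thesis using fun_cong[OF t, of "j - k"] by (simp add: tail_of_def ones_ray_def)
  qed
qed

text \<open>The word depends only on the parity of the index, so a single word of length linear in m
  passes 1^\<infinity> from every point with prefix 1^k, index at most m and that parity.\<close>

lemma zigzag_visits:
  "x \<in> tree_boundary d \<Longrightarrow> prefix_of x k = replicate k 1 \<Longrightarrow> tail_of k x = ray i \<Longrightarrow> i \<le> m \<Longrightarrow>
    visits (zigzag m (odd i)) x"
proof (induction i arbitrary: x m)
  case 0
  then have "x = ones_ray" using ones_ray_eq by simp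
  then show ?case by (simp add: visits_ones)
next
  case (Suc i)
  then obtain m' where m': "m = Suc m'" "i \<le> m'" by (cases m) auto
  define q where "q = (if even i then loop else [h0])"
  have q: "set q \<subseteq> letters" using loop_letters h0_letter by (simp add: q_def)
  have y: "prefix_of (run aut_bd q x) k = replicate k 1 \<and> tail_of k (run aut_bd q x) = ray i"
  proof (cases "even i")
    case True
    then show ?thesis using loop_run[OF Suc.prems(1,2)] Suc.prems(3) by (simp add: q_def)
  next
    case False
    have "tail_of k (aut_bd h0 x) = flip (flip (ray i))"
      using H_tail(2)[OF h0(1) Suc.prems(1,2)] Suc.prems(3) False by (simp add: flip_def)
    then show ?thesis using H_tail(1)[OF h0(1) Suc.prems(1,2)] flip_tails(2)[OF ray_tails] False
      by (simp add: q_def)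
  qed
  have "visits (zigzag m' (odd i)) (run aut_bd q x)"
    using Suc.IH[OF run_bd_closed[OF q Suc.prems(1)]] y m'(2) by blast
  then have "visits (q @ zigzag m' (odd i)) x" unfolding visits_append by (rule disjI2)
  moreover have "zigzag m (odd (Suc i)) = q @ zigzag m' (odd i)" by (simp add: m'(1) q_def)
  ultimately show ?case by (simp only:)
qed

definition access :: "nat list \<Rightarrow> (nat list \<Rightarrow> nat list) list" where
  "access u = (SOME q. set q \<subseteq> letters \<and>
     (\<forall>x\<in>tree_boundary d. prefix_of x k = u \<longrightarrow> prefix_of (run aut_bd q x) k = replicate k 1))"

lemma access:
  assumes "u \<in> level k"
  shows "set (access u) \<subseteq> letters"
    and "x \<in> tree_boundary d \<Longrightarrow> prefix_of x k = u \<Longrightarrow> prefix_of (run aut_bd (access u) x) k = replicate k 1"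
proof -
  have o: "replicate k 1 \<in> level k" by (simp add: level_def)
  obtain w where w: "set w \<subseteq> \<Sigma>" "snd (wprod W w) u = replicate k 1"
    using reach_level[OF assms o] unfolding reach_def by blast
  have "\<exists>q. set q \<subseteq> letters \<and>
     (\<forall>x\<in>tree_boundary d. prefix_of x k = u \<longrightarrow> prefix_of (run aut_bd q x) k = replicate k 1)"
  proof (intro exI[of _ "map snd w"] conjI ballI impI)
    show "set (map snd w) \<subseteq> letters" using w(1) snd_Sigma by auto
    fix x assume x: "x \<in> tree_boundary d" "prefix_of x k = u"
    show "prefix_of (run aut_bd (map snd w) x) k = replicate k 1"
      unfolding run_bd_wprod[OF w(1) x(1)] prefix_aut_bd[OF wprod_aut[OF w(1)] x(1)] x(2) by (rule w(2))
  qed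
  then have *: "set (access u) \<subseteq> letters \<and>
     (\<forall>x\<in>tree_boundary d. prefix_of x k = u \<longrightarrow> prefix_of (run aut_bd (access u) x) k = replicate k 1)"
    unfolding access_def by (rule someI_ex)
  then show "set (access u) \<subseteq> letters" by blast
  show "x \<in> tree_boundary d \<Longrightarrow> prefix_of x k = u \<Longrightarrow> prefix_of (run aut_bd (access u) x) k = replicate k 1"
    using * by blast
qed

text \<open>The access word brings the prefix to 1^k and may raise the index by its length, which
  the zigzag has to allow for. The parity reached depends on the point, hence the flag.\<close>

definition tour :: "nat \<Rightarrow> nat list \<times> bool \<Rightarrow> (nat list \<Rightarrow> nat list) list" where
  "tour m p = access (fst p) @ zigzag (m + length (access (fst p))) (snd p)"

lemma tour_letters: "fst p \<in> level k \<Longrightarrow> set (tour m p) \<subseteq> letters"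
  using access(1)[of "fst p"] zigzag_letters by (auto simp: tour_def)

lemma tour_length: "length (tour m p) \<le> length (access (fst p)) + (length loop + 1) * (m + length (access (fst p)))"
  using zigzag_length[of "m + length (access (fst p))" "snd p"] by (simp add: tour_def)

lemma tour_visits:
  assumes x: "x \<in> tree_boundary d" "tail_of k x = ray i" "i \<le> m"
  shows "\<exists>c. visits (tour m (prefix_of x k, c)) x"
proof -
  define u where "u = prefix_of x k"
  have u: "u \<in> level k" using prefix_tree_vertices[OF x(1)] by (simp add: u_def level_def)
  define y where "y = run aut_bd (access u) x"
  have y: "y \<in> tree_boundary d" "prefix_of y k = replicate k 1"
    using run_bd_closed[OF access(1)[OF u] x(1)] access(2)[OF u x(1)] by (simp_all add: y_def u_def)
  obtain j where j: "j \<le> i + length (access u)" "tail_of k y = ray j"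
    using run_tail[OF access(1)[OF u] x(1,2)] unfolding y_def by blast
  have "visits (zigzag (m + length (access u)) (odd j)) y"
    by (rule zigzag_visits[OF y j(2)]) (use j(1) x(3) in simp)
  then have "visits (tour m (u, odd j)) x" by (simp add: tour_def visits_append y_def)
  then show ?thesis unfolding u_def by blast
qed

subsection \<open>Lighting lamps along a word\<close>

lemma lamp_bool: "x \<in> tree_boundary d \<Longrightarrow> lamp bool_grp d \<epsilon> x \<longleftrightarrow> x = ones_ray \<and> \<epsilon>"
  by (simp add: lamp_def)

text \<open>One lamp letter is put in front of each letter of q and one at the end, which doubles
  the length and adds 1. It sets the lamp at the point which the prefix read so far carries to
  1^\<infinity>; a lamp is dealt with at its first visit, and \<psi> is what remains, transported by
  g.\<close>

lemma insert_lamps: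
  "set q \<subseteq> letters \<Longrightarrow> \<phi> \<in> extensional (tree_boundary d) \<Longrightarrow>
    (\<And>x. x \<in> tree_boundary d \<Longrightarrow> \<phi> x \<Longrightarrow> visits q x) \<Longrightarrow>
    \<exists>w. set w \<subseteq> SB \<and> length w \<le> 2 * length q + 1 \<and> wprod WB w = (\<phi>, snd (wprod WB (map lift q)))"
proof (induction q arbitrary: \<phi>)
  case Nil
  define a where "a = (lamp bool_grp d (\<phi> ones_ray), id :: nat list \<Rightarrow> nat list)"
  have a: "a \<in> SB" unfolding a_def by (rule L.HF_Sigma[OF L.HF_I]) simp_all
  have "lamp bool_grp d (\<phi> ones_ray) = \<phi>"
  proof (rule extensionalityI[of _ "tree_boundary d"])
    fix x assume "x \<in> tree_boundary d"
    then show "lamp bool_grp d (\<phi> ones_ray) x = \<phi> x" using Nil.prems(3)[of x] by (auto simp: lamp_bool visits_Nil)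
  qed (use Nil.prems(2) in \<open>simp_all add: lamp_def\<close>)
  then have "a = (\<phi>, id)" by (simp add: a_def)
  moreover have "a \<in> carrier WB" using a L.Sigma_carrier by blast
  then have "wprod WB [a] = a" by simp
  ultimately show ?case using a by (intro exI[of _ "[a]"]) (simp add: wreath_one id_def)
next
  case (Cons g q)
  have g: "g \<in> letters" "set q \<subseteq> letters" using Cons.prems(1) by auto
  note ga = letters_aut[OF g(1)]
  obtain g' where g': "g' \<in> letters" "g' \<circ> g = id" using letters_inv[OF g(1)] by blast
  have gg: "aut_bd g' (aut_bd g x) = x" if "x \<in> tree_boundary d" for x
    using aut_bd_comp[OF ga letters_aut[OF g'(1)] that] g'(2) by simp
  have "g \<circ> g' = id"
  proof -
    have "inj g" "surj g" using tree_aut_bij[OF ga] by (simp_all add: bij_is_inj bij_is_surj)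
    then show ?thesis using g'(2) by (metis comp_assoc comp_id id_comp surj_iff)
  qed
  then have gg': "aut_bd g (aut_bd g' x) = x" if "x \<in> tree_boundary d" for x
    using aut_bd_comp[OF letters_aut[OF g'(1)] ga that] by simp
  define \<epsilon> where "\<epsilon> = \<phi> ones_ray"
  define \<psi> where "\<psi> = (\<lambda>z\<in>tree_boundary d. \<phi> (aut_bd g' z) \<and> aut_bd g' z \<noteq> ones_ray)"
  have psi: "\<psi> \<in> extensional (tree_boundary d)" by (simp add: \<psi>_def)
  have psi_visits: "visits q z" if z: "z \<in> tree_boundary d" "\<psi> z" for z
  proof -
    have y: "aut_bd g' z \<in> tree_boundary d" by (rule aut_bd_closed[OF letters_aut[OF g'(1)] z(1)])
    have "visits (g # q) (aut_bd g' z)" "aut_bd g' z \<noteq> ones_ray"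
      using Cons.prems(3)[OF y] z by (simp_all add: \<psi>_def)
    then show ?thesis unfolding visits_Cons gg'[OF z(1)] by simp
  qed
  obtain w where w: "set w \<subseteq> SB" "length w \<le> 2 * length q + 1"
    "wprod WB w = (\<psi>, snd (wprod WB (map lift q)))"
    using Cons.IH[OF g(2) psi psi_visits] by blast
  define a where "a = (lamp bool_grp d \<epsilon>, id :: nat list \<Rightarrow> nat list)"
  have a: "a \<in> SB" unfolding a_def by (rule L.HF_Sigma[OF L.HF_I]) simp_all
  have gS: "lift g \<in> SB" using L.letters_Sigma[OF g(1)] by simp
  have "wprod WB (a # lift g # w) = (\<phi>, snd (wprod WB (map lift (g # q))))"
  proof (rule prod_eqI)
    show "snd (wprod WB (a # lift g # w)) = snd (\<phi>, snd (wprod WB (map lift (g # q))))"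
      by (simp add: snd_wreath_mult w(3) a_def)
    have "fst (wprod WB (a # lift g # w)) \<in> extensional (tree_boundary d)"
      by (cases "lift g \<otimes>\<^bsub>WB\<^esub> wprod WB w") (simp add: a_def wreath_mult)
    moreover have "fst (wprod WB (a # lift g # w)) x = \<phi> x" if x: "x \<in> tree_boundary d" for x
    proof -
      have gx: "aut_bd g x \<in> tree_boundary d" by (rule aut_bd_closed[OF ga x])
      have "fst (wprod WB (a # lift g # w)) x
          = (lamp bool_grp d \<epsilon> x \<noteq> (lamp bool_grp d False x \<noteq> \<psi> (aut_bd g x)))"
        by (simp add: a_def fst_wreath_mult x w(3))
      then show ?thesis using x gx by (auto simp: lamp_bool \<psi>_def gg \<epsilon>_def)
    qed
    ultimately show "fst (wprod WB (a # lift g # w)) = fst (\<phi>, snd (wprod WB (map lift (g # q))))"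
      using Cons.prems(2) by (auto intro: extensionalityI)
  qed
  then show ?case using a gS w(1,2) by (intro exI[of _ "a # lift g # w"]) simp
qed

lemma lift_wprod:
  "set q \<subseteq> letters \<Longrightarrow> wprod WB (map lift q) = lift (snd (wprod WB (map lift q)))"
proof (induction q)
  case Nil
  show ?case unfolding list.map wprod_Nil L.W_one by (simp add: id_def)
next
  case (Cons g q)
  have g: "g \<in> tree_aut d" using letters_aut Cons.prems by simp
  obtain G where G: "wprod WB (map lift q) = lift G" using Cons by auto
  have "lift g \<otimes>\<^bsub>WB\<^esub> lift G = lift (G \<circ> g)" using L.rooted_mult[OF g, of G] by simp
  then show ?case by (simp add: G o_def)
qed

text \<open>Appending the inverse of q without lamps undoes the automorphism and keeps the
  configuration, at the cost of another length of q.\<close>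

lemma lamps_norm:
  assumes q: "set q \<subseteq> letters" and phi: "\<phi> \<in> extensional (tree_boundary d)"
    and v: "\<And>x. x \<in> tree_boundary d \<Longrightarrow> \<phi> x \<Longrightarrow> visits q x"
  shows "\<exists>w. set w \<subseteq> SB \<and> length w \<le> 3 * length q + 1 \<and> wprod WB w = (\<phi>, id)"
proof -
  obtain w where w: "set w \<subseteq> SB" "length w \<le> 2 * length q + 1" "wprod WB w = (\<phi>, snd (wprod WB (map lift q)))"
    using insert_lamps[OF assms] by blast
  let ?c = "map lift q"
  have cS: "set ?c \<subseteq> SB" using q L.letters_Sigma by auto
  let ?c' = "rev (map (\<lambda>a. inv\<^bsub>WB\<^esub> a) ?c)"
  have c'S: "set ?c' \<subseteq> SB" using cS L.Sigma_inv by auto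
  have C: "set ?c \<subseteq> carrier WB" "set ?c' \<subseteq> carrier WB" "set w \<subseteq> carrier WB"
    using cS c'S w(1) L.Sigma_carrier by blast+
  have phiW: "(\<phi>, id) \<in> carrier WB" using phi by (simp add: wreath_carrier PiE_def)
  have "(\<phi>, id) \<otimes>\<^bsub>WB\<^esub> lift G = (\<phi>, G)" for G
  proof -
    have "(\<lambda>x\<in>tree_boundary d. \<phi> x \<otimes>\<^bsub>bool_grp\<^esub> lamp bool_grp d False (aut_bd id x)) = \<phi>"
      by (rule extensionalityI[of _ "tree_boundary d"]) (use phi in \<open>simp_all add: lamp_bool\<close>)
    then show ?thesis by (simp add: wreath_mult)
  qed
  moreover obtain G where "wprod WB ?c = lift G" using lift_wprod[OF q] by blast
  ultimately have eq: "wprod WB w = (\<phi>, id) \<otimes>\<^bsub>WB\<^esub> wprod WB ?c"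
    using w(3) by simp
  have "wprod WB (w @ ?c') = wprod WB w \<otimes>\<^bsub>WB\<^esub> inv\<^bsub>WB\<^esub> (wprod WB ?c)"
    unfolding L.W.wprod_append[OF C(3,2)] L.W.wprod_rev_inv[OF C(1)] ..
  also have "\<dots> = (\<phi>, id)"
    unfolding eq using phiW L.W.wprod_closed[OF C(1)] by (simp add: L.W.m_assoc)
  finally show ?thesis using w(1,2) c'S by (intro exI[of _ "w @ ?c'"]) (simp add: id_def)
qed

lemma lamps_add:
  "(\<phi>, id) \<otimes>\<^bsub>WB\<^esub> (\<psi>, id) = (\<lambda>x\<in>tree_boundary d. \<phi> x \<noteq> \<psi> x, id)"
proof -
  have "(\<lambda>x\<in>tree_boundary d. \<phi> x \<otimes>\<^bsub>bool_grp\<^esub> \<psi> (aut_bd id x)) = (\<lambda>x\<in>tree_boundary d. \<phi> x \<noteq> \<psi> x)"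
    by (rule restrict_ext) simp
  then show ?thesis by (simp add: wreath_mult)
qed

text \<open>The configuration is split into pieces with disjoint supports, one for each word; pure
  lamp elements multiply pointwise.\<close>

lemma family_lamps_norm:
  assumes "finite I"
  shows "(\<And>i. i \<in> I \<Longrightarrow> set (q i) \<subseteq> letters) \<Longrightarrow> \<phi> \<in> extensional (tree_boundary d) \<Longrightarrow>
    (\<And>x. x \<in> tree_boundary d \<Longrightarrow> \<phi> x \<Longrightarrow> \<exists>i\<in>I. visits (q i) x) \<Longrightarrow>
    \<exists>w. set w \<subseteq> SB \<and> length w \<le> (\<Sum>i\<in>I. 3 * length (q i) + 1) \<and> wprod WB w = (\<phi>, id)"
  using assms
proof (induction I arbitrary: \<phi> rule: finite_induct)
  case empty
  have "\<phi> = lamp bool_grp d False"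
    by (rule extensionalityI[of _ "tree_boundary d"]) (use empty in \<open>auto simp: lamp_def\<close>)
  then have "wprod WB [] = (\<phi>, id)" unfolding wprod_Nil L.W_one by (simp add: id_def)
  then show ?case by (intro exI[of _ "[]"]) (simp add: id_def)
next
  case (insert i I)
  define \<phi>1 where "\<phi>1 = (\<lambda>x\<in>tree_boundary d. \<phi> x \<and> visits (q i) x)"
  define \<phi>2 where "\<phi>2 = (\<lambda>x\<in>tree_boundary d. \<phi> x \<and> \<not> visits (q i) x)"
  obtain w1 where w1: "set w1 \<subseteq> SB" "length w1 \<le> 3 * length (q i) + 1" "wprod WB w1 = (\<phi>1, id)"
    using lamps_norm[of "q i" \<phi>1] insert.prems(1)[of i] by (auto simp: \<phi>1_def)
  have "\<exists>w. set w \<subseteq> SB \<and> length w \<le> (\<Sum>i\<in>I. 3 * length (q i) + 1) \<and> wprod WB w = (\<phi>2, id)"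
  proof (rule insert.IH)
    show "\<phi>2 \<in> extensional (tree_boundary d)" by (simp add: \<phi>2_def)
    fix x assume x: "x \<in> tree_boundary d" "\<phi>2 x"
    then have "\<phi> x" "\<not> visits (q i) x" by (simp_all add: \<phi>2_def)
    then show "\<exists>i\<in>I. visits (q i) x" using insert.prems(3)[OF x(1)] by blast
  qed (use insert.prems(1) in blast)
  then obtain w2 where w2: "set w2 \<subseteq> SB" "length w2 \<le> (\<Sum>i\<in>I. 3 * length (q i) + 1)" "wprod WB w2 = (\<phi>2, id)"
    by blast
  have C: "set w1 \<subseteq> carrier WB" "set w2 \<subseteq> carrier WB" using w1(1) w2(1) L.Sigma_carrier by blast+
  have "(\<lambda>x\<in>tree_boundary d. \<phi>1 x \<noteq> \<phi>2 x) = \<phi>"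
    by (rule extensionalityI[of _ "tree_boundary d"]) (use insert.prems(2) in \<open>auto simp: \<phi>1_def \<phi>2_def\<close>)
  then have "wprod WB (w1 @ w2) = (\<phi>, id)"
    unfolding L.W.wprod_append[OF C] w1(3) w2(3) lamps_add by simp
  then show ?case using w1 w2 insert.hyps by (intro exI[of _ "w1 @ w2"]) (simp add: id_def)
qed

lemma lamps_support:
  "set w \<subseteq> SB \<Longrightarrow> x \<in> tree_boundary d \<Longrightarrow> fst (wprod WB w) x \<Longrightarrow>
    \<exists>w1 w2. w = w1 @ w2 \<and> run aut_bd (map snd w1) x = ones_ray"
proof (induction w arbitrary: x)
  case Nil
  then show ?case by (simp add: wreath_one)
next
  case (Cons a w)
  have a: "a \<in> SB" "set w \<subseteq> SB" using Cons.prems(1) by auto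
  have ax: "aut_bd (snd a) x \<in> tree_boundary d" by (rule aut_bd_closed[OF L.Sigma_aut[OF a(1)] Cons.prems(2)])
  have "fst a x \<noteq> fst (wprod WB w) (aut_bd (snd a) x)"
    using Cons.prems(2,3) by (simp add: fst_wreath_mult)
  then consider "fst a x" | "fst (wprod WB w) (aut_bd (snd a) x)" by blast
  then show ?case
  proof cases
    case 1
    then have "x = ones_ray" using a(1) Cons.prems(2) by (elim L.Sigma_cases) (auto simp: lamp_bool)
    then show ?thesis by (intro exI[of _ "[]"] exI[of _ "a # w"]) simp
  next
    case 2
    from Cons.IH[OF a(2) ax 2] obtain w1 w2 where "w = w1 @ w2" "run aut_bd (map snd w1) (aut_bd (snd a) x) = ones_ray"
      by blast
    then show ?thesis by (intro exI[of _ "a # w1"] exI[of _ w2]) simp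
  qed
qed

subsection \<open>Comparing the norms\<close>

lemma max_norm_prefix: "word_norm G S (y \<otimes>\<^bsub>G\<^esub> wprod G w1) \<le> max_norm G S y (w1 @ w2)"
  if "group G" "y \<in> carrier G" "set w1 \<subseteq> carrier G" for G (structure) and w1 w2
  using that(2,3)
proof (induction w1 arbitrary: y)
  interpret group G by (rule that(1))
  case Nil
  then show ?case by (cases w2) auto
next
  interpret group G by (rule that(1))
  case (Cons a w1)
  then have "y \<otimes> a \<otimes> wprod G w1 = y \<otimes> wprod G (a # w1)" by (simp add: m_assoc)
  then show ?case using Cons.IH[of "y \<otimes> a"] Cons.prems by (auto simp: le_max_iff_disj)
qed

lemma drop_lamps_Sigma: "a \<in> SB \<Longrightarrow> drop_lamps a \<in> \<Sigma>"
  using letters_Sigma[OF L.snd_Sigma] .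

lemma snd_wprod_drop: "snd (wprod W (map drop_lamps w)) = snd (wprod WB w)"
  by (induction w) (simp_all add: snd_wreath_mult wreath_one)

lemma snd_wprod_map_lift: "snd (wprod WB (map (\<lambda>a. lift (snd a)) w)) = snd (wprod W w)"
  by (induction w) (simp_all add: snd_wreath_mult wreath_one)

text \<open>Let M be the maximal norm of the projected word. If the lamp at x is lit, a prefix
  carries x to 1^\<infinity>; a shortest word for the inverse of this prefix in \<Gamma> has length
  at most M and leads from 1^\<infinity> back to x, so the tail of x has index at most M. All such
  points are covered by a fixed number of tours of length linear in M, and the automorphism part
  costs at most M more.\<close>

lemma norm_comparison:
  "\<exists>A. \<forall>w. set w \<subseteq> SB \<longrightarrow> word_norm GB SB (wprod WB w) \<le> A * (max_norm \<Gamma> \<Sigma> \<one>\<^bsub>\<Gamma>\<^esub> (map drop_lamps w) + 1)"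
proof -
  define I where "I = level k \<times> (UNIV :: bool set)"
  have finI: "finite I" by (simp add: I_def level_def finite_level)
  define b where "b p = 3 * (length (access (fst p)) + (length loop + 1) * (1 + length (access (fst p)))) + 1"
    for p :: "nat list \<times> bool"
  \<comment> \<open>The sum pays for one tour per vertex of level k and flag, the 1 for the
    automorphism part.\<close>
  define A where "A = (\<Sum>p\<in>I. b p) + 1"
  have "word_norm GB SB (wprod WB w) \<le> A * (max_norm \<Gamma> \<Sigma> \<one>\<^bsub>\<Gamma>\<^esub> (map drop_lamps w) + 1)"
    if w: "set w \<subseteq> SB" for w
  proof -
    define M where "M = max_norm \<Gamma> \<Sigma> \<one>\<^bsub>\<Gamma>\<^esub> (map drop_lamps w)"
    have wd: "set (map drop_lamps w) \<subseteq> \<Sigma>" using w drop_lamps_Sigma by auto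
    have prefix_norm: "word_norm \<Gamma> \<Sigma> (wprod \<Gamma> (map drop_lamps w1)) \<le> M" if "w = w1 @ w2" for w1 w2
    proof -
      have S1: "set (map drop_lamps w1) \<subseteq> carrier \<Gamma>" using wd \<Gamma>.S_carrier that by auto
      show ?thesis
        using max_norm_prefix[OF \<Gamma>.is_group \<Gamma>.one_closed S1, of \<Sigma> "map drop_lamps w2"] \<Gamma>.wprod_closed[OF S1]
        by (simp add: M_def that)
    qed
    define \<phi> where "\<phi> = fst (wprod WB w)"
    define g where "g = snd (wprod WB w)"
    have wC: "set w \<subseteq> carrier WB" using w L.Sigma_carrier by blast
    have phi: "\<phi> \<in> extensional (tree_boundary d)"
      using L.W.wprod_closed[OF wC] by (auto simp: \<phi>_def wreath_carrier PiE_def)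
    have cover: "\<exists>p\<in>I. visits (tour M p) x" if x: "x \<in> tree_boundary d" "\<phi> x" for x
    proof -
      obtain w1 w2 where w12: "w = w1 @ w2" "run aut_bd (map snd w1) x = ones_ray"
        using lamps_support[OF w x(1)] x(2) unfolding \<phi>_def by blast
      let ?w1 = "map drop_lamps w1"
      have w1S: "set ?w1 \<subseteq> \<Sigma>" using wd w12(1) by auto
      have w1C: "set ?w1 \<subseteq> carrier \<Gamma>" using w1S \<Gamma>.S_carrier by blast
      define c where "c = wprod \<Gamma> ?w1"
      have c: "c \<in> carrier \<Gamma>" unfolding c_def by (rule \<Gamma>.wprod_closed[OF w1C])
      have cW: "c = wprod W ?w1" by (simp add: c_def wprod_Gamma)
      have cC: "c \<in> carrier W" unfolding cW by (rule W.wprod_closed) (use w1S Sigma_carrier in blast)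
      have inv_eq: "inv\<^bsub>\<Gamma>\<^esub> c = inv\<^bsub>W\<^esub> c"
        unfolding Gamma_generate
        by (rule W.m_inv_consistent[OF W.generate_is_subgroup[OF Sigma_carrier]]) (use c in \<open>simp add: Gamma_generate\<close>)
      obtain v where v: "length v = word_norm \<Gamma> \<Sigma> (inv\<^bsub>\<Gamma>\<^esub> c)" "set v \<subseteq> \<Sigma>" "wprod \<Gamma> v = inv\<^bsub>\<Gamma>\<^esub> c"
        using \<Gamma>.word_norm_attained[OF \<Gamma>.inv_closed[OF c]] .
      have lv: "length v \<le> M" using v(1) prefix_norm[OF w12(1)] \<Gamma>.word_norm_inv[OF c] by (simp add: c_def)
      have vo: "run aut_bd (map snd v) ones_ray = x"
      proof -
        have "aut_bd (snd c) x = ones_ray"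
          using run_bd_wprod[OF w1S x(1)] w12(2) by (simp add: cW o_def)
        then have "run aut_bd (map snd v) ones_ray = aut_bd (snd (inv\<^bsub>W\<^esub> c)) (aut_bd (snd c) x)"
          using run_bd_wprod[OF v(2) ones_boundary] v(3) inv_eq by (simp add: wprod_Gamma)
        also have "\<dots> = aut_bd (snd (inv\<^bsub>W\<^esub> c) \<circ> snd c) x"
          using cC W.inv_closed[OF cC] x(1) by (intro aut_bd_comp[symmetric]) (auto simp: wreath_carrier)
        also have "snd (inv\<^bsub>W\<^esub> c) \<circ> snd c = id" using snd_inv[OF cC] by (auto simp: fun_eq_iff)
        finally show ?thesis by (simp only: aut_bd_id)
      qed
      have "tail_of k ones_ray = ray 0" by (rule ext) (simp add: tail_of_def ones_ray_def)
      moreover have "set (map snd v) \<subseteq> letters" using v(2) snd_Sigma by auto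
      ultimately obtain j where j: "j \<le> 0 + length (map snd v)" "tail_of k x = ray j"
        using run_tail[OF _ ones_boundary] vo by metis
      then obtain e where "visits (tour M (prefix_of x k, e)) x" using tour_visits[OF x(1) j(2), of M] lv by auto
      moreover have "(prefix_of x k, e) \<in> I" using prefix_tree_vertices[OF x(1)] by (simp add: I_def level_def)
      ultimately show ?thesis by blast
    qed
    have tour_S: "set (tour M p) \<subseteq> letters" if "p \<in> I" for p
      by (rule tour_letters) (use that in \<open>auto simp: I_def\<close>)
    obtain w' where w': "set w' \<subseteq> SB" "length w' \<le> (\<Sum>p\<in>I. 3 * length (tour M p) + 1)" "wprod WB w' = (\<phi>, id)"
      using family_lamps_norm[OF finI tour_S phi cover] by blast
    have "(\<Sum>p\<in>I. 3 * length (tour M p) + 1) \<le> (\<Sum>p\<in>I. b p * (M + 1))"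
    proof (rule sum_mono)
      fix p :: "nat list \<times> bool"
      let ?l = "length (access (fst p))"
      have "?l + (length loop + 1) * (M + ?l) \<le> (?l + (length loop + 1) * (1 + ?l)) * (M + 1)"
        by (simp add: algebra_simps)
      then have "3 * length (tour M p) + 1 \<le> 3 * ((?l + (length loop + 1) * (1 + ?l)) * (M + 1)) + 1"
        using tour_length[of M p] by linarith
      also have "\<dots> \<le> b p * (M + 1)" by (simp add: b_def algebra_simps)
      finally show "3 * length (tour M p) + 1 \<le> b p * (M + 1)" .
    qed
    also have "\<dots> = (A - 1) * (M + 1)" by (simp only: A_def sum_distrib_right add_diff_cancel_right')
    finally have w'len: "length w' \<le> (A - 1) * (M + 1)" using w'(2) by (rule order_trans[rotated])
    have wdC: "wprod \<Gamma> (map drop_lamps w) \<in> carrier \<Gamma>" using wd \<Gamma>.S_carrier by (intro \<Gamma>.wprod_closed) blast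
    obtain v where v: "length v = word_norm \<Gamma> \<Sigma> (wprod \<Gamma> (map drop_lamps w))" "set v \<subseteq> \<Sigma>"
      "wprod \<Gamma> v = wprod \<Gamma> (map drop_lamps w)"
      using \<Gamma>.word_norm_attained[OF wdC] .
    have lv: "length v \<le> M" using v(1) prefix_norm[of w "[]"] by simp
    let ?v = "map (\<lambda>a. lift (snd a)) v"
    have vS: "set ?v \<subseteq> SB" using v(2) snd_Sigma L.letters_Sigma by auto
    have sg: "snd (wprod WB ?v) = g"
      unfolding snd_wprod_map_lift g_def using v(3) snd_wprod_drop[of w] by (simp add: wprod_Gamma)
    have sl: "set (map snd v) \<subseteq> letters" using v(2) snd_Sigma by auto
    have e: "map lift (map snd v) = ?v" by simp
    have "wprod WB ?v = lift (snd (wprod WB ?v))" using lift_wprod[OF sl] unfolding e .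
    also have "\<dots> = lift g" unfolding sg ..
    finally have vg: "wprod WB ?v = lift g" .
    have "(\<lambda>x\<in>tree_boundary d. \<phi> x \<otimes>\<^bsub>bool_grp\<^esub> lamp bool_grp d False (aut_bd id x)) = \<phi>"
      by (rule extensionalityI[of _ "tree_boundary d"]) (use phi in \<open>simp_all add: lamp_bool\<close>)
    then have "(\<phi>, id) \<otimes>\<^bsub>WB\<^esub> lift g = (\<phi>, g)" by (simp add: wreath_mult)
    moreover have "set w' \<subseteq> carrier WB" "set ?v \<subseteq> carrier WB" using w'(1) vS L.Sigma_carrier by blast+
    ultimately have "wprod WB (w' @ ?v) = wprod WB w"
      using L.W.wprod_append[of w' ?v] w'(3) vg by (simp add: \<phi>_def g_def)
    moreover have "set (w' @ ?v) \<subseteq> SB" using w'(1) vS by simp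
    ultimately have "word_norm GB SB (wprod WB w) \<le> length (w' @ ?v)"
      using word_norm_le[of "w' @ ?v" SB GB] by (simp add: L.wprod_Gamma)
    also have "\<dots> \<le> (A - 1) * (M + 1) + (M + 1)" using w'len lv by simp
    also have "\<dots> = A * (M + 1)" by (simp add: A_def)
    finally show ?thesis by (simp add: M_def)
  qed
  then show ?thesis by blast
qed

section \<open>Projection of the lamp walk and comparison of the drifts\<close>

lemma HF_trivial: "HF = (\<lambda>h. (lamp F d \<one>\<^bsub>F\<^esub>, h)) ` H"
  unfolding HF_alt F_trivial by auto

lemma drop_lamps_R: "map_pmf drop_lamps (pmf_of_set (rooted_set bool_grp d)) = pmf_of_set R"
proof -
  have inj: "inj_on drop_lamps (rooted_set bool_grp d)"
    by (rule inj_onI) (auto simp: L.R_alt)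
  have "drop_lamps ` rooted_set bool_grp d = R" by (force simp: L.R_alt R_alt image_image)
  moreover have "rooted_set bool_grp d \<noteq> {}" using L.one_R by blast
  ultimately show ?thesis using map_pmf_of_set_inj[OF inj _ L.finite_R] by simp
qed

lemma drop_lamps_HF: "map_pmf drop_lamps (pmf_of_set (HF_set bool_grp d H)) = pmf_of_set HF"
proof -
  have inj: "inj_on (\<lambda>h. (lamp F d \<one>\<^bsub>F\<^esub>, h)) H" by (rule inj_onI) simp
  have "map_pmf drop_lamps (pmf_of_set (HF_set bool_grp d H))
      = map_pmf (\<lambda>h. (lamp F d \<one>\<^bsub>F\<^esub>, h)) (map_pmf snd (pmf_of_set (HF_set bool_grp d H)))"
    by (simp add: map_pmf_comp)
  also have "\<dots> = pmf_of_set HF"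
    unfolding L.snd_HF_uniform HF_trivial
    by (rule map_pmf_of_set_inj[OF inj _ H_fin]) (use H_id in blast)
  finally show ?thesis .
qed

text \<open>As F is trivial, forgetting the lamps maps uniform letters to uniform letters, so the
  lamp walk projects to the given walk letter by letter.\<close>

lemma drop_lamps_words: "map_pmf (map drop_lamps) (step_words bool_grp d H) = step_words F d H"
proof -
  have "map_pmf (map drop_lamps) (step_words bool_grp d H) =
     do { s \<leftarrow> map_pmf drop_lamps (pmf_of_set (rooted_set bool_grp d));
          a \<leftarrow> map_pmf drop_lamps (pmf_of_set (HF_set bool_grp d H));
          s' \<leftarrow> map_pmf drop_lamps (pmf_of_set (rooted_set bool_grp d));
          return_pmf [s, a, s'] }"
    by (simp add: step_words_def map_bind_pmf bind_map_pmf)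
  then show ?thesis unfolding drop_lamps_R drop_lamps_HF by (simp add: step_words_def)
qed

lemma map_word_law: "word_law (map_pmf (map f) \<nu>) n = map_pmf (map f) (word_law \<nu> n)"
  by (induction n) (auto simp: map_bind_pmf bind_map_pmf map_pmf_comp)

text \<open>The norm is bounded by A times one plus the maximal norm of the projected walk, whose
  expectation is at most 8 plus 9 times the drift; hence the constant 9 A in both places.\<close>

lemma drift_comparison:
  "\<exists>C\<ge>0. \<forall>n. drift GB SB (step_law bool_grp d H) n \<le> C * drift \<Gamma> \<Sigma> (step_law F d H) n + C"
proof -
  interpret walk: symmetric_walk \<Gamma> \<Sigma> "step_words F d H" by (rule symmetric_walk)
  obtain A where A: "\<And>w. set w \<subseteq> SB \<Longrightarrow>
      word_norm GB SB (wprod WB w) \<le> A * (max_norm \<Gamma> \<Sigma> \<one>\<^bsub>\<Gamma>\<^esub> (map drop_lamps w) + 1)"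
    using norm_comparison by blast
  have "drift GB SB (step_law bool_grp d H) n \<le> 9 * real A * drift \<Gamma> \<Sigma> (step_law F d H) n + 9 * real A" for n
  proof -
    have "drift GB SB (step_law bool_grp d H) n
        = measure_pmf.expectation (word_law (step_words bool_grp d H) n) (\<lambda>w. real (word_norm GB SB (wprod GB w)))"
      unfolding L.step_law_words
      by (rule drift_word_law[OF L.\<Gamma>.is_group]) (use L.step_words_Sigma L.\<Gamma>.S_carrier in blast)
    also have "\<dots> \<le> measure_pmf.expectation (word_law (step_words bool_grp d H) n)
        (\<lambda>w. real A + real A * real (max_norm \<Gamma> \<Sigma> \<one>\<^bsub>\<Gamma>\<^esub> (map drop_lamps w)))"
    proof (rule pmf_expectation_mono[OF finite_set_word_law[OF L.finite_step_words]])
      fix w assume w: "w \<in> set_pmf (word_law (step_words bool_grp d H) n)"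
      have "set w \<subseteq> SB" by (rule word_law_set[OF L.step_words_Sigma w])
      from A[OF this] have "real (word_norm GB SB (wprod WB w))
          \<le> real (A * (max_norm \<Gamma> \<Sigma> \<one>\<^bsub>\<Gamma>\<^esub> (map drop_lamps w) + 1))" by (rule of_nat_mono)
      then show "real (word_norm GB SB (wprod GB w))
          \<le> real A + real A * real (max_norm \<Gamma> \<Sigma> \<one>\<^bsub>\<Gamma>\<^esub> (map drop_lamps w))"
        by (simp add: L.wprod_Gamma algebra_simps)
    qed
    also have "\<dots> = walk.E n (\<lambda>w. real A + real A * real (max_norm \<Gamma> \<Sigma> \<one>\<^bsub>\<Gamma>\<^esub> w))"
      by (simp add: drop_lamps_words[symmetric] map_word_law)
    also have "\<dots> \<le> real A + real A * (8 + 9 * walk.E n (\<lambda>w. real (word_norm \<Gamma> \<Sigma> (wprod \<Gamma> w))))"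
      unfolding walk.E_affine using walk.expected_max_norm[of n] by (intro add_left_mono mult_left_mono) auto
    also have "walk.E n (\<lambda>w. real (word_norm \<Gamma> \<Sigma> (wprod \<Gamma> w))) = drift \<Gamma> \<Sigma> (step_law F d H) n"
      unfolding step_law_words
      by (rule drift_word_law[OF \<Gamma>.is_group, symmetric]) (use step_words_Sigma \<Gamma>.S_carrier in blast)
    finally show ?thesis by (simp add: algebra_simps)
  qed
  then show ?thesis by (intro exI[of _ "9 * real A"]) simp
qed

end

section \<open>The dichotomy and the main theorem\<close>

context saturated begin

text \<open>Already the last uniform rooted factor of a step keeps the walk away from the identity.\<close>

lemma drift_lower_bound:
  assumes "1 \<le> n"
  shows "1 / 2 \<le> drift \<Gamma> \<Sigma> (step_law F d H) n"
proof -
  obtain m where m: "n = Suc m" using assms by (cases n) auto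
  have R2: "2 \<le> card R"
  proof -
    let ?t = "Transposition.transpose 1 2 :: nat \<Rightarrow> nat"
    have "?t permutes {1..d 0}" using d_ge2[of 0] by (intro permutes_swap_id) auto
    then have t: "(lamp F d \<one>\<^bsub>F\<^esub>, rooted_aut d ?t) \<in> R" unfolding R_alt by blast
    have "[1] \<in> tree_vertices d" using d_pos[of 0] by (simp add: Cons_tree_vertices)
    then have "rooted_aut d ?t [1] = [2]" by (simp add: rooted_aut_Cons)
    then have "rooted_aut d ?t \<noteq> id" by auto
    then have ne: "(lamp F d \<one>\<^bsub>F\<^esub>, rooted_aut d ?t) \<noteq> \<one>\<^bsub>W\<^esub>" unfolding W_one by simp
    have "card {\<one>\<^bsub>W\<^esub>, (lamp F d \<one>\<^bsub>F\<^esub>, rooted_aut d ?t)} \<le> card R"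
      using t one_R by (intro card_mono finite_R) auto
    then show ?thesis using ne by simp
  qed
  have RC: "s \<in> carrier \<Gamma>" if "s \<in> R" for s using R_Sigma[OF that] \<Gamma>.S_carrier by blast
  \<comment> \<open>At most one s in \<open>R\<close> makes g s trivial, so the mean norm is at
    least 1 - 1/|R|, and \<open>R\<close> contains a transposition besides the identity.\<close>
  have main: "1 / 2 \<le> ER (\<lambda>s. real (word_norm \<Gamma> \<Sigma> (g \<otimes>\<^bsub>\<Gamma>\<^esub> s)))" if g: "g \<in> carrier \<Gamma>" for g
  proof -
    have "real (card R) - 1 \<le> real (card (R - {inv\<^bsub>\<Gamma>\<^esub> g}))"
      using finite_R by (cases "inv\<^bsub>\<Gamma>\<^esub> g \<in> R") (simp_all add: card_Diff_singleton of_nat_diff card_gt_0_iff Suc_le_eq)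
    also have "\<dots> = (\<Sum>s\<in>R - {inv\<^bsub>\<Gamma>\<^esub> g}. 1)" by simp
    also have "\<dots> \<le> (\<Sum>s\<in>R - {inv\<^bsub>\<Gamma>\<^esub> g}. real (word_norm \<Gamma> \<Sigma> (g \<otimes>\<^bsub>\<Gamma>\<^esub> s)))"
    proof (rule sum_mono)
      fix s assume s: "s \<in> R - {inv\<^bsub>\<Gamma>\<^esub> g}"
      then have sC: "s \<in> carrier \<Gamma>" using RC by blast
      have "g \<otimes>\<^bsub>\<Gamma>\<^esub> s \<noteq> \<one>\<^bsub>\<Gamma>\<^esub>"
      proof
        assume "g \<otimes>\<^bsub>\<Gamma>\<^esub> s = \<one>\<^bsub>\<Gamma>\<^esub>"
        then have "inv\<^bsub>\<Gamma>\<^esub> s = g" by (rule \<Gamma>.inv_equality[OF _ sC g])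
        then show False using s sC by auto
      qed
      then show "1 \<le> real (word_norm \<Gamma> \<Sigma> (g \<otimes>\<^bsub>\<Gamma>\<^esub> s))"
        using \<Gamma>.word_norm_pos[OF \<Gamma>.m_closed[OF g sC]] by linarith
    qed
    also have "\<dots> \<le> (\<Sum>s\<in>R. real (word_norm \<Gamma> \<Sigma> (g \<otimes>\<^bsub>\<Gamma>\<^esub> s)))"
      by (rule sum_mono2[OF finite_R]) auto
    finally have "real (card R) - 1 \<le> (\<Sum>s\<in>R. real (word_norm \<Gamma> \<Sigma> (g \<otimes>\<^bsub>\<Gamma>\<^esub> s)))" .
    moreover have avg: "ER (\<lambda>s. real (word_norm \<Gamma> \<Sigma> (g \<otimes>\<^bsub>\<Gamma>\<^esub> s)))
        = (\<Sum>s\<in>R. real (word_norm \<Gamma> \<Sigma> (g \<otimes>\<^bsub>\<Gamma>\<^esub> s))) / real (card R)"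
      using one_R finite_R by (intro integral_pmf_of_set) auto
    moreover have "real (card R) / 2 \<le> real (card R) - 1" using R2 by simp
    ultimately have "1 / 2 * real (card R) \<le> (\<Sum>s\<in>R. real (word_norm \<Gamma> \<Sigma> (g \<otimes>\<^bsub>\<Gamma>\<^esub> s)))" by linarith
    then have "1 / 2 \<le> (\<Sum>s\<in>R. real (word_norm \<Gamma> \<Sigma> (g \<otimes>\<^bsub>\<Gamma>\<^esub> s))) / real (card R)"
      using R2 by (subst pos_le_divide_eq) auto
    then show ?thesis unfolding avg .
  qed
  have "drift \<Gamma> \<Sigma> (step_law F d H) n
     = measure_pmf.expectation (word_law (step_words F d H) (Suc m)) (\<lambda>w. real (word_norm \<Gamma> \<Sigma> (wprod \<Gamma> w)))"
    unfolding m step_law_words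
    by (rule drift_word_law[OF \<Gamma>.is_group]) (use step_words_Sigma \<Gamma>.S_carrier in blast)
  also have "\<dots> = measure_pmf.expectation (word_law (step_words F d H) m)
      (\<lambda>u. ER (\<lambda>s. EK (\<lambda>a. ER (\<lambda>s'. real (word_norm \<Gamma> \<Sigma> (wprod \<Gamma> (u @ [s, a, s'])))))))"
    unfolding word_law.simps(2)
    by (subst expectation_bind_pmf)
       (use finite_set_word_law[OF finite_step_words] finite_step_words in \<open>auto simp: expectation_step_words\<close>)
  also have "\<dots> \<ge> measure_pmf.expectation (word_law (step_words F d H) m) (\<lambda>u. ER (\<lambda>s. EK (\<lambda>a. 1 / 2)))"
  proof (intro pmf_expectation_mono[OF finite_set_word_law[OF finite_step_words]] ER_mono EK_mono)
    fix u s a assume u: "u \<in> set_pmf (word_law (step_words F d H) m)" and s: "s \<in> R" and a: "a \<in> HF"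
    have "set u \<subseteq> \<Sigma>" using word_law_set[OF step_words_Sigma u] .
    then have C: "set (u @ [s, a]) \<subseteq> carrier \<Gamma>"
      using R_Sigma[OF s] HF_Sigma[OF a] \<Gamma>.S_carrier by auto
    have "wprod \<Gamma> (u @ [s, a, s']) = wprod \<Gamma> (u @ [s, a]) \<otimes>\<^bsub>\<Gamma>\<^esub> s'" if "s' \<in> R" for s'
      using \<Gamma>.wprod_append[OF C, of "[s']"] RC[OF that] by simp
    then have "ER (\<lambda>s'. real (word_norm \<Gamma> \<Sigma> (wprod \<Gamma> (u @ [s, a, s']))))
        = ER (\<lambda>s'. real (word_norm \<Gamma> \<Sigma> (wprod \<Gamma> (u @ [s, a]) \<otimes>\<^bsub>\<Gamma>\<^esub> s')))"
      by (intro ER_cong) simp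
    then show "1 / 2 \<le> ER (\<lambda>s'. real (word_norm \<Gamma> \<Sigma> (wprod \<Gamma> (u @ [s, a, s']))))"
      using main[OF \<Gamma>.wprod_closed[OF C]] by simp
  qed
  finally show ?thesis by simp
qed

lemma card_Kgrp: "card (carrier (Kgrp k)) = card (sec k ` H) * card (carrier F)"
proof -
  have "carrier (Kgrp k) = (sec k ` H) \<times> carrier F"
    by (force simp: Kgrp_def HF_alt image_image)
  then show ?thesis by (simp add: card_cartesian_product)
qed

text \<open>A section at 1^k determines the label at the special vertex 1^(l-1)2, which lies below
  1^k, and by saturation this label takes every value in the symmetric group.\<close>

lemma card_sec_ge:
  assumes "k < l"
  shows "fact (d l) \<le> card (sec k ` H)"
proof -
  define p where "p = replicate (l - 1) 1 @ [2 :: nat]"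
  define p' where "p' = replicate (l - 1 - k) 1 @ [2 :: nat]"
  have pp: "p = replicate k 1 @ p'" using assms by (simp add: p_def p'_def flip: replicate_add append_assoc)
  define lab where "lab s = (\<lambda>i. if 1 \<le> i \<and> i \<le> d l then last (s (p' @ [i])) else i)" for s :: "nat list \<Rightarrow> nat list"
  have plen: "length p = l" using assms by (simp add: p_def)
  have lab: "aut_label d h p = lab (sec k h)" if h: "h \<in> H" for h
  proof
    fix i
    show "aut_label d h p i = lab (sec k h) i"
    proof (cases "1 \<le> i \<and> i \<le> d l")
      case True
      have "replicate (l - 1) (Suc 0) @ [2] \<in> tree_vertices d"
        using d_ge2[of "l - 1"] by (simp add: snoc_tree_vertices)
      then have "p \<in> tree_vertices d" by (simp add: p_def)
      then have V: "p @ [i] \<in> tree_vertices d" unfolding snoc_tree_vertices using True plen by simp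
      have "h (p @ [i]) = replicate k 1 @ sec k h (p' @ [i])" unfolding pp append_assoc by (rule H_sec[OF h])
      moreover have "length (h (p @ [i])) = Suc l" using tree_autD(2)[OF H_aut[OF h] V] plen by simp
      ultimately have "sec k h (p' @ [i]) \<noteq> []" "last (h (p @ [i])) = last (sec k h (p' @ [i]))"
        using assms by (auto simp: last_append)
      then show ?thesis using True by (simp add: aut_label_def lab_def plen)
    qed (auto simp: aut_label_def lab_def plen)
  qed
  have "{q. q permutes {1..d l}} \<subseteq> lab ` sec k ` H"
  proof
    fix q assume "q \<in> {q. q permutes {1..d l}}"
    then obtain h where "h \<in> H" "aut_label d h p = q"
      using H_label_surj[of l q] assms unfolding p_def by auto
    then show "q \<in> lab ` sec k ` H" using lab by (metis image_eqI)
  qed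
  then have "card {q. q permutes {1..d l}} \<le> card (sec k ` H)"
    using H_fin by (intro surj_card_le) auto
  then show ?thesis by (simp add: card_permutations)
qed

lemma fact_d_ge2: "(2 :: nat) \<le> fact (d l)"
  using fact_mono_nat[OF d_ge2[of l]] by (simp add: numeral_2_eq_2)

text \<open>The section at the next vertex of the ray is determined by the one above it.\<close>

lemma card_sec_Suc: "card (sec (Suc k) ` H) \<le> card (sec k ` H)"
proof -
  have "sec (Suc k) h = (\<lambda>y. drop 1 (sec k h (1 # y)))" if h: "h \<in> H" for h
  proof
    fix y
    have "sec (Suc k) h y = drop (Suc k) (h (replicate k 1 @ (1 # y)))"
      by (simp add: sec_def replicate_app_Cons_same)
    also have "\<dots> = drop 1 (sec k h (1 # y))" unfolding H_sec[OF h] by simp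
    finally show "sec (Suc k) h y = drop 1 (sec k h (1 # y))" .
  qed
  then have "sec (Suc k) ` H = (\<lambda>s y. drop 1 (s (1 # y))) ` sec k ` H" by (simp add: image_image)
  then show ?thesis using card_image_le[of "sec k ` H"] H_fin by simp
qed

lemma approximated:
  assumes big: "\<And>k. 4 \<le> k \<Longrightarrow> 3 \<le> card (carrier (Kgrp k))"
  shows "approximated_group \<Gamma> \<Sigma> (step_words F d H) act Zs"
proof (intro approximated_group.intro approximated_group_axioms.intro)
  show "symmetric_walk \<Gamma> \<Sigma> (step_words F d H)" by (rule symmetric_walk)
  show "finite (Zs k L)" for k L by (rule finite_Zs)
  show "act k L s permutes Zs k L" if "4 \<le> k" "s \<in> \<Sigma>" for k L s
    by (rule act_permutes) (use that in auto)
  show "run (act k L) w z = z"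
    if "set w \<subseteq> \<Sigma>" "length w < k" "wprod \<Gamma> w = \<one>\<^bsub>\<Gamma>\<^esub>" "4 \<le> k" for w k L z
    by (rule act_local) (use that in \<open>auto simp: wprod_Gamma one_Gamma\<close>)
  show "\<exists>c>0. \<forall>N. \<exists>n\<ge>N. \<exists>L z\<^sub>0. \<exists>\<rho>::_ \<Rightarrow> nat. (\<forall>s\<in>\<Sigma>. \<forall>z. \<rho> (act k L s z) \<le> \<rho> z + 1) \<and>
        c * real n \<le> measure_pmf.expectation (word_law (step_words F d H) n) (\<lambda>w. real (\<rho> (run (act k L) w z\<^sub>0)))
                      - real (\<rho> z\<^sub>0)" if "4 \<le> k" for k
    by (rule act_drift) (use that big[OF that] in auto)
qed

text \<open>Adds what holds for any marked extension: \<pi> is onto because its image contains the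
  generators, it does not increase norms, and C is the largest norm of a step.\<close>

lemma oscillating_extension:
  fixes \<Delta> :: "nat monoid"
  assumes m: "marked_group \<Delta> S'" and pi: "\<pi> \<in> hom \<Delta> \<Gamma>" and bij: "bij_betw \<pi> S' \<Sigma>"
    and mu: "set_pmf \<mu>' \<subseteq> carrier \<Delta>" "finite (set_pmf \<mu>')"
      "\<forall>x\<in>carrier \<Delta>. pmf \<mu>' (inv\<^bsub>\<Delta>\<^esub> x) = pmf \<mu>' x" "map_pmf \<pi> \<mu>' = step_law F d H"
    and ns: "\<exists>ns :: nat \<Rightarrow> nat. strict_mono ns \<and> (\<forall>i. drift \<Delta> S' \<mu>' (ns i) \<le> L1 (ns i))"
    and ms: "\<exists>ms :: nat \<Rightarrow> nat. strict_mono ms \<and> (\<forall>i. L2 (ms i) \<le> drift \<Delta> S' \<mu>' (ms i))"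
  shows "\<exists>(\<Delta> :: nat monoid) \<Sigma>' \<pi> \<mu>' (C :: real).
      group \<Delta> \<and> finite \<Sigma>' \<and> \<Sigma>' \<subseteq> carrier \<Delta> \<and> (\<forall>s\<in>\<Sigma>'. inv\<^bsub>\<Delta>\<^esub> s \<in> \<Sigma>')
      \<and> generate \<Delta> \<Sigma>' = carrier \<Delta>
      \<and> \<pi> \<in> hom \<Delta> \<Gamma> \<and> \<pi> ` carrier \<Delta> = carrier \<Gamma>
      \<and> bij_betw \<pi> \<Sigma>' \<Sigma>
      \<and> set_pmf \<mu>' \<subseteq> carrier \<Delta> \<and> finite (set_pmf \<mu>')
      \<and> (\<forall>x\<in>carrier \<Delta>. pmf \<mu>' (inv\<^bsub>\<Delta>\<^esub> x) = pmf \<mu>' x)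
      \<and> map_pmf \<pi> \<mu>' = step_law F d H
      \<and> (\<forall>n. drift \<Gamma> \<Sigma> (step_law F d H) n \<le> drift \<Delta> \<Sigma>' \<mu>' n
             \<and> drift \<Delta> \<Sigma>' \<mu>' n \<le> C * real n)
      \<and> (\<exists>ns :: nat \<Rightarrow> nat. strict_mono ns \<and> (\<forall>i. drift \<Delta> \<Sigma>' \<mu>' (ns i) \<le> L1 (ns i)))
      \<and> (\<exists>ms :: nat \<Rightarrow> nat. strict_mono ms \<and> (\<forall>i. L2 (ms i) \<le> drift \<Delta> \<Sigma>' \<mu>' (ms i)))"
proof -
  interpret \<Delta>: marked_group \<Delta> S' by (rule m)
  interpret h: group_hom \<Delta> \<Gamma> \<pi> using pi by unfold_locales
  have im: "\<pi> ` S' = \<Sigma>" using bij by (simp add: bij_betw_def)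
  have surj: "\<pi> ` carrier \<Delta> = carrier \<Gamma>"
    using h.generate_img[OF \<Delta>.S_carrier] unfolding \<Delta>.gen_S im \<Gamma>.gen_S by (rule sym)
  define B where "B = Max (word_norm \<Delta> S' ` set_pmf \<mu>')"
  have B: "word_norm \<Delta> S' x \<le> B" if "x \<in> set_pmf \<mu>'" for x
    unfolding B_def using that mu(2) by simp
  have lo: "drift \<Gamma> \<Sigma> (step_law F d H) n \<le> drift \<Delta> S' \<mu>' n" for n
    using drift_hom_le[OF m marked_Gamma pi _ mu(1,2), of n] im mu(4) by simp
  have hi: "drift \<Delta> S' \<mu>' n \<le> real B * real n" for n by (rule drift_le_linear[OF m mu(1,2) B])
  show ?thesis
    by (rule exI[of _ \<Delta>], rule exI[of _ S'], rule exI[of _ \<pi>], rule exI[of _ \<mu>'], rule exI[of _ "real B"], intro conjI)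
       (fact \<Delta>.is_group \<Delta>.fin_S \<Delta>.S_carrier \<Delta>.gen_S pi surj bij mu ns ms
         | (use \<Delta>.inv_S lo hi in blast))+
qed

text \<open>For n at least 1 the drift is at least 1/2, so an additive constant K costs at most 2|K|
  times the drift, which a ratio tending to infinity absorbs.\<close>

lemma growth_condition:
  fixes L1 :: "nat \<Rightarrow> real"
  assumes "filterlim (\<lambda>n. L1 n / drift \<Gamma> \<Sigma> (step_law F d H) n) at_top sequentially"
  shows "\<exists>n\<ge>N. a * drift \<Gamma> \<Sigma> (step_law F d H) n + K \<le> L1 n"
proof -
  define B where "B = \<bar>a\<bar> + 2 * \<bar>K\<bar>"
  have "eventually (\<lambda>n. B \<le> L1 n / drift \<Gamma> \<Sigma> (step_law F d H) n) sequentially"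
    using assms by (simp add: filterlim_at_top)
  then obtain N0 where N0: "\<And>n. n \<ge> N0 \<Longrightarrow> B \<le> L1 n / drift \<Gamma> \<Sigma> (step_law F d H) n"
    by (auto simp: eventually_sequentially)
  define n where "n = max 1 (max N N0)"
  define x where "x = drift \<Gamma> \<Sigma> (step_law F d H) n"
  have x: "1 / 2 \<le> x" unfolding x_def by (rule drift_lower_bound) (simp add: n_def)
  have "B \<le> L1 n / x" using N0[of n] by (simp add: n_def x_def)
  then have "B * x \<le> L1 n" using x by (simp add: field_simps)
  moreover have "a * x \<le> \<bar>a\<bar> * x" using x by (intro mult_right_mono) auto
  moreover have "2 * \<bar>K\<bar> * (1 / 2) \<le> 2 * \<bar>K\<bar> * x" using x by (intro mult_left_mono) auto
  then have "K \<le> 2 * \<bar>K\<bar> * x" by linarith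
  ultimately have "a * x + K \<le> L1 n" by (simp add: B_def distrib_right)
  then show ?thesis by (intro exI[of _ n]) (simp add: n_def x_def)
qed

end

section \<open>Thinning out the generating set of the lamp extension\<close>

lemma change_of_generators:
  assumes m: "marked_group G S" and T: "T \<subseteq> S" "\<And>t. t \<in> T \<Longrightarrow> inv\<^bsub>G\<^esub> t \<in> T"
    and two: "\<And>s. s \<in> S \<Longrightarrow> \<exists>w. set w \<subseteq> T \<and> length w \<le> 2 \<and> wprod G w = s"
    and mu: "set_pmf \<mu> \<subseteq> carrier G" "finite (set_pmf \<mu>)"
  shows "marked_group G T" "drift G T \<mu> n \<le> 2 * drift G S \<mu> n" "drift G S \<mu> n \<le> drift G T \<mu> n"
proof -
  interpret marked_group G S by (rule m)
  have TC: "T \<subseteq> carrier G" using T(1) S_carrier by blast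
  have words: "\<exists>v. set v \<subseteq> T \<and> length v \<le> 2 * length w \<and> wprod G v = wprod G w" if "set w \<subseteq> S" for w
    using that
  proof (induction w)
    case Nil
    show ?case by (rule exI[of _ "[]"]) simp
  next
    case (Cons a w)
    then obtain v where v: "set v \<subseteq> T" "length v \<le> 2 * length w" "wprod G v = wprod G w" by auto
    obtain u where u: "set u \<subseteq> T" "length u \<le> 2" "wprod G u = a" using two[of a] Cons.prems by auto
    have "set u \<subseteq> carrier G" "set v \<subseteq> carrier G" using u v TC by blast+
    then have "wprod G (u @ v) = wprod G (a # w)" by (simp add: wprod_append u v)
    then show ?case using u v by (intro exI[of _ "u @ v"]) simp
  qed
  have norm: "word_norm G T g \<le> 2 * word_norm G S g" if g: "g \<in> carrier G" for g
  proof -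
    obtain w where w: "length w = word_norm G S g" "set w \<subseteq> S" "wprod G w = g" using word_norm_attained[OF g] .
    obtain v where "set v \<subseteq> T" "length v \<le> 2 * length w" "wprod G v = wprod G w" using words[OF w(2)] by blast
    then show ?thesis using word_norm_le[of v T G] w by simp
  qed
  have "carrier G \<subseteq> generate G T"
  proof
    fix g assume "g \<in> carrier G"
    then obtain w where "set w \<subseteq> S" "g = wprod G w" using carrier_wprod by blast
    then obtain v where "set v \<subseteq> T" "g = wprod G v" using words by metis
    then show "g \<in> generate G T" using wprod_in_generate by simp
  qed
  then have gen: "generate G T = carrier G" using generate_in_carrier[OF TC] by blast
  show mT: "marked_group G T"
    by (intro marked_group.intro marked_group_axioms.intro)
       (use is_group finite_subset[OF T(1) fin_S] TC T(2) gen in auto)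
  note fin = finite_set_conv_pow[OF mu(2), of G n]
  have "drift G T \<mu> n \<le> measure_pmf.expectation (conv_pow G \<mu> n) (\<lambda>g. 2 * real (word_norm G S g))"
    unfolding drift_def
  proof (rule pmf_expectation_mono[OF fin])
    fix g assume "g \<in> set_pmf (conv_pow G \<mu> n)"
    then have "g \<in> carrier G" using conv_pow_carrier[OF mu(1)] by blast
    from norm[OF this] show "real (word_norm G T g) \<le> 2 * real (word_norm G S g)" by linarith
  qed
  then show "drift G T \<mu> n \<le> 2 * drift G S \<mu> n" by (simp add: drift_def)
  have "(\<lambda>x. x) \<in> hom G G" by (simp add: hom_def)
  from drift_hom_le[OF mT m this _ mu, of n] T(1) show "drift G S \<mu> n \<le> drift G T \<mu> n" by simp
qed

context degenerate begin

definition lamp_switch :: "((nat \<Rightarrow> nat) \<Rightarrow> bool) \<times> (nat list \<Rightarrow> nat list)" where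
  "lamp_switch = (lamp bool_grp d True, id)"

text \<open>The lamp switch takes the place of the identity, so that \<open>drop_lamps\<close> is a bijection
  from this generating set onto \<open>\<Sigma>\<close>.\<close>

definition reduced_gens :: "(((nat \<Rightarrow> nat) \<Rightarrow> bool) \<times> (nat list \<Rightarrow> nat list)) set" where
  "reduced_gens = lift ` (letters - {id}) \<union> {lamp_switch}"

lemma lamp_switch_SB: "lamp_switch \<in> SB"
  unfolding lamp_switch_def by (rule L.HF_Sigma[OF L.HF_I]) simp_all

lemma reduced_gens_SB: "reduced_gens \<subseteq> SB"
  using lamp_switch_SB L.letters_Sigma by (auto simp: reduced_gens_def)

lemma lift_inv:
  assumes g: "g \<in> letters" and ne: "g \<noteq> id"
  shows "inv\<^bsub>WB\<^esub> (lift g) \<in> reduced_gens"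
proof -
  obtain g' where g': "g' \<in> letters" "g' \<circ> g = id" using letters_inv[OF g] by blast
  have C: "lift g \<in> carrier WB" "lift g' \<in> carrier WB"
    using L.letters_Sigma[OF g] L.letters_Sigma[OF g'(1)] L.Sigma_carrier by auto
  have "lift g \<otimes>\<^bsub>WB\<^esub> lift g' = lift (g' \<circ> g)" using L.rooted_mult[OF letters_aut[OF g], of g'] by simp
  also have "\<dots> = \<one>\<^bsub>WB\<^esub>" unfolding g'(2) L.W_one by (simp add: id_def)
  finally have "lift g \<otimes>\<^bsub>WB\<^esub> lift g' = \<one>\<^bsub>WB\<^esub>" .
  then have "lift g' = inv\<^bsub>WB\<^esub> (lift g)" using L.W.inv_unique'[OF C] L.W.inv_comm[OF _ C] by blast
  moreover have "g' \<noteq> id" using g'(2) ne by auto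
  ultimately show ?thesis using g'(1) unfolding reduced_gens_def by (metis DiffI UnI1 imageI singletonD)
qed

lemma lamp_switch_inv: "inv\<^bsub>WB\<^esub> lamp_switch = lamp_switch"
proof (rule L.W.inv_equality)
  have "lamp_switch \<otimes>\<^bsub>WB\<^esub> lamp_switch = (lamp bool_grp d False, id)"
    unfolding lamp_switch_def using L.lamp_mult[OF H_id, of True True id] by simp
  then show "lamp_switch \<otimes>\<^bsub>WB\<^esub> lamp_switch = \<one>\<^bsub>WB\<^esub>" unfolding L.W_one by simp
qed (use lamp_switch_SB L.Sigma_carrier in auto)

lemma reduced_gens_inv:
  assumes "a \<in> reduced_gens" shows "inv\<^bsub>GB\<^esub> a \<in> reduced_gens"
proof -
  have "inv\<^bsub>GB\<^esub> a = inv\<^bsub>WB\<^esub> a" using L.inv_Gamma reduced_gens_SB assms by blast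
  moreover have "inv\<^bsub>WB\<^esub> a \<in> reduced_gens"
    using assms lift_inv lamp_switch_inv unfolding reduced_gens_def by auto
  ultimately show ?thesis by simp
qed

lemma Sigma_lift: "\<Sigma> = (\<lambda>g. (lamp F d \<one>\<^bsub>F\<^esub>, g)) ` letters"
proof (intro equalityI subsetI)
  fix a assume "a \<in> \<Sigma>"
  then show "a \<in> (\<lambda>g. (lamp F d \<one>\<^bsub>F\<^esub>, g)) ` letters"
    using F_trivial by (cases rule: Sigma_cases) (auto simp: letters_def)
qed (auto intro: letters_Sigma)

lemma drop_lamps_bij: "bij_betw drop_lamps reduced_gens \<Sigma>"
proof (rule bij_betw_imageI)
  show "inj_on drop_lamps reduced_gens"
    by (rule inj_onI) (auto simp: reduced_gens_def lamp_switch_def)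
  have "id \<in> letters" by (simp add: letters_def)
  then show "drop_lamps ` reduced_gens = \<Sigma>"
    unfolding Sigma_lift by (force simp: reduced_gens_def lamp_switch_def image_Un image_image)
qed

lemma drop_wprod: "set w \<subseteq> SB \<Longrightarrow> drop_lamps (wprod WB w) = wprod W (map drop_lamps w)"
proof (induction w)
  case Nil
  show ?case unfolding list.map wprod_Nil W_one by (simp add: wreath_one id_def)
next
  case (Cons a w)
  have a: "snd a \<in> tree_aut d" using L.Sigma_aut Cons.prems by simp
  have "wprod W (map drop_lamps (a # w)) = drop_lamps a \<otimes>\<^bsub>W\<^esub> drop_lamps (wprod WB w)"
    using Cons by simp
  also have "\<dots> = (lamp F d \<one>\<^bsub>F\<^esub>, snd (wprod WB w) \<circ> snd a)" by (rule rooted_mult[OF a])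
  finally show ?case by (simp add: snd_wreath_mult o_def)
qed

lemma drop_lamps_hom: "drop_lamps \<in> hom GB \<Gamma>"
proof (rule homI)
  have words: "\<exists>w. set w \<subseteq> SB \<and> x = wprod WB w" if "x \<in> carrier GB" for x
    using that L.\<Gamma>.carrier_wprod by (auto simp: L.wprod_Gamma)
  show "drop_lamps x \<in> carrier \<Gamma>" if x: "x \<in> carrier GB" for x
  proof -
    obtain w where w: "set w \<subseteq> SB" "x = wprod WB w" using words[OF x] by blast
    have "set (map drop_lamps w) \<subseteq> carrier \<Gamma>" using w(1) drop_lamps_Sigma \<Gamma>.S_carrier by auto
    then have "wprod \<Gamma> (map drop_lamps w) \<in> carrier \<Gamma>" by (rule \<Gamma>.wprod_closed)
    then show ?thesis unfolding w(2) drop_wprod[OF w(1)] by (simp only: wprod_Gamma)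
  qed
  fix x y assume x: "x \<in> carrier GB"
  obtain w where w: "set w \<subseteq> SB" "x = wprod WB w" using words[OF x] by blast
  have "drop_lamps x \<otimes>\<^bsub>W\<^esub> drop_lamps y = (lamp F d \<one>\<^bsub>F\<^esub>, snd y \<circ> snd x)"
    unfolding w(2) by (rule rooted_mult[OF L.wprod_aut[OF w(1)]])
  then show "drop_lamps (x \<otimes>\<^bsub>GB\<^esub> y) = drop_lamps x \<otimes>\<^bsub>\<Gamma>\<^esub> drop_lamps y"
    by (simp add: mult_Gamma L.mult_Gamma snd_wreath_mult)
qed

text \<open>At least two sections, distinguished by a label one level deeper, times two lamp
  values.\<close>

lemma card_Kgrp_bool: "3 \<le> card (carrier (L.Kgrp j))"
proof -
  have "2 \<le> card (sec j ` H)" using fact_d_ge2[of "Suc j"] card_sec_ge[of j "Suc j"] by simp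
  then show ?thesis unfolding L.card_Kgrp by simp
qed

text \<open>The diagonal product is formed over the lamp group, with L1 replaced by L1/2: passing to
  the generators that lie over \<open>reduced_gens\<close> at most doubles the norm, which this
  factor compensates. Lower bounds only improve with fewer generators.\<close>

lemma oscillation:
  fixes L1 L2 :: "nat \<Rightarrow> real"
  assumes L1: "filterlim (\<lambda>n. L1 n / drift \<Gamma> \<Sigma> (step_law F d H) n) at_top sequentially"
    and L2: "(\<lambda>n. L2 n / real n) \<longlonglongrightarrow> 0"
  shows "\<exists>(\<Delta> :: nat monoid) S' \<pi> \<mu>'. marked_group \<Delta> S' \<and> \<pi> \<in> hom \<Delta> \<Gamma> \<and> bij_betw \<pi> S' \<Sigma> \<and>
     set_pmf \<mu>' \<subseteq> carrier \<Delta> \<and> finite (set_pmf \<mu>') \<and>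
     (\<forall>x\<in>carrier \<Delta>. pmf \<mu>' (inv\<^bsub>\<Delta>\<^esub> x) = pmf \<mu>' x) \<and> map_pmf \<pi> \<mu>' = step_law F d H \<and>
     (\<exists>ns :: nat \<Rightarrow> nat. strict_mono ns \<and> (\<forall>i. drift \<Delta> S' \<mu>' (ns i) \<le> L1 (ns i))) \<and>
     (\<exists>ms :: nat \<Rightarrow> nat. strict_mono ms \<and> (\<forall>i. L2 (ms i) \<le> drift \<Delta> S' \<mu>' (ms i)))"
proof -
  interpret A: approximated_group GB SB "step_words bool_grp d H" L.act L.Zs
    by (rule L.approximated) (rule card_Kgrp_bool)
  obtain C where C: "\<And>n. drift GB SB (step_law bool_grp d H) n \<le> C * drift \<Gamma> \<Sigma> (step_law F d H) n + C"
    using drift_comparison by blast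
  have "\<exists>n\<ge>N. drift GB SB A.step n + K \<le> L1 n / 2" for K N
  proof -
    obtain n where n: "n \<ge> N" "2 * C * drift \<Gamma> \<Sigma> (step_law F d H) n + (2 * C + 2 * K) \<le> L1 n"
      using growth_condition[OF L1] by blast
    have "drift GB SB A.step n + K \<le> L1 n / 2"
      using C[of n] n(2) unfolding L.step_law_words by linarith
    then show ?thesis using n(1) by blast
  qed
  from A.diagonal_product[OF this L2] obtain \<Delta> :: "nat monoid" and S' \<pi> \<mu>' where
    m: "marked_group \<Delta> S'" and pi: "\<pi> \<in> hom \<Delta> GB" and bij: "bij_betw \<pi> S' SB"
    and rel: "\<And>a b c. a \<in> S' \<Longrightarrow> b \<in> S' \<Longrightarrow> c \<in> S' \<Longrightarrow> \<pi> a \<otimes>\<^bsub>GB\<^esub> \<pi> b = \<pi> c \<Longrightarrow> a \<otimes>\<^bsub>\<Delta>\<^esub> b = c"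
    and mu: "set_pmf \<mu>' \<subseteq> carrier \<Delta>" "finite (set_pmf \<mu>')"
     "\<forall>x\<in>carrier \<Delta>. pmf \<mu>' (inv\<^bsub>\<Delta>\<^esub> x) = pmf \<mu>' x" "map_pmf \<pi> \<mu>' = A.step"
    and ns: "\<exists>ns :: nat \<Rightarrow> nat. strict_mono ns \<and> (\<forall>i. drift \<Delta> S' \<mu>' (ns i) \<le> L1 (ns i) / 2)"
    and ms: "\<exists>ms :: nat \<Rightarrow> nat. strict_mono ms \<and> (\<forall>i. L2 (ms i) \<le> drift \<Delta> S' \<mu>' (ms i))"
    by blast
  interpret \<Delta>: marked_group \<Delta> S' by (rule m)
  interpret h: group_hom \<Delta> GB \<pi> using pi by unfold_locales
  define T where "T = {s \<in> S'. \<pi> s \<in> reduced_gens}"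
  have preimage: "\<exists>s\<in>S'. \<pi> s = a" if "a \<in> SB" for a
    using bij that unfolding bij_betw_def by (metis imageE)
  have piS: "\<pi> s \<in> SB" if "s \<in> S'" for s using bij that by (auto simp: bij_betw_def)
  have T_inv: "inv\<^bsub>\<Delta>\<^esub> t \<in> T" if "t \<in> T" for t
  proof -
    have t: "t \<in> S'" "\<pi> t \<in> reduced_gens" using that by (auto simp: T_def)
    have "t \<in> carrier \<Delta>" using t(1) \<Delta>.S_carrier by blast
    then have "\<pi> (inv\<^bsub>\<Delta>\<^esub> t) = inv\<^bsub>GB\<^esub> (\<pi> t)" by simp
    then show ?thesis using reduced_gens_inv[OF t(2)] \<Delta>.inv_S[OF t(1)] by (simp add: T_def)
  qed
  \<comment> \<open>Relations among letters persist in \<Delta>, so the letter over the identity is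
    idempotent.\<close>
  have one: "s = \<one>\<^bsub>\<Delta>\<^esub>" if s: "s \<in> S'" "\<pi> s = \<one>\<^bsub>WB\<^esub>" for s
  proof -
    have sC: "s \<in> carrier \<Delta>" using s(1) \<Delta>.S_carrier by blast
    have "s \<otimes>\<^bsub>\<Delta>\<^esub> s = s" by (rule rel[OF s(1) s(1) s(1)]) (simp add: s(2) L.mult_Gamma)
    then show ?thesis using sC by simp
  qed
  have two: "\<exists>w. set w \<subseteq> T \<and> length w \<le> 2 \<and> wprod \<Delta> w = s" if s: "s \<in> S'" for s
  proof -
    have single: "\<exists>w. set w \<subseteq> T \<and> length w \<le> 2 \<and> wprod \<Delta> w = t" if "t \<in> T" for t
    proof -
      have "t \<in> carrier \<Delta>" using that \<Delta>.S_carrier by (auto simp: T_def)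
      then show ?thesis using that by (intro exI[of _ "[t]"]) simp
    qed
    have lampless: "\<exists>w. set w \<subseteq> T \<and> length w \<le> 2 \<and> wprod \<Delta> w = t"
      if t: "t \<in> S'" "\<pi> t = lift g" "g \<in> letters" for t g
    proof (cases "g = id")
      case True
      then have "\<pi> t = \<one>\<^bsub>WB\<^esub>" unfolding L.W_one using t(2) by simp
      then have "t = \<one>\<^bsub>\<Delta>\<^esub>" by (rule one[OF t(1)])
      then show ?thesis by (intro exI[of _ "[]"]) simp
    next
      case False
      then have "t \<in> T" using t unfolding T_def reduced_gens_def by blast
      then show ?thesis by (rule single)
    qed
    from piS[OF s] show ?thesis
    proof (cases rule: L.Sigma_cases)
      case (R \<tau>)
      have "rooted_aut d \<tau> \<in> letters" using R(1) by (auto simp: letters_def)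
      then show ?thesis using lampless[OF s] R(2) by simp
    next
      case (HF f h)
      have hl: "h \<in> letters" using HF(2) by (simp add: letters_def)
      show ?thesis
      proof (cases "f \<and> h \<noteq> id")
        case False
        show ?thesis
        proof (cases f)
          case True
          then have "\<pi> s = lamp_switch" using False HF(3) by (simp add: lamp_switch_def)
          then have "s \<in> T" using s by (simp add: T_def reduced_gens_def)
          then show ?thesis by (rule single)
        next
          case False
          then have "\<pi> s = lift h" using HF(3) by simp
          then show ?thesis using lampless[OF s _ hl] by simp
        qed
      next
        case True
        obtain a where a: "a \<in> S'" "\<pi> a = lamp_switch" using preimage[OF lamp_switch_SB] by blast
        obtain b where b: "b \<in> S'" "\<pi> b = lift h" using preimage[of "lift h"] L.letters_Sigma[OF hl] by auto
        \<comment> \<open>The same persistence: a letter with both a lamp and an automorphism part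
          equals, already in \<Delta>, the product of the letters over the lamp switch and over the
          lampless part.\<close>
        have "lamp_switch \<otimes>\<^bsub>WB\<^esub> lift h = (lamp bool_grp d True, h)"
          unfolding lamp_switch_def using L.lamp_mult[OF H_id, of True False h] by simp
        then have "a \<otimes>\<^bsub>\<Delta>\<^esub> b = s"
          by (intro rel a(1) b(1) s) (use a(2) b(2) HF(3) True in \<open>simp add: L.mult_Gamma\<close>)
        moreover have "a \<in> T" "b \<in> T" using a b hl True by (auto simp: T_def reduced_gens_def)
        moreover have "b \<in> carrier \<Delta>" using b(1) \<Delta>.S_carrier by blast
        ultimately show ?thesis by (intro exI[of _ "[a, b]"]) simp
      qed
    qed
  qed
  have TS: "T \<subseteq> S'" by (auto simp: T_def)
  note change = change_of_generators[OF m TS T_inv two mu(1,2)]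
  have "bij_betw \<pi> T reduced_gens"
  proof -
    have "\<pi> ` T = reduced_gens"
    proof (intro equalityI subsetI)
      fix a assume a: "a \<in> reduced_gens"
      then obtain s where "s \<in> S'" "\<pi> s = a" using preimage reduced_gens_SB by blast
      then show "a \<in> \<pi> ` T" using a by (auto simp: T_def)
    qed (auto simp: T_def)
    moreover have "inj_on \<pi> T" using bij TS by (auto simp: bij_betw_def intro: inj_on_subset)
    ultimately show ?thesis by (simp add: bij_betw_def)
  qed
  then have bT: "bij_betw (drop_lamps \<circ> \<pi>) T \<Sigma>" using drop_lamps_bij by (rule bij_betw_trans)
  have hT: "drop_lamps \<circ> \<pi> \<in> hom \<Delta> \<Gamma>" using pi drop_lamps_hom by (auto simp: hom_def Pi_iff)
  have "map_pmf (drop_lamps \<circ> \<pi>) \<mu>' = map_pmf drop_lamps (map_pmf (wprod GB) (step_words bool_grp d H))"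
    by (simp only: pmf.map_comp[symmetric] mu(4))
  also have "\<dots> = map_pmf (wprod \<Gamma>) (map_pmf (map drop_lamps) (step_words bool_grp d H))"
    unfolding map_pmf_comp
    by (rule map_pmf_cong[OF refl]) (simp only: L.wprod_Gamma wprod_Gamma drop_wprod[OF L.step_words_Sigma])
  also have "\<dots> = step_law F d H" unfolding drop_lamps_words step_law_words ..
  finally have law: "map_pmf (drop_lamps \<circ> \<pi>) \<mu>' = step_law F d H" .
  have ns': "\<exists>ns :: nat \<Rightarrow> nat. strict_mono ns \<and> (\<forall>i. drift \<Delta> T \<mu>' (ns i) \<le> L1 (ns i))"
  proof -
    obtain ns :: "nat \<Rightarrow> nat" where nn: "strict_mono ns" "\<And>i. drift \<Delta> S' \<mu>' (ns i) \<le> L1 (ns i) / 2" using ns by blast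
    have "drift \<Delta> T \<mu>' (ns i) \<le> L1 (ns i)" for i using change(2)[of "ns i"] nn(2)[of i] by linarith
    then show ?thesis using nn(1) by blast
  qed
  have ms': "\<exists>ms :: nat \<Rightarrow> nat. strict_mono ms \<and> (\<forall>i. L2 (ms i) \<le> drift \<Delta> T \<mu>' (ms i))"
  proof -
    obtain ms :: "nat \<Rightarrow> nat" where mm: "strict_mono ms" "\<And>i. L2 (ms i) \<le> drift \<Delta> S' \<mu>' (ms i)" using ms by blast
    have "L2 (ms i) \<le> drift \<Delta> T \<mu>' (ms i)" for i using change(3)[of "ms i"] mm(2)[of i] by linarith
    then show ?thesis using mm(1) by blast
  qed
  show ?thesis
    by (rule exI[of _ \<Delta>], rule exI[of _ T], rule exI[of _ "drop_lamps \<circ> \<pi>"], rule exI[of _ \<mu>'],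
        intro conjI change(1) hT bT mu(1-3) law ns' ms')
qed

end

text \<open>If K_k has at most two elements, the sections provided by saturation, at least the
  factorial of d (k+1) many, leave no room for a nontrivial F or for a third child. The locale is
  entered one level further down, where d is known to be 2 and the number of sections has not
  grown.\<close>

lemma (in saturated) degenerate_or_large:
  "(\<forall>k\<ge>4. 3 \<le> card (carrier (Kgrp k))) \<or> (\<exists>k. degenerate d F H k)"
proof (rule disjCI)
  assume "\<nexists>k. degenerate d F H k"
  show "\<forall>k\<ge>4. 3 \<le> card (carrier (Kgrp k))"
  proof (rule ccontr)
    assume "\<not> (\<forall>k\<ge>4. 3 \<le> card (carrier (Kgrp k)))"
    then obtain k where "card (sec k ` H) * card (carrier F) < 3" by (auto simp: card_Kgrp not_le)
    then have k: "card (sec k ` H) * card (carrier F) \<le> 2" by simp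
    have f: "fact (d (Suc k)) \<le> card (sec k ` H)" by (rule card_sec_ge) simp
    have s: "2 \<le> card (sec k ` H)" using f fact_d_ge2[of "Suc k"] by linarith
    have F1: "1 \<le> card (carrier F)" using F_fin F.one_closed by (auto simp: Suc_le_eq card_gt_0_iff)
    have "2 * card (carrier F) \<le> 2" using mult_le_mono1[OF s, of "card (carrier F)"] k by linarith
    then have "card (carrier F) = 1" using F1 by simp
    then obtain e where "carrier F = {e}" by (rule card_1_singletonE)
    then have triv: "carrier F = {\<one>\<^bsub>F\<^esub>}" using F.one_closed by simp
    have s2: "card (sec k ` H) \<le> 2" using k \<open>card (carrier F) = 1\<close> by simp
    have "d (Suc k) = 2"
    proof (rule ccontr)
      assume "d (Suc k) \<noteq> 2"
      then have "3 \<le> d (Suc k)" using d_ge2[of "Suc k"] by simp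
      then have "fact 3 \<le> (fact (d (Suc k)) :: nat)" by (rule fact_mono_nat)
      moreover have "fact 3 = (6 :: nat)" by (simp add: eval_nat_numeral)
      ultimately show False using f s2 by linarith
    qed
    then have "degenerate d F H (Suc k)"
      using triv card_sec_Suc[of k] s2 by unfold_locales auto
    then show False using \<open>\<nexists>k. degenerate d F H k\<close> by blast
  qed
qed

theorem mainTheorem15:
  fixes d :: "nat \<Rightarrow> nat"
    and F :: "('f, 'm) monoid_scheme"
    and H :: "(nat list \<Rightarrow> nat list) set"
    and L1 L2 :: "nat \<Rightarrow> real"
  assumes d_ge2: "\<forall>j. 2 \<le> d j"
    and d_bdd: "\<exists>B. \<forall>j. d j \<le> B"
    and F_grp: "group F" and F_fin: "finite (carrier F)"
    and H_sub: "subgroup H (aut_group d)" and H_fin: "finite H"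
    and H_Hd: "H \<subseteq> H_group_set d"
    and H_unif: "\<forall>l t. 1 \<le> l \<longrightarrow> 2 \<le> t \<longrightarrow> t \<le> d (l - 1) \<longrightarrow>
        map_pmf (\<lambda>h. aut_label d h (replicate (l - 1) 1 @ [t])) (pmf_of_set H)
          = pmf_of_set {p. p permutes {1..d l}}"
    and L1_pos: "\<forall>n. 0 < L1 n" and L2_pos: "\<forall>n. 0 < L2 n"
    and L1_lim: "filterlim (\<lambda>n. L1 n / drift (Gamma_grp F d H) (Sigma_set F d H) (step_law F d H) n)
                   at_top sequentially"
    and L2_lim: "(\<lambda>n. L2 n / real n) \<longlonglongrightarrow> 0"
  shows "\<exists>(\<Delta> :: nat monoid) \<Sigma>' (\<pi> :: nat \<Rightarrow> ((nat \<Rightarrow> nat) \<Rightarrow> 'f) \<times> (nat list \<Rightarrow> nat list))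
           (\<mu>' :: nat pmf) (C :: real).
      group \<Delta> \<and> finite \<Sigma>' \<and> \<Sigma>' \<subseteq> carrier \<Delta> \<and> (\<forall>s\<in>\<Sigma>'. inv\<^bsub>\<Delta>\<^esub> s \<in> \<Sigma>')
      \<and> generate \<Delta> \<Sigma>' = carrier \<Delta>
      \<and> \<pi> \<in> hom \<Delta> (Gamma_grp F d H) \<and> \<pi> ` carrier \<Delta> = carrier (Gamma_grp F d H)
      \<and> bij_betw \<pi> \<Sigma>' (Sigma_set F d H)
      \<and> set_pmf \<mu>' \<subseteq> carrier \<Delta> \<and> finite (set_pmf \<mu>')
      \<and> (\<forall>x\<in>carrier \<Delta>. pmf \<mu>' (inv\<^bsub>\<Delta>\<^esub> x) = pmf \<mu>' x)
      \<and> map_pmf \<pi> \<mu>' = step_law F d H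
      \<and> (\<forall>n. drift (Gamma_grp F d H) (Sigma_set F d H) (step_law F d H) n \<le> drift \<Delta> \<Sigma>' \<mu>' n
             \<and> drift \<Delta> \<Sigma>' \<mu>' n \<le> C * real n)
      \<and> (\<exists>ns :: nat \<Rightarrow> nat. strict_mono ns \<and> (\<forall>i. drift \<Delta> \<Sigma>' \<mu>' (ns i) \<le> L1 (ns i)))
      \<and> (\<exists>ms :: nat \<Rightarrow> nat. strict_mono ms \<and> (\<forall>i. L2 (ms i) \<le> drift \<Delta> \<Sigma>' \<mu>' (ms i)))"
proof -
  interpret S: saturated d F H
    by (rule saturated.intro) (use assms in simp_all)
  from S.degenerate_or_large show ?thesis
  proof
    assume large: "\<forall>k\<ge>4. 3 \<le> card (carrier (S.Kgrp k))"
    interpret A: approximated_group "Gamma_grp F d H" "Sigma_set F d H" "step_words F d H" S.act S.Zs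
      by (rule S.approximated) (use large in blast)
    have step: "A.step = step_law F d H" by (rule S.step_law_words[symmetric])
    have "\<exists>n\<ge>N. drift (Gamma_grp F d H) (Sigma_set F d H) A.step n + K \<le> L1 n" for K N
      using S.growth_condition[OF L1_lim, of N 1 K] unfolding step by simp
    from A.diagonal_product[OF this L2_lim, unfolded step] show ?thesis
      by (elim exE conjE) (rule S.oscillating_extension; assumption?; blast)
  next
    assume "\<exists>k. degenerate d F H k"
    then obtain k where "degenerate d F H k" by blast
    then interpret D: degenerate d F H k .
    from D.oscillation[OF L1_lim L2_lim] show ?thesis
      by (elim exE conjE) (rule S.oscillating_extension; assumption?; blast)
  qed
qed

end
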